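(* Let $\lambda,\mu>0$, let $q\neq 0$ and $\rho$ be real constants, let $\sigma^{+-},\sigma^{-+}$ be (possibly spatially varying) coupling functions on $[0,1]$, let $\tau=\frac1\lambda+\frac1\mu$, and consider the system $$u_t+\lambda u_x=\sigma^{+-}(x)v,\qquad v_t-\mu v_x=\sigma^{-+}(x)u,\qquad t>0,\ x\in[0,1],$$ $$u(t,0)=q\,v(t,0),\qquad v(t,1)=\rho\,u(t,1)+U(t),$$ with initial conditions in $L^2([0,1])$ and control input $U$. Let $(\alpha,\beta)$ be the image of $(u,v)$ under the invertible Volterra transformation $$\alpha(t,x)=u(t,x)-\int_0^x\big(K^{uu}(x,\xi)u(t,\xi)+K^{uv}(x,\xi)v(t,\xi)\big)d\xi,$$ $$\beta(t,x)=v(t,x)-\int_0^x\big(K^{vu}(x,\xi)u(t,\xi)+K^{vv}(x,\xi)v(t,\xi)\big)d\xi ,$$ with kernels defined in the context. Then for all $x\in[0,1]$ and all $t>0$, $$\alpha(t,x)=q\,\beta\big(t-\tfrac x\lambda-\tfrac1\mu,1\big),\qquad \beta(t,x)=\beta\big(t-\tfrac{1-x}{\mu},1\big),$$ and $\beta(\cdot,1)$ satisfies the neutral equation with distributed delay $$\beta(t,1)=q\rho\,\beta(t-\tau,1)+U(t)-\int_0^\tau\tilde N(\nu)\,\beta(t-\nu,1)\,d\nu ,$$ where $$\tilde N(\nu)=\lambda\,N^\alpha\!\left(\lambda\nu-\tfrac{\lambda}{\mu}\right)h_{[\frac1\mu,\tau]}(\nu)+\mu\,N^\beta(1-\mu\nu)\,h_{[0,\frac1\mu]}(\nu),$$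 with $N^\alpha,N^\beta$ defined in the context and $h_I$ the indicator function of the interval $I$. Since the transformation is independent of the control law, the class of systems above is equivalent to a class of neutral systems with distributed delay, as given by this equation.
   Context: Backstepping kernels: on $\mathcal T=\{(x,\xi)\in[0,1]^2:\xi\le x\}$, $K^{uu},K^{uv},K^{vu},K^{vv}\in L^\infty(\mathcal T)$ are the unique solution of $\lambda K^{uu}_x+\lambda K^{uu}_\xi=-K^{uv}(x,\xi)\sigma^{-+}(\xi)$, $\lambda K^{uv}_x-\mu K^{uv}_\xi=-K^{uu}(x,\xi)\sigma^{+-}(\xi)$, $\mu K^{vu}_x-\lambda K^{vu}_\xi=K^{vv}(x,\xi)\sigma^{-+}(\xi)$, $\mu K^{vv}_x+\mu K^{vv}_\xi=K^{vu}(x,\xi)\sigma^{+-}(\xi)$, with boundary conditions $K^{vu}(x,x)=-\frac{\sigma^{-+}(x)}{\lambda+\mu}$, $K^{vv}(x,0)=\frac{\lambda q}{\mu}K^{vu}(x,0)$, $K^{uv}(x,x)=\frac{\sigma^{+-}(x)}{\lambda+\mu}$, $K^{uv}(x,0)=\frac{\lambda q}{\mu}K^{uu}(x,0)$. It is a known result (Coron, Vazquez, Krstic, Bastin 2013) that this solution exists and is unique and that the Volterra transformation is invertible, with inverse $u(t,x)=\alpha(t,x)+\int_0^x(L^{\alpha\alpha}(x,\xi)\alpha(t,\xi)+L^{\alpha\beta}(x,\xi)\beta(t,\xi))d\xi$, $v(t,x)=\beta(t,x)+\int_0^x(L^{\beta\alpha}(x,\xi)\alpha(t,\xi)+L^{\beta\beta}(x,\xi)\beta(t,\xi))d\xi$,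 where $L^{\alpha\alpha},L^{\alpha\beta},L^{\beta\alpha},L^{\beta\beta}\in L^\infty(\mathcal T)$. Define $N^\alpha(\xi)=L^{\beta\alpha}(1,\xi)-\rho L^{\alpha\alpha}(1,\xi)$ and $N^\beta(\xi)=L^{\beta\beta}(1,\xi)-\rho L^{\alpha\beta}(1,\xi)$.
   Formalization: The first term of Ñ is corrected to qλN^α(λν−λ/μ)h_{[1/μ,τ]}(ν); the printed formula lacks the factor q (forced by α=qβ(t−x/λ−1/μ,1)) and fails for q≠1, e.g. ρ=0, σ^{+-}=0, σ^{-+} a nonzero constant. *)

theory Defs
  imports "HOL-Analysis.Analysis"
begin

text \<open>All functions are honest pointwise-defined Borel functions rather than classes modulo null
  sets: the statement uses boundary traces such as \<open>\<beta>(t,1)\<close> and \<open>L(1,\<xi>)\<close>.\<close>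

definition L2_01 :: "(real \<Rightarrow> real) \<Rightarrow> bool" where
  "L2_01 f \<longleftrightarrow> set_borel_measurable borel {0..1} f \<and>
     set_integrable lborel {0..1} (\<lambda>x. (f x)\<^sup>2)"

definition Linf_01 :: "(real \<Rightarrow> real) \<Rightarrow> bool" where
  "Linf_01 f \<longleftrightarrow> set_borel_measurable borel {0..1} f \<and> (\<exists>C. \<forall>x\<in>{0..1}. \<bar>f x\<bar> \<le> C)"

definition triangle :: "(real \<times> real) set" where
  "triangle = {(x, \<xi>). 0 \<le> \<xi> \<and> \<xi> \<le> x \<and> x \<le> 1}"

definition Linf_triangle :: "(real \<Rightarrow> real \<Rightarrow> real) \<Rightarrow> bool" where
  "Linf_triangle K \<longleftrightarrow> set_borel_measurable borel triangle (case_prod K) \<and>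
     (\<exists>C. \<forall>(x, \<xi>)\<in>triangle. \<bar>K x \<xi>\<bar> \<le> C)"

text \<open>\<open>a f\<^sub>y + b f\<^sub>z = g\<close> on \<open>D\<close> in the sense of broad solutions: along every segment of a
  characteristic contained in \<open>D\<close>, \<open>f\<close> is the integral of \<open>g\<close>. No corner compatibility is
  needed, and for arbitrary Borel representatives of square-integrable data such solutions exist,
  because a characteristic of one family crosses those of the other transversally.\<close>

definition transport_eq ::
  "(real \<times> real) set \<Rightarrow> real \<Rightarrow> real \<Rightarrow> (real \<Rightarrow> real \<Rightarrow> real) \<Rightarrow> (real \<Rightarrow> real \<Rightarrow> real) \<Rightarrow> bool" where
  "transport_eq D a b f g \<longleftrightarrow>
     (\<forall>y z s. 0 \<le> s \<longrightarrow> (\<forall>r\<in>{0..s}. (y + a * r, z + b * r) \<in> D) \<longrightarrow>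
        set_integrable lborel {0..s} (\<lambda>r. g (y + a * r) (z + b * r)) \<and>
        f (y + a * s) (z + b * s) - f y z = (LBINT r:{0..s}. g (y + a * r) (z + b * r)))"

definition half_strip :: "(real \<times> real) set" where
  "half_strip = {(t, x). 0 \<le> t \<and> 0 \<le> x \<and> x \<le> 1}"

definition L2_continuous :: "(real \<Rightarrow> real \<Rightarrow> real) \<Rightarrow> bool" where
  "L2_continuous w \<longleftrightarrow> (\<forall>t\<ge>0. L2_01 (w t)) \<and>
     (\<forall>t\<ge>0. ((\<lambda>s. LBINT x:{0..1}. (w s x - w t x)\<^sup>2) \<longlongrightarrow> 0) (at t within {0..}))"

text \<open>Arguments: \<open>lam\<close> is the speed \<open>\<lambda>\<close>, and \<open>spm\<close>, \<open>smp\<close> are the couplings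
  \<open>\<sigma>\<^sup>+\<^sup>-\<close>, \<open>\<sigma>\<^sup>-\<^sup>+\<close>.\<close>

definition hyperbolic_solution ::
  "real \<Rightarrow> real \<Rightarrow> real \<Rightarrow> real \<Rightarrow> (real \<Rightarrow> real) \<Rightarrow> (real \<Rightarrow> real) \<Rightarrow> (real \<Rightarrow> real) \<Rightarrow>
   (real \<Rightarrow> real) \<Rightarrow> (real \<Rightarrow> real) \<Rightarrow> (real \<Rightarrow> real \<Rightarrow> real) \<Rightarrow> (real \<Rightarrow> real \<Rightarrow> real) \<Rightarrow> bool" where
  "hyperbolic_solution lam \<mu> q \<rho> spm smp U u0 v0 u v \<longleftrightarrow>
     set_borel_measurable borel half_strip (case_prod u) \<and>
     set_borel_measurable borel half_strip (case_prod v) \<and>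
     L2_continuous u \<and> L2_continuous v \<and>
     transport_eq half_strip 1 lam u (\<lambda>t x. spm x * v t x) \<and>
     transport_eq half_strip 1 (- \<mu>) v (\<lambda>t x. smp x * u t x) \<and>
     (\<forall>t>0. u t 0 = q * v t 0) \<and>
     (\<forall>t>0. v t 1 = \<rho> * u t 1 + U t) \<and>
     L2_01 u0 \<and> L2_01 v0 \<and>
     (AE x in lborel. x \<in> {0..1} \<longrightarrow> u 0 x = u0 x \<and> v 0 x = v0 x)"

definition backstepping_kernels ::
  "real \<Rightarrow> real \<Rightarrow> real \<Rightarrow> (real \<Rightarrow> real) \<Rightarrow> (real \<Rightarrow> real) \<Rightarrow> (real \<Rightarrow> real \<Rightarrow> real) \<Rightarrow>
   (real \<Rightarrow> real \<Rightarrow> real) \<Rightarrow> (real \<Rightarrow> real \<Rightarrow> real) \<Rightarrow> (real \<Rightarrow> real \<Rightarrow> real) \<Rightarrow> bool" where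
  "backstepping_kernels lam \<mu> q spm smp Kuu Kuv Kvu Kvv \<longleftrightarrow>
     Linf_triangle Kuu \<and> Linf_triangle Kuv \<and> Linf_triangle Kvu \<and> Linf_triangle Kvv \<and>
     transport_eq triangle lam lam Kuu (\<lambda>x \<xi>. - Kuv x \<xi> * smp \<xi>) \<and>
     transport_eq triangle lam (- \<mu>) Kuv (\<lambda>x \<xi>. - Kuu x \<xi> * spm \<xi>) \<and>
     transport_eq triangle \<mu> (- lam) Kvu (\<lambda>x \<xi>. Kvv x \<xi> * smp \<xi>) \<and>
     transport_eq triangle \<mu> \<mu> Kvv (\<lambda>x \<xi>. Kvu x \<xi> * spm \<xi>) \<and>
     (\<forall>x\<in>{0..1}.
        Kvu x x = - smp x / (lam + \<mu>) \<and>
        Kvv x 0 = lam * q / \<mu> * Kvu x 0 \<and>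
        Kuv x x = spm x / (lam + \<mu>) \<and>
        Kuv x 0 = lam * q / \<mu> * Kuu x 0)"

definition volterra ::
  "(real \<Rightarrow> real \<Rightarrow> real) \<Rightarrow> (real \<Rightarrow> real \<Rightarrow> real) \<Rightarrow> (real \<Rightarrow> real) \<Rightarrow> (real \<Rightarrow> real) \<Rightarrow> real \<Rightarrow> real" where
  "volterra A B f g x = (LBINT \<xi>:{0..x}. A x \<xi> * f \<xi> + B x \<xi> * g \<xi>)"

text \<open>The inversion formulas hold at every \<open>x\<close>, including \<open>x = 1\<close>; this determines the traces
  \<open>L(1,\<cdot>)\<close> almost everywhere.\<close>

definition inverse_kernels ::
  "(real \<Rightarrow> real \<Rightarrow> real) \<Rightarrow> (real \<Rightarrow> real \<Rightarrow> real) \<Rightarrow> (real \<Rightarrow> real \<Rightarrow> real) \<Rightarrow> (real \<Rightarrow> real \<Rightarrow> real) \<Rightarrow>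
   (real \<Rightarrow> real \<Rightarrow> real) \<Rightarrow> (real \<Rightarrow> real \<Rightarrow> real) \<Rightarrow> (real \<Rightarrow> real \<Rightarrow> real) \<Rightarrow> (real \<Rightarrow> real \<Rightarrow> real) \<Rightarrow> bool" where
  "inverse_kernels Kuu Kuv Kvu Kvv Laa Lab Lba Lbb \<longleftrightarrow>
     Linf_triangle Laa \<and> Linf_triangle Lab \<and> Linf_triangle Lba \<and> Linf_triangle Lbb \<and>
     (\<forall>f g. L2_01 f \<and> L2_01 g \<longrightarrow>
        (let a = (\<lambda>x. f x - volterra Kuu Kuv f g x);
             b = (\<lambda>x. g x - volterra Kvu Kvv f g x)
         in \<forall>x\<in>{0..1}. f x = a x + volterra Laa Lab a b x \<and>
                        g x = b x + volterra Lba Lbb a b x)) \<and>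
     (\<forall>a b. L2_01 a \<and> L2_01 b \<longrightarrow>
        (let f = (\<lambda>x. a x + volterra Laa Lab a b x);
             g = (\<lambda>x. b x + volterra Lba Lbb a b x)
         in \<forall>x\<in>{0..1}. a x = f x - volterra Kuu Kuv f g x \<and>
                        b x = g x - volterra Kvu Kvv f g x))"

text \<open>The function \<open>t \<mapsto> \<beta>(t,1)\<close>, extended to \<open>[-\<tau>, 0)\<close>, where \<open>\<tau> = 1/\<lambda> + 1/\<mu>\<close>, by following
  the characteristics of the target system backwards from the initial data (this is where
  \<open>q \<noteq> 0\<close> is needed). It makes the delayed values meaningful for \<open>0 < t < \<tau>\<close>.\<close>

definition boundary_history ::
  "real \<Rightarrow> real \<Rightarrow> real \<Rightarrow> (real \<Rightarrow> real \<Rightarrow> real) \<Rightarrow> (real \<Rightarrow> real \<Rightarrow> real) \<Rightarrow> real \<Rightarrow> real" where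
  "boundary_history lam \<mu> q \<alpha> \<beta> t =
     (if t \<ge> 0 then \<beta> t 1
      else if t > - (1 / \<mu>) then \<beta> 0 (1 + \<mu> * t)
      else \<alpha> 0 (- lam * (t + 1 / \<mu>)) / q)"

definition N_alpha ::
  "real \<Rightarrow> (real \<Rightarrow> real \<Rightarrow> real) \<Rightarrow> (real \<Rightarrow> real \<Rightarrow> real) \<Rightarrow> real \<Rightarrow> real" where
  "N_alpha \<rho> Laa Lba \<xi> = Lba 1 \<xi> - \<rho> * Laa 1 \<xi>"

definition N_beta ::
  "real \<Rightarrow> (real \<Rightarrow> real \<Rightarrow> real) \<Rightarrow> (real \<Rightarrow> real \<Rightarrow> real) \<Rightarrow> real \<Rightarrow> real" where
  "N_beta \<rho> Lab Lbb \<xi> = Lbb 1 \<xi> - \<rho> * Lab 1 \<xi>"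

text \<open>The factor \<open>q\<close> in the first term arises on substituting
  \<open>\<alpha>(t,\<xi>) = q \<beta>(t - \<xi>/\<lambda> - 1/\<mu>, 1)\<close> into the integral of \<open>N\<^sup>\<alpha>(\<xi>) \<alpha>(t,\<xi>)\<close> over \<open>\<xi> \<in> [0,1]\<close>.
  It is missing from the printed formula, which is correct only if \<open>q = 1\<close> or \<open>N\<^sup>\<alpha> = 0\<close> a.e.\<close>

definition N_tilde ::
  "real \<Rightarrow> real \<Rightarrow> real \<Rightarrow> real \<Rightarrow> (real \<Rightarrow> real \<Rightarrow> real) \<Rightarrow> (real \<Rightarrow> real \<Rightarrow> real) \<Rightarrow>
   (real \<Rightarrow> real \<Rightarrow> real) \<Rightarrow> (real \<Rightarrow> real \<Rightarrow> real) \<Rightarrow> real \<Rightarrow> real" where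
  "N_tilde lam \<mu> q \<rho> Laa Lab Lba Lbb \<nu> =
     q * lam * N_alpha \<rho> Laa Lba (lam * \<nu> - lam / \<mu>) * indicator {1 / \<mu> .. 1 / lam + 1 / \<mu>} \<nu> +
     \<mu> * N_beta \<rho> Lab Lbb (1 - \<mu> * \<nu>) * indicator {0 .. 1 / \<mu>} \<nu>"

definition neutral_solution ::
  "real \<Rightarrow> real \<Rightarrow> real \<Rightarrow> (real \<Rightarrow> real) \<Rightarrow> (real \<Rightarrow> real) \<Rightarrow> (real \<Rightarrow> real) \<Rightarrow> bool" where
  "neutral_solution q \<rho> \<tau> N U B \<longleftrightarrow>
     set_borel_measurable borel {- \<tau>..} B \<and>
     (\<forall>T. set_integrable lborel {- \<tau>..T} (\<lambda>t. (B t)\<^sup>2)) \<and>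
     (\<forall>t>0. set_integrable lborel {0..\<tau>} (\<lambda>\<nu>. N \<nu> * B (t - \<nu>)) \<and>
        B t = q * \<rho> * B (t - \<tau>) + U t - (LBINT \<nu>:{0..\<tau>}. N \<nu> * B (t - \<nu>)))"

end

theory Submission
  imports Defs
begin

text \<open>Write \<open>V f g = \<integral>\<^sub>0\<^sup>x (K\<^sup>u\<^sup>u f + K\<^sup>u\<^sup>v g) d\<xi>\<close>. If \<open>f\<close> and \<open>g\<close> have derivatives \<open>F\<close> and \<open>G\<close> along their characteristics
  and \<open>f = q g\<close> at \<open>x = 0\<close>, then the kernel equations make \<open>V f g\<close> differentiable along the
  characteristics of \<open>f\<close>, with derivative \<open>\<sigma>\<^sup>+\<^sup>- g + V (F - \<sigma>\<^sup>+\<^sup>- g) (G - \<sigma>\<^sup>-\<^sup>+ f)\<close>: this is Reynolds' transport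
  theorem for the products of kernel and state, in which all boundary terms cancel but one.

  For a solution the defects \<open>F - \<sigma>\<^sup>+\<^sup>- g\<close> and \<open>G - \<sigma>\<^sup>-\<^sup>+ f\<close> vanish, so \<open>\<alpha>\<close> and \<open>\<beta>\<close> are constant along
  characteristics; inserting this into the inverse transformation at \<open>x = 1\<close> gives the neutral
  equation. Conversely, a solution \<open>B\<close> of the neutral equation determines \<open>\<alpha>\<close> and \<open>\<beta>\<close>, and \<open>(u, v)\<close>
  is their image under the inverse transformation. No equation for the inverse kernels is needed to
  see that \<open>(u, v)\<close> solves the original system: \<open>(u, v)\<close> is the limit of the Neumann iteration
  \<open>f' = \<alpha> + V f g\<close> for the direct transformation, and by the formula above the defects of the iterates
  satisfy the same contraction estimate as the iterates themselves.\<close>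

section \<open>Broad solutions of transport equations\<close>

text \<open>Along a characteristic x + lam r the interval of integration of \<open>V\<close> grows,
  so the space-time picture is a trapezoid. The product \<open>Kuu f\<close> moves parallel to the
  slanted side, and nothing crosses that side. \<open>Kuv g\<close> moves with speed -\<mu> and
  crosses it with relative speed lam + \<mu>; since (lam + \<mu>) Kuv(x,x) equals the coupling, this
  is the one surviving boundary term. At \<xi> = 0 the fluxes \<open>lam Kuu f\<close> and
  \<open>\<mu> Kuv g\<close> agree, by the kernel condition there and f = q g. Inside, the source
  terms of the kernels supply exactly the couplings subtracted in the defects. The obstacle is
  regularity: states have values but no derivatives, so every step is an integral identity obtained
  from Fubini, and integrability of traces and along transversal characteristics has to be carried
  along as extra data. The Neumann iteration converges although \<alpha> and \<beta> may be
  unbounded, because Volterra operators send integrable functions to bounded ones and only bounded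
  differences are estimated.\<close>

lemma lborel_pair_sets_borel [simp]:
  "sets ((lborel :: real measure) \<Otimes>\<^sub>M (lborel :: real measure)) = sets borel"
  by (metis lborel_prod sets_lborel)

lemma borel_measurable_lborel_pair_iff:
  "f \<in> borel_measurable ((lborel :: real measure) \<Otimes>\<^sub>M (lborel :: real measure)) \<longleftrightarrow> f \<in> borel_measurable borel"
  unfolding lborel_prod by simp

text \<open>For fixed \<open>r\<close> the inner substitution is a translation, so both iterated
  integrals agree by Fubini once absolute integrability of the sheared function is known. This
  trades an area integral for an integral over the parallel lines of slope \<open>c\<close>,
  labelled by their position \<eta> at time 0.\<close>

lemma shear_integral:
  fixes \<Psi> :: "real \<Rightarrow> real \<Rightarrow> real"
  assumes int: "integrable (lborel \<Otimes>\<^sub>M lborel) (case_prod \<Psi>)"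
  shows "integrable lborel (\<lambda>\<eta>. LBINT r. \<Psi> r (\<eta> + c * r))"
    and "(LBINT \<eta>. LBINT r. \<Psi> r (\<eta> + c * r)) = (LBINT r. LBINT \<xi>. \<Psi> r \<xi>)"
proof -
  have m: "case_prod \<Psi> \<in> borel_measurable (borel \<Otimes>\<^sub>M borel)"
    using borel_measurable_integrable[OF int] by simp
  have m': "case_prod (\<lambda>r \<eta>. \<Psi> r (\<eta> + c * r)) \<in> borel_measurable (borel \<Otimes>\<^sub>M borel)"
  proof -
    have "(\<lambda>p. case_prod \<Psi> (fst p, snd p + c * fst p)) \<in> borel_measurable (borel \<Otimes>\<^sub>M borel)"
      by (rule measurable_compose[OF _ m]) simp
    then show ?thesis by (simp add: case_prod_beta')
  qed
  have tr: "(\<integral>\<eta>. h (\<eta> + d) \<partial>lborel) = (\<integral>\<eta>. h \<eta> \<partial>lborel)" for h :: "real \<Rightarrow> real" and d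
    using lborel_integral_real_affine[of 1 h d] by (simp add: add.commute)
  have tri: "integrable lborel h \<Longrightarrow> integrable lborel (\<lambda>\<eta>. h (\<eta> + d))" for h :: "real \<Rightarrow> real" and d
    using lborel_integrable_real_affine[of h 1 d] by (simp add: add.commute)
  have int': "integrable (lborel \<Otimes>\<^sub>M lborel) (case_prod (\<lambda>r \<eta>. \<Psi> r (\<eta> + c * r)))"
  proof (rule lborel_pair.Fubini_integrable)
    show "case_prod (\<lambda>r \<eta>. \<Psi> r (\<eta> + c * r)) \<in> borel_measurable (lborel \<Otimes>\<^sub>M lborel)"
      using m' by simp
    have "integrable lborel (\<lambda>x. LBINT y. norm (\<Psi> x y))"
      using lborel_pair.integrable_fst[of "\<lambda>x y. norm (\<Psi> x y)"] integrable_norm[OF int]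
      by (simp add: case_prod_beta')
    then show "integrable lborel (\<lambda>x. LBINT y. norm (case (x, y) of (r, \<eta>) \<Rightarrow> \<Psi> r (\<eta> + c * r)))"
      by (simp add: tr[of "\<lambda>z. norm (\<Psi> x z)" for x, simplified])
    show "AE x in lborel. integrable lborel (\<lambda>y. case (x, y) of (r, \<eta>) \<Rightarrow> \<Psi> r (\<eta> + c * r))"
      using lborel_pair.AE_integrable_fst[OF int] by eventually_elim (simp add: tri)
  qed
  show "integrable lborel (\<lambda>\<eta>. LBINT r. \<Psi> r (\<eta> + c * r))"
    by (rule lborel_pair.integrable_snd[OF int'])
  show "(LBINT \<eta>. LBINT r. \<Psi> r (\<eta> + c * r)) = (LBINT r. LBINT \<xi>. \<Psi> r \<xi>)"
    using lborel_pair.Fubini_integral[OF int'] by (simp add: tr)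
qed

lemma transport_eqD:
  assumes "transport_eq D a b f g" "0 \<le> s" "\<And>r. 0 \<le> r \<Longrightarrow> r \<le> s \<Longrightarrow> (y + a * r, z + b * r) \<in> D"
  shows "set_integrable lborel {0..s} (\<lambda>r. g (y + a * r) (z + b * r))"
    and "f (y + a * s) (z + b * s) = f y z + (LBINT r:{0..s}. g (y + a * r) (z + b * r))"
  using assms unfolding transport_eq_def by (force simp: algebra_simps)+

lemma transport_eqI:
  assumes "\<And>y z s. 0 \<le> s \<Longrightarrow> (\<And>r. 0 \<le> r \<Longrightarrow> r \<le> s \<Longrightarrow> (y + a * r, z + b * r) \<in> D) \<Longrightarrow>
     set_integrable lborel {0..s} (\<lambda>r. g (y + a * r) (z + b * r)) \<and>
     f (y + a * s) (z + b * s) - f y z = (LBINT r:{0..s}. g (y + a * r) (z + b * r))"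
  shows "transport_eq D a b f g"
  using assms unfolding transport_eq_def by auto

lemma transport_eq_cong:
  assumes "\<And>y z. (y, z) \<in> D \<Longrightarrow> f y z = f' y z" "\<And>y z. (y, z) \<in> D \<Longrightarrow> g y z = g' y z"
    and tr: "transport_eq D a b f g"
  shows "transport_eq D a b f' g'"
proof (rule transport_eqI)
  fix y z s :: real
  assume s: "0 \<le> s" and D: "\<And>r. 0 \<le> r \<Longrightarrow> r \<le> s \<Longrightarrow> (y + a * r, z + b * r) \<in> D"
  note T = transport_eqD[OF tr s D]
  have "set_integrable lborel {0..s} (\<lambda>r. g' (y + a * r) (z + b * r))"
    using T(1) by (rule set_integrable_cong[THEN iffD1, rotated 3]) (auto simp: assms(2) D)
  moreover have "(LBINT r:{0..s}. g' (y + a * r) (z + b * r)) = (LBINT r:{0..s}. g (y + a * r) (z + b * r))"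
    by (rule set_lebesgue_integral_cong) (auto simp: assms(2) D)
  moreover have "f (y + a * s) (z + b * s) = f' (y + a * s) (z + b * s)" "f y z = f' y z"
    using D[of s] D[of 0] s by (auto simp: assms(1))
  ultimately show "set_integrable lborel {0..s} (\<lambda>r. g' (y + a * r) (z + b * r)) \<and>
     f' (y + a * s) (z + b * s) - f' y z = (LBINT r:{0..s}. g' (y + a * r) (z + b * r))"
    using T by simp
qed

lemma transport_eq_add:
  assumes "transport_eq D a b f g" "transport_eq D a b f' g'"
  shows "transport_eq D a b (\<lambda>y z. f y z + f' y z) (\<lambda>y z. g y z + g' y z)"
proof (rule transport_eqI)
  fix y z s :: real
  assume s: "0 \<le> s" and D: "\<And>r. 0 \<le> r \<Longrightarrow> r \<le> s \<Longrightarrow> (y + a * r, z + b * r) \<in> D"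
  note T = transport_eqD[OF assms(1) s D] transport_eqD[OF assms(2) s D]
  then show "set_integrable lborel {0..s} (\<lambda>r. g (y + a * r) (z + b * r) + g' (y + a * r) (z + b * r)) \<and>
     f (y + a * s) (z + b * s) + f' (y + a * s) (z + b * s) - (f y z + f' y z) =
     (LBINT r:{0..s}. g (y + a * r) (z + b * r) + g' (y + a * r) (z + b * r))"
    using T by (simp add: set_integral_add)
qed

lemma transport_eq_cmult:
  assumes "transport_eq D a b f g"
  shows "transport_eq D a b (\<lambda>y z. c * f y z) (\<lambda>y z. c * g y z)"
proof (rule transport_eqI)
  fix y z s :: real
  assume s: "0 \<le> s" and D: "\<And>r. 0 \<le> r \<Longrightarrow> r \<le> s \<Longrightarrow> (y + a * r, z + b * r) \<in> D"
  note T = transport_eqD[OF assms(1) s D]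
  then show "set_integrable lborel {0..s} (\<lambda>r. c * g (y + a * r) (z + b * r)) \<and>
     c * f (y + a * s) (z + b * s) - c * f y z =
     (LBINT r:{0..s}. c * g (y + a * r) (z + b * r))"
    using T by (simp add: algebra_simps)
qed

lemma transport_eq_diff:
  assumes "transport_eq D a b f g" "transport_eq D a b f' g'"
  shows "transport_eq D a b (\<lambda>y z. f y z - f' y z) (\<lambda>y z. g y z - g' y z)"
  using transport_eq_add[OF assms(1) transport_eq_cmult[OF assms(2), of "-1"]] by simp

lemma transport_eq_subset:
  assumes "transport_eq D a b f g" "D' \<subseteq> D"
  shows "transport_eq D' a b f g"
  using assms unfolding transport_eq_def by blast

text \<open>Reparametrises the first variable. With \<open>k = lam\<close> it turns a kernel
  equation in (x, \<xi>) into one in (r, \<xi>), where \<open>r\<close> is the time spent on the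
  characteristic x + lam r; with \<open>k = 1\<close> it is a shift of time.\<close>

lemma transport_eq_pullback:
  assumes "transport_eq D (k * a) b f g" "\<And>y z. (y, z) \<in> D' \<Longrightarrow> (y0 + k * y, z) \<in> D"
  shows "transport_eq D' a b (\<lambda>y z. f (y0 + k * y) z) (\<lambda>y z. g (y0 + k * y) z)"
proof (rule transport_eqI)
  fix y z s :: real
  assume s: "0 \<le> s" and D: "\<And>r. 0 \<le> r \<Longrightarrow> r \<le> s \<Longrightarrow> (y + a * r, z + b * r) \<in> D'"
  have "(y0 + k * y + k * a * r, z + b * r) \<in> D" if "0 \<le> r" "r \<le> s" for r
    using assms(2)[OF D[OF that]] by (simp add: algebra_simps)
  note T = transport_eqD[OF assms(1) s this]
  then show "set_integrable lborel {0..s} (\<lambda>r. g (y0 + k * (y + a * r)) (z + b * r)) \<and>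
     f (y0 + k * (y + a * s)) (z + b * s) - f (y0 + k * y) z =
     (LBINT r:{0..s}. g (y0 + k * (y + a * r)) (z + b * r))"
    by (simp add: algebra_simps)
qed

section \<open>Product rule along characteristics\<close>

text \<open>The product rule for absolutely continuous functions, without derivatives: the product
  of the two increments is the integral of \<open>A x * B y\<close> over a square, and the diagonal
  cuts the square into the half \<open>x \<le> y\<close>, which yields the integral of
  \<open>B * (a - a 0)\<close>, and the half \<open>y < x\<close>, which yields that of
  \<open>A * (b - b 0)\<close>.\<close>

lemma AC_mult:
  fixes a b A B :: "real \<Rightarrow> real"
  assumes s: "0 \<le> s" and A: "set_integrable lborel {0..s} A" and B: "set_integrable lborel {0..s} B"
    and a: "\<And>r. 0 \<le> r \<Longrightarrow> r \<le> s \<Longrightarrow> a r = a 0 + (LBINT x:{0..r}. A x)"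
    and b: "\<And>r. 0 \<le> r \<Longrightarrow> r \<le> s \<Longrightarrow> b r = b 0 + (LBINT x:{0..r}. B x)"
  shows "set_integrable lborel {0..s} (\<lambda>r. A r * b r + a r * B r)"
    and "a s * b s - a 0 * b 0 = (LBINT r:{0..s}. A r * b r + a r * B r)"
proof -
  define A' where "A' = (\<lambda>r. indicator {0..s} r * A r)"
  define B' where "B' = (\<lambda>r. indicator {0..s} r * B r)"
  have iA: "integrable lborel A'" and iB: "integrable lborel B'"
    using A B by (simp_all add: A'_def B'_def set_integrable_def)
  have mA[measurable]: "A' \<in> borel_measurable borel" and mB[measurable]: "B' \<in> borel_measurable borel"
    using borel_measurable_integrable[OF iA] borel_measurable_integrable[OF iB] by simp_all
  have int: "integrable (lborel \<Otimes>\<^sub>M lborel) (\<lambda>(x, y). A' x * B' y)"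
  proof (rule lborel_pair.Fubini_integrable)
    show "integrable lborel (\<lambda>x. LBINT y. norm (case (x, y) of (x, y) \<Rightarrow> A' x * B' y))"
      using iA by (simp add: abs_mult)
  qed (use iB in auto)
  have intI: "integrable (lborel \<Otimes>\<^sub>M lborel) (\<lambda>(x, y). indicator {p. P (fst p) (snd p)} (x, y) * (A' x * B' y))"
    if "{p. P (fst p) (snd p)} \<in> sets (lborel \<Otimes>\<^sub>M lborel)" for P
    using integrable_mult_indicator[OF that int] by (simp add: case_prod_beta')
  have sle: "{p. fst p \<le> (snd p :: real)} \<in> sets (lborel \<Otimes>\<^sub>M lborel)"
    unfolding lborel_pair_sets_borel by (intro borel_closed closed_Collect_le continuous_intros)
  have slt: "{p. (snd p :: real) < fst p} \<in> sets (lborel \<Otimes>\<^sub>M lborel)"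
    unfolding lborel_pair_sets_borel by (intro borel_open open_Collect_less continuous_intros)
  note I1 = intI[of "\<lambda>x y. x \<le> y", OF sle]
  note I2 = intI[of "\<lambda>x y. y < x", OF slt]
  have e1: "(LBINT x. indicator {p. fst p \<le> snd p} (x, y) * (A' x * B' y)) = B' y * (a y - a 0)" for y
  proof (cases "y \<in> {0..s}")
    case True
    then have eq: "(\<lambda>x. indicator {p. fst p \<le> snd p} (x, y) * (A' x * B' y)) = (\<lambda>x. B' y * (indicator {0..y} x * A x))"
      by (auto simp: A'_def indicator_def)
    show ?thesis unfolding eq using a[of y] True by (simp add: set_lebesgue_integral_def)
  qed (simp add: B'_def)
  have e2: "(LBINT y. indicator {p. snd p < fst p} (x, y) * (A' x * B' y)) = A' x * (b x - b 0)" for x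
  proof (cases "x \<in> {0..s}")
    case True
    \<comment> \<open>The half-square is open at the diagonal and the interval is closed; they
      differ in the null set y = x.\<close>
    have "(LBINT y. indicator {p. snd p < fst p} (x, y) * (A' x * B' y)) = (LBINT y. A' x * (indicator {0..x} y * B' y))"
    proof (rule integral_cong_AE)
      have "AE y in lborel. y \<noteq> x"
        by (rule AE_lborel_singleton)
      then show "AE y in lborel. indicat_real {p. snd p < fst p} (x, y) * (A' x * B' y) = A' x * (indicat_real {0..x} y * B' y)"
        by eventually_elim (auto simp: indicator_def B'_def)
      have "(\<lambda>y. indicat_real {p. snd p < fst p} (x, y)) = indicator {..<x}"
        by (auto simp: indicator_def fun_eq_iff)
      then show "(\<lambda>y. indicat_real {p. snd p < fst p} (x, y) * (A' x * B' y)) \<in> borel_measurable lborel"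
        by simp
    qed simp
    also have "\<dots> = A' x * (LBINT y. indicator {0..x} y * B y)"
      using True by (auto simp: B'_def indicator_def intro!: Bochner_Integration.integral_cong)
    finally show ?thesis using b[of x] True by (simp add: set_lebesgue_integral_def)
  qed (simp add: A'_def)
  have J1: "integrable lborel (\<lambda>y. B' y * (a y - a 0))"
    using lborel_pair.integrable_snd[OF I1] by (simp add: e1)
  have J2: "integrable lborel (\<lambda>x. A' x * (b x - b 0))"
    using lborel_pair.integrable_fst[OF I2] by (simp add: e2)
  have sum: "(\<lambda>r. indicator {0..s} r * (A r * b r + a r * B r)) =
      (\<lambda>r. (B' r * (a r - a 0) + a 0 * B' r) + (A' r * (b r - b 0) + b 0 * A' r))"
    by (auto simp: A'_def B'_def indicator_def algebra_simps)
  show "set_integrable lborel {0..s} (\<lambda>r. A r * b r + a r * B r)"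
    unfolding set_integrable_def real_scaleR_def sum using J1 J2 iA iB by simp
  have intA: "(\<integral>x. A' x \<partial>lborel) = a s - a 0" and intB: "(\<integral>x. B' x \<partial>lborel) = b s - b 0"
    using a[of s] b[of s] s by (simp_all add: A'_def B'_def set_lebesgue_integral_def)
  have "(a s - a 0) * (b s - b 0) = (\<integral>x. (\<integral>y. A' x * B' y \<partial>lborel) \<partial>lborel)"
    by (simp add: intA intB)
  also have "\<dots> = integral\<^sup>L (lborel \<Otimes>\<^sub>M lborel) (\<lambda>(x, y). A' x * B' y)"
    using lborel_pair.integral_fst[OF int] .
  also have "\<dots> = integral\<^sup>L (lborel \<Otimes>\<^sub>M lborel) (\<lambda>p. (case p of (x, y) \<Rightarrow> indicator {p. fst p \<le> snd p} (x, y) * (A' x * B' y))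
       + (case p of (x, y) \<Rightarrow> indicator {p. snd p < fst p} (x, y) * (A' x * B' y)))"
    by (rule Bochner_Integration.integral_cong) (auto simp: indicator_def)
  also have "\<dots> = (LBINT y. B' y * (a y - a 0)) + (LBINT x. A' x * (b x - b 0))"
    using lborel_pair.integral_snd[OF I1] lborel_pair.integral_fst[OF I2] I1 I2
    by (simp add: e1 e2)
  finally have *: "(a s - a 0) * (b s - b 0) = (LBINT y. B' y * (a y - a 0)) + (LBINT x. A' x * (b x - b 0))" .
  have "(LBINT r:{0..s}. A r * b r + a r * B r) =
     (LBINT y. B' y * (a y - a 0)) + a 0 * (b s - b 0) + ((LBINT x. A' x * (b x - b 0)) + b 0 * (a s - a 0))"
    unfolding set_lebesgue_integral_def real_scaleR_def sum using J1 J2 iA iB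
    by (simp add: intA intB)
  then show "a s * b s - a 0 * b 0 = (LBINT r:{0..s}. A r * b r + a r * B r)"
    using * by (simp add: algebra_simps)
qed

lemma transport_eq_mult:
  assumes "transport_eq D a b f F" "transport_eq D a b g G"
  shows "transport_eq D a b (\<lambda>y z. f y z * g y z) (\<lambda>y z. F y z * g y z + f y z * G y z)"
proof (rule transport_eqI)
  fix y z s :: real
  assume s: "0 \<le> s" and D: "\<And>r. 0 \<le> r \<Longrightarrow> r \<le> s \<Longrightarrow> (y + a * r, z + b * r) \<in> D"
  note T = transport_eqD[OF assms(1) s D] transport_eqD[OF assms(2) s D]
  have r: "f (y + a * r) (z + b * r) = f (y + a * 0) (z + b * 0) + (LBINT x:{0..r}. F (y + a * x) (z + b * x))"
     "g (y + a * r) (z + b * r) = g (y + a * 0) (z + b * 0) + (LBINT x:{0..r}. G (y + a * x) (z + b * x))"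
    if "0 \<le> r" "r \<le> s" for r
    using transport_eqD(2)[OF assms(1) that(1), of y z] transport_eqD(2)[OF assms(2) that(1), of y z] D that by auto
  show "set_integrable lborel {0..s} (\<lambda>r. F (y + a * r) (z + b * r) * g (y + a * r) (z + b * r) + f (y + a * r) (z + b * r) * G (y + a * r) (z + b * r)) \<and>
     f (y + a * s) (z + b * s) * g (y + a * s) (z + b * s) - f y z * g y z =
     (LBINT r:{0..s}. F (y + a * r) (z + b * r) * g (y + a * r) (z + b * r) + f (y + a * r) (z + b * r) * G (y + a * r) (z + b * r))"
    using AC_mult[of s "\<lambda>x. F (y + a * x) (z + b * x)" "\<lambda>x. G (y + a * x) (z + b * x)"
         "\<lambda>r. f (y + a * r) (z + b * r)" "\<lambda>r. g (y + a * r) (z + b * r)", OF s T(1) T(3) r] by simp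
qed

section \<open>Reynolds transport identities\<close>

text \<open>The premise \<open>R\<close> says that the line labelled \<eta> meets the region in a
  single segment, so the transport equation evaluates the integral at the entry time
  \<open>r1\<close> and the exit time \<open>r2\<close>.\<close>

lemma transport_line_integral:
  assumes tr: "transport_eq R 1 c \<phi> \<Phi>" and le: "r1 \<le> r2"
    and R: "\<And>r. (r, \<eta> + c * r) \<in> R \<longleftrightarrow> r1 \<le> r \<and> r \<le> r2"
  shows "(LBINT r. indicator R (r, \<eta> + c * r) * \<Phi> r (\<eta> + c * r)) =
     \<phi> r2 (\<eta> + c * r2) - \<phi> r1 (\<eta> + c * r1)"
proof -
  have D: "(r1 + 1 * r, \<eta> + c * r1 + c * r) \<in> R" if "0 \<le> r" "r \<le> r2 - r1" for r
    using R[of "r1 + r"] that by (simp add: algebra_simps)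
  have "0 \<le> r2 - r1" using le by simp
  from transport_eqD(2)[OF tr this D]
  have "\<phi> r2 (\<eta> + c * r2) - \<phi> r1 (\<eta> + c * r1) = (LBINT r:{0..r2 - r1}. \<Phi> (r1 + r) (\<eta> + c * (r1 + r)))"
    by (simp add: algebra_simps)
  also have "\<dots> = (LBINT r. indicator R (r1 + 1 * r, \<eta> + c * (r1 + 1 * r)) * \<Phi> (r1 + 1 * r) (\<eta> + c * (r1 + 1 * r)))"
    unfolding set_lebesgue_integral_def
    by (rule Bochner_Integration.integral_cong) (auto simp: indicator_def R)
  also have "\<dots> = (LBINT r. indicator R (r, \<eta> + c * r) * \<Phi> r (\<eta> + c * r))"
    using lborel_integral_real_affine[of 1 "\<lambda>r. indicator R (r, \<eta> + c * r) * \<Phi> r (\<eta> + c * r)" r1] by simp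
  finally show ?thesis by simp
qed

lemma set_integral_affine:
  fixes f :: "real \<Rightarrow> real"
  assumes "c \<noteq> 0" "set_integrable lborel A f"
  shows "integrable lborel (\<lambda>x. indicator A (t + c * x) * f (t + c * x))"
    and "(LBINT x. indicator A (t + c * x) * f (t + c * x)) = (LBINT x:A. f x) / \<bar>c\<bar>"
  using lborel_integrable_real_affine[of "\<lambda>x. indicator A x * f x" c t]
    lborel_integral_real_affine[of c "\<lambda>x. indicator A x * f x" t] assms
  by (simp_all add: set_integrable_def set_lebesgue_integral_def)

lemma set_integral_indicator_fst:
  assumes "\<And>r \<xi>. (r, \<xi>) \<in> R \<longleftrightarrow> r \<in> A \<and> \<xi> \<in> B r"
  shows "(LBINT \<xi>. indicator R (r, \<xi>) * \<Phi> r \<xi>) = indicator A r * (LBINT \<xi>:B r. (\<Phi> r \<xi> :: real))"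
proof -
  have "(\<lambda>\<xi>. indicator R (r, \<xi>) * \<Phi> r \<xi>) = (\<lambda>\<xi>. indicator A r * (indicator (B r) \<xi> * \<Phi> r \<xi>))"
    using assms by (auto simp: indicator_def)
  then show ?thesis by (simp add: set_lebesgue_integral_def)
qed

text \<open>Both identities below integrate over the parameter \<open>\<eta> = \<xi> - c r\<close> of the characteristics: on each
  of them the integral of \<open>\<Phi>\<close> is the difference of \<open>\<phi>\<close> at the exit point and at the entry point, and these
  points sweep the sides of the trapezoid.\<close>

definition trapezoid :: "real \<Rightarrow> real \<Rightarrow> real \<Rightarrow> (real \<times> real) set" where
  "trapezoid lam x s = {(r, \<xi>). 0 \<le> r \<and> r \<le> s \<and> 0 \<le> \<xi> \<and> \<xi> \<le> x + lam * r}"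

lemma trapezoid_integral:
  assumes I: "integrable (lborel \<Otimes>\<^sub>M lborel) (\<lambda>(r, \<xi>). indicator (trapezoid lam x s) (r, \<xi>) * \<Phi> r \<xi>)"
  shows "set_integrable lborel {0..s} (\<lambda>r. LBINT \<xi>:{0..x + lam * r}. (\<Phi> r \<xi> :: real))"
    and "(LBINT r. LBINT \<xi>. indicator (trapezoid lam x s) (r, \<xi>) * \<Phi> r \<xi>) =
       (LBINT r:{0..s}. LBINT \<xi>:{0..x + lam * r}. \<Phi> r \<xi>)"
proof -
  have R: "(r, \<xi>) \<in> trapezoid lam x s \<longleftrightarrow> r \<in> {0..s} \<and> \<xi> \<in> {0..x + lam * r}" for r \<xi>
    by (auto simp: trapezoid_def)
  note e = set_integral_indicator_fst[OF R]
  show "set_integrable lborel {0..s} (\<lambda>r. LBINT \<xi>:{0..x + lam * r}. \<Phi> r \<xi>)"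
    using lborel_pair.integrable_fst[OF I] unfolding e set_integrable_def by simp
  show "(LBINT r. LBINT \<xi>. indicator (trapezoid lam x s) (r, \<xi>) * \<Phi> r \<xi>) =
       (LBINT r:{0..s}. LBINT \<xi>:{0..x + lam * r}. \<Phi> r \<xi>)"
    unfolding e by (simp add: set_lebesgue_integral_def)
qed

text \<open>Lines enter through the base r = 0 or through \<xi> = 0 and all leave at r = s; the
  slanted side is itself a line of the family and gives no term. The factor \<open>lam\<close> is
  the Jacobian between the label \<eta> = - lam r and the entry time r.\<close>

lemma reynolds_parallel:
  assumes pos: "lam > 0" and s: "0 \<le> s" and x: "0 \<le> x"
    and tr: "transport_eq (trapezoid lam x s) 1 lam \<phi> \<Phi>"
    and I: "integrable (lborel \<Otimes>\<^sub>M lborel) (\<lambda>(r, \<xi>). indicator (trapezoid lam x s) (r, \<xi>) * \<Phi> r \<xi>)"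
    and i0: "set_integrable lborel {0..x} (\<phi> 0)"
    and ie: "set_integrable lborel {0..x + lam * s} (\<phi> s)"
    and ib: "set_integrable lborel {0..s} (\<lambda>r. \<phi> r 0)"
  shows "(LBINT \<xi>:{0..x + lam * s}. \<phi> s \<xi>) = (LBINT \<xi>:{0..x}. \<phi> 0 \<xi>) + lam * (LBINT r:{0..s}. \<phi> r 0)
     + (LBINT r:{0..s}. LBINT \<xi>:{0..x + lam * r}. \<Phi> r \<xi>)"
proof -
  let ?R = "trapezoid lam x s"
  define J where "J = (\<lambda>\<eta>. LBINT r. indicator ?R (r, \<eta> + lam * r) * \<Phi> r (\<eta> + lam * r))"
  note sh = shear_integral[OF I, of lam]
  have iJ: "integrable lborel J" using sh(1) by (simp add: J_def)
  have vJ: "integral\<^sup>L lborel J = (LBINT r:{0..s}. LBINT \<xi>:{0..x + lam * r}. \<Phi> r \<xi>)"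
    using sh(2) trapezoid_integral(2)[OF I] by (simp add: J_def)
  define E where "E = (\<lambda>\<eta>. indicator {0..x + lam * s} (lam * s + 1 * \<eta>) * \<phi> s (lam * s + 1 * \<eta>))"
  define A where "A = (\<lambda>\<eta>. indicator {0..x} \<eta> * \<phi> 0 \<eta>)"
  define B where "B = (\<lambda>\<eta>. indicator {0..s} (0 + (- 1 / lam) * \<eta>) * \<phi> (0 + (- 1 / lam) * \<eta>) 0)"
  have iE: "integrable lborel E" and vE: "integral\<^sup>L lborel E = (LBINT \<xi>:{0..x + lam * s}. \<phi> s \<xi>)"
    unfolding E_def using set_integral_affine[OF _ ie, of 1 "lam * s"] by simp_all
  have iA: "integrable lborel A" and vA: "integral\<^sup>L lborel A = (LBINT \<xi>:{0..x}. \<phi> 0 \<xi>)"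
    using i0 by (simp_all add: A_def set_integrable_def set_lebesgue_integral_def)
  have iB: "integrable lborel B" and vB: "integral\<^sup>L lborel B = lam * (LBINT r:{0..s}. \<phi> r 0)"
    unfolding B_def using set_integral_affine[OF _ ib, of "- 1 / lam" 0] pos by simp_all
  \<comment> \<open>The line \<eta> = 0 passes through the corner (0, 0) and would be counted both
    in \<open>A\<close> and in \<open>B\<close>; a single label is negligible.\<close>
  have eq: "E \<eta> = A \<eta> + B \<eta> + J \<eta>" if "\<eta> \<noteq> 0" for \<eta>
  proof -
    consider (a) "0 \<le> \<eta>" "\<eta> \<le> x" | (b) "- lam * s \<le> \<eta>" "\<eta> < 0" | (c) "\<eta> < - lam * s \<or> \<eta> > x"
      by linarith
    then show ?thesis
    proof cases
      case a
      have "J \<eta> = \<phi> s (\<eta> + lam * s) - \<phi> 0 (\<eta> + lam * 0)"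
        unfolding J_def
        by (rule transport_line_integral[OF tr s]) (use a pos in \<open>auto simp: trapezoid_def\<close>)
      moreover have "B \<eta> = 0" using a that pos by (simp add: B_def indicator_def field_simps)
      ultimately show ?thesis
        using a s pos by (simp add: E_def A_def add.commute)
    next
      case b
      have "J \<eta> = \<phi> s (\<eta> + lam * s) - \<phi> (- \<eta> / lam) (\<eta> + lam * (- \<eta> / lam))"
        unfolding J_def
      proof (rule transport_line_integral[OF tr])
        show "(r, \<eta> + lam * r) \<in> trapezoid lam x s \<longleftrightarrow> - \<eta> / lam \<le> r \<and> r \<le> s" for r
        proof -
          have "- \<eta> / lam \<le> r \<longleftrightarrow> 0 \<le> \<eta> + lam * r" using pos by (auto simp: field_simps)
          moreover have "0 \<le> r" if "0 \<le> \<eta> + lam * r"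
            using that b pos by (smt (verit) mult_nonneg_nonpos)
          ultimately show ?thesis using b x by (auto simp: trapezoid_def)
        qed
      qed (use b pos in \<open>simp add: field_simps\<close>)
      moreover have "A \<eta> = 0" using b by (simp add: A_def)
      moreover have "B \<eta> = \<phi> (- \<eta> / lam) 0" using b pos by (simp add: B_def indicator_def field_simps)
      ultimately show ?thesis
        using b x s pos by (simp add: E_def add.commute)
    next
      case c
      have "(r, \<eta> + lam * r) \<notin> ?R" for r
      proof
        assume "(r, \<eta> + lam * r) \<in> ?R"
        then have r: "r \<le> s" "0 \<le> \<eta> + lam * r" "\<eta> \<le> x" by (auto simp: trapezoid_def)
        have "lam * r \<le> lam * s" using r pos by simp
        then show False using c r by linarith
      qed
      then have "J \<eta> = 0" by (simp add: J_def)
      moreover have "A \<eta> = 0" using c s pos x by (auto simp: A_def indicator_def) (smt (verit) mult_nonneg_nonneg)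
      moreover have "B \<eta> = 0" using c pos x that by (auto simp: B_def indicator_def field_simps)
      moreover have "E \<eta> = 0" using c by (auto simp: E_def indicator_def)
      ultimately show ?thesis by simp
    qed
  qed
  have "integral\<^sup>L lborel E = integral\<^sup>L lborel (\<lambda>\<eta>. A \<eta> + B \<eta> + J \<eta>)"
  proof (rule integral_cong_AE)
    have "AE \<eta> in lborel. \<eta> \<noteq> (0::real)" by (rule AE_lborel_singleton)
    then show "AE \<eta> in lborel. E \<eta> = A \<eta> + B \<eta> + J \<eta>" by eventually_elim (rule eq)
  qed (use iE iA iB iJ in auto)
  then show ?thesis using iA iB iJ by (simp add: vE vA vB vJ)
qed

text \<open>Lines of slope -\<mu> enter through the base or the slanted side and leave at r = s or
  through \<xi> = 0. Along the slanted side the label \<eta> = x + (lam + \<mu>) r grows at rate lam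
  + \<mu>, along \<xi> = 0 at rate \<mu>; these are the two weights.\<close>

lemma reynolds_transversal:
  assumes pos: "lam > 0" "\<mu> > 0" and s: "0 \<le> s" and x: "0 \<le> x"
    and tr: "transport_eq (trapezoid lam x s) 1 (- \<mu>) \<phi> \<Phi>"
    and I: "integrable (lborel \<Otimes>\<^sub>M lborel) (\<lambda>(r, \<xi>). indicator (trapezoid lam x s) (r, \<xi>) * \<Phi> r \<xi>)"
    and i0: "set_integrable lborel {0..x} (\<phi> 0)"
    and ie: "set_integrable lborel {0..x + lam * s} (\<phi> s)"
    and ib: "set_integrable lborel {0..s} (\<lambda>r. \<phi> r 0)"
    and id: "set_integrable lborel {0..s} (\<lambda>r. \<phi> r (x + lam * r))"
  shows "(LBINT \<xi>:{0..x + lam * s}. \<phi> s \<xi>) + \<mu> * (LBINT r:{0..s}. \<phi> r 0) = (LBINT \<xi>:{0..x}. \<phi> 0 \<xi>)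
     + (lam + \<mu>) * (LBINT r:{0..s}. \<phi> r (x + lam * r)) + (LBINT r:{0..s}. LBINT \<xi>:{0..x + lam * r}. \<Phi> r \<xi>)"
proof -
  let ?R = "trapezoid lam x s"
  define J where "J = (\<lambda>\<eta>. LBINT r. indicator ?R (r, \<eta> + (- \<mu>) * r) * \<Phi> r (\<eta> + (- \<mu>) * r))"
  note sh = shear_integral[OF I, of "- \<mu>"]
  have iJ: "integrable lborel J" using sh(1) by (simp add: J_def)
  have vJ: "integral\<^sup>L lborel J = (LBINT r:{0..s}. LBINT \<xi>:{0..x + lam * r}. \<Phi> r \<xi>)"
    using sh(2) trapezoid_integral(2)[OF I] by (simp add: J_def)
  define E where "E = (\<lambda>\<eta>. indicator {0..x + lam * s} (- \<mu> * s + 1 * \<eta>) * \<phi> s (- \<mu> * s + 1 * \<eta>))"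
  define A where "A = (\<lambda>\<eta>. indicator {0..x} \<eta> * \<phi> 0 \<eta>)"
  define B where "B = (\<lambda>\<eta>. indicator {0..s} (0 + (1 / \<mu>) * \<eta>) * \<phi> (0 + (1 / \<mu>) * \<eta>) 0)"
  define K where "K = (\<lambda>\<eta>. indicator {0..s} (- x / (lam + \<mu>) + (1 / (lam + \<mu>)) * \<eta>) *
     \<phi> (- x / (lam + \<mu>) + (1 / (lam + \<mu>)) * \<eta>) (x + lam * (- x / (lam + \<mu>) + (1 / (lam + \<mu>)) * \<eta>)))"
  have iE: "integrable lborel E" and vE: "integral\<^sup>L lborel E = (LBINT \<xi>:{0..x + lam * s}. \<phi> s \<xi>)"
    unfolding E_def using set_integral_affine[OF _ ie, of 1 "- \<mu> * s"] by simp_all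
  have iA: "integrable lborel A" and vA: "integral\<^sup>L lborel A = (LBINT \<xi>:{0..x}. \<phi> 0 \<xi>)"
    using i0 by (simp_all add: A_def set_integrable_def set_lebesgue_integral_def)
  have iB: "integrable lborel B" and vB: "integral\<^sup>L lborel B = \<mu> * (LBINT r:{0..s}. \<phi> r 0)"
    unfolding B_def using set_integral_affine[OF _ ib, of "1 / \<mu>" 0] pos by simp_all
  have iK: "integrable lborel K" and vK: "integral\<^sup>L lborel K = (lam + \<mu>) * (LBINT r:{0..s}. \<phi> r (x + lam * r))"
    unfolding K_def using set_integral_affine[OF _ id, of "1 / (lam + \<mu>)" "- x / (lam + \<mu>)"] pos
    by (simp_all add: abs_of_pos)
  \<comment> \<open>The excluded labels belong to the lines through the corners (0, x) and (s, 0),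
    where two sides would be counted.\<close>
  have eq: "E \<eta> + B \<eta> = A \<eta> + K \<eta> + J \<eta>" if ne: "\<eta> \<noteq> x" "\<eta> \<noteq> \<mu> * s" for \<eta>
  proof -
    \<comment> \<open>\<open>\<theta>\<close> is the time at which the line meets the slanted side
      and \<open>\<kappa>\<close> the time at which it reaches \<xi> = 0; the line lies in the
      trapezoid exactly between \<open>max 0 \<theta>\<close> and
      \<open>min s \<kappa>\<close>.\<close>
    define \<theta> where "\<theta> = (\<eta> - x) / (lam + \<mu>)"
    have \<eta>: "\<eta> = x + (lam + \<mu>) * \<theta>" using pos by (simp add: \<theta>_def)
    define \<kappa> where "\<kappa> = \<eta> / \<mu>"
    have \<eta>': "\<eta> = \<mu> * \<kappa>" using pos by (simp add: \<kappa>_def)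
    have K: "K \<eta> = indicator {0..s} \<theta> * \<phi> \<theta> (x + lam * \<theta>)"
      by (simp add: K_def \<theta>_def diff_divide_distrib)
    have B: "B \<eta> = indicator {0..s} \<kappa> * \<phi> \<kappa> 0"
      by (simp add: B_def \<kappa>_def)
    have R: "(r, \<eta> + (- \<mu>) * r) \<in> ?R \<longleftrightarrow> max 0 \<theta> \<le> r \<and> r \<le> min s \<kappa>" for r
    proof -
      have "0 \<le> \<eta> + (- \<mu>) * r \<longleftrightarrow> r \<le> \<kappa>" using pos by (simp add: \<eta>')
      moreover have "\<eta> + (- \<mu>) * r \<le> x + lam * r \<longleftrightarrow> (lam + \<mu>) * \<theta> \<le> (lam + \<mu>) * r"
        by (simp add: \<eta> algebra_simps)
      moreover have "(lam + \<mu>) * \<theta> \<le> (lam + \<mu>) * r \<longleftrightarrow> \<theta> \<le> r" using pos by simp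
      ultimately show ?thesis by (auto simp: trapezoid_def)
    qed
    have \<kappa>0: "0 \<le> \<kappa> \<longleftrightarrow> 0 \<le> \<eta>" using pos by (simp add: \<kappa>_def zero_le_divide_iff)
    have \<theta>0: "0 < \<theta> \<longleftrightarrow> x < \<eta>" "\<theta> \<noteq> 0" using pos ne by (auto simp: \<theta>_def zero_less_divide_iff)
    have \<kappa>s: "\<kappa> < s \<longleftrightarrow> \<eta> < \<mu> * s" "\<kappa> \<noteq> s" using pos ne by (auto simp: \<kappa>_def field_simps)
    have \<theta>s: "\<theta> \<le> s \<longleftrightarrow> \<eta> \<le> x + (lam + \<mu>) * s" using pos by (simp add: \<theta>_def field_simps)
    have \<theta>\<kappa>: "\<theta> \<le> \<kappa>" if "0 \<le> \<eta>"
    proof -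
      have "(lam + \<mu>) * \<theta> \<le> \<mu> * \<kappa>" using \<eta> \<eta>' x by linarith
      also have "\<dots> \<le> (lam + \<mu>) * \<kappa>" using that \<kappa>0 pos by (simp add: mult_right_mono)
      finally show ?thesis using pos by simp
    qed
    show ?thesis
    proof (cases "0 \<le> \<eta> \<and> \<eta> \<le> x + (lam + \<mu>) * s")
      case True
      have J: "J \<eta> = \<phi> (min s \<kappa>) (\<eta> + (- \<mu>) * min s \<kappa>) - \<phi> (max 0 \<theta>) (\<eta> + (- \<mu>) * max 0 \<theta>)"
        unfolding J_def
        by (rule transport_line_integral[OF tr _ R]) (use True s \<theta>s \<kappa>0 \<theta>\<kappa> in auto)
      have l: "E \<eta> + B \<eta> = \<phi> (min s \<kappa>) (\<eta> + (- \<mu>) * min s \<kappa>)"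
      proof (cases "\<eta> < \<mu> * s")
        case t: True
        then show ?thesis using True \<kappa>s \<kappa>0
          by (simp add: E_def B min_def \<eta>'[symmetric] indicator_def)
      next
        case False
        then show ?thesis using True \<kappa>s ne pos
          by (simp add: E_def B min_def indicator_def algebra_simps)
      qed
      have r: "A \<eta> + K \<eta> = \<phi> (max 0 \<theta>) (\<eta> + (- \<mu>) * max 0 \<theta>)"
      proof (cases "x < \<eta>")
        case t: True
        then have "\<eta> + (- \<mu>) * \<theta> = x + lam * \<theta>" using \<eta> by (simp add: algebra_simps)
        with t show ?thesis using True \<theta>0 \<theta>s
          by (simp add: A_def K max_def indicator_def)
      next
        case False
        then show ?thesis using True \<theta>0 ne pos
          by (simp add: A_def K max_def indicator_def)
      qed
      show ?thesis unfolding l r J by simp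
    next
      case False
      have "(r, \<eta> + (- \<mu>) * r) \<notin> ?R" for r
        unfolding R using False \<kappa>0 \<theta>s by auto
      then have "J \<eta> = 0" by (simp add: J_def)
      moreover have "A \<eta> = 0"
      proof -
        have "0 \<le> (lam + \<mu>) * s" using pos s by simp
        then show ?thesis using False by (auto simp: A_def indicator_def)
      qed
      moreover have "K \<eta> = 0" using False \<theta>0 \<theta>s x s by (auto simp: K indicator_def)
      moreover have "B \<eta> = 0"
      proof -
        have "\<eta> \<le> x + (lam + \<mu>) * s" if "\<kappa> \<le> s"
        proof -
          have "\<mu> * \<kappa> \<le> \<mu> * s" using that pos by simp
          moreover have "0 \<le> lam * s" using pos s by simp
          ultimately show ?thesis using x \<eta>' by (simp add: distrib_right)
        qed
        then show ?thesis using False \<kappa>0 by (auto simp: B indicator_def)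
      qed
      moreover have "E \<eta> = 0"
      proof -
        have "0 \<le> \<mu> * s" using pos s by simp
        then show ?thesis using False by (auto simp: E_def indicator_def algebra_simps)
      qed
      ultimately show ?thesis by simp
    qed
  qed
  have "integral\<^sup>L lborel (\<lambda>\<eta>. E \<eta> + B \<eta>) = integral\<^sup>L lborel (\<lambda>\<eta>. A \<eta> + K \<eta> + J \<eta>)"
  proof (rule integral_cong_AE)
    have "AE \<eta> in lborel. \<eta> \<noteq> x" "AE \<eta> in lborel. \<eta> \<noteq> \<mu> * s" by (rule AE_lborel_singleton)+
    then show "AE \<eta> in lborel. E \<eta> + B \<eta> = A \<eta> + K \<eta> + J \<eta>" by eventually_elim (rule eq)
  qed (use iE iA iB iJ iK in auto)
  then show ?thesis using iA iB iJ iK iE by (simp add: vE vA vB vJ vK)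
qed

text \<open>Reynolds' formula needs an integrable trace at \<xi> = 0, which is no part of the notion
  of solution. It follows from the data at time 0: since \<open>\<mu> * s \<le> 1\<close>, each
  boundary point (r, 0) with r \<le> s is reached from the point \<mu> r of the initial interval,
  and the source accumulated on the way is integrable in the label.\<close>

lemma boundary_trace_integrable:
  assumes pos: "\<mu> > 0" and s: "0 \<le> s" "\<mu> * s \<le> 1"
    and tr: "transport_eq ({0..s} \<times> {0..1}) 1 (- \<mu>) \<phi> \<Phi>"
    and I: "integrable (lborel \<Otimes>\<^sub>M lborel) (\<lambda>(r, \<xi>). indicator ({0..s} \<times> {0..1}) (r, \<xi>) * \<Phi> r \<xi>)"
    and i0: "set_integrable lborel {0..1} (\<phi> 0)"
  shows "set_integrable lborel {0..s} (\<lambda>r. \<phi> r 0)"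
proof -
  define R where "R = {(r, \<xi>). 0 \<le> r \<and> 0 \<le> \<xi> \<and> \<xi> + \<mu> * r \<le> \<mu> * s}"
  have sub: "R \<subseteq> {0..s} \<times> {0..1}"
  proof
    fix p assume "p \<in> R"
    then obtain r \<xi> where p: "p = (r, \<xi>)" "0 \<le> r" "0 \<le> \<xi>" "\<xi> + \<mu> * r \<le> \<mu> * s" by (auto simp: R_def)
    then have "\<mu> * r \<le> \<mu> * s" by linarith
    moreover have "0 \<le> \<mu> * r" using p pos by simp
    moreover have "\<xi> \<le> 1" using p s \<open>0 \<le> \<mu> * r\<close> by linarith
    ultimately show "p \<in> {0..s} \<times> {0..1}" using p pos by auto
  qed
  have trR: "transport_eq R 1 (- \<mu>) \<phi> \<Phi>"
    using transport_eq_subset[OF tr sub] .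
  have "closed R" unfolding R_def case_prod_beta'
    by (intro closed_Collect_conj closed_Collect_le continuous_intros)
  then have "R \<in> sets (lborel \<Otimes>\<^sub>M lborel)"
    unfolding lborel_pair_sets_borel by (rule borel_closed)
  note IR' = integrable_mult_indicator[OF this I]
  have "(\<lambda>x. indicat_real R x *\<^sub>R (case x of (r, \<xi>) \<Rightarrow> indicat_real ({0..s} \<times> {0..1}) (r, \<xi>) * \<Phi> r \<xi>)) =
      (\<lambda>(r, \<xi>). indicator R (r, \<xi>) * \<Phi> r \<xi>)"
    using sub by (auto simp: indicator_def fun_eq_iff)
  with IR' have IR: "integrable (lborel \<Otimes>\<^sub>M lborel) (\<lambda>(r, \<xi>). indicator R (r, \<xi>) * \<Phi> r \<xi>)"
    by simp
  define J where "J = (\<lambda>\<eta>. LBINT r. indicator R (r, \<eta> + (- \<mu>) * r) * \<Phi> r (\<eta> + (- \<mu>) * r))"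
  have iJ: "integrable lborel J"
    unfolding J_def by (rule shear_integral(1)[OF IR])
  have J: "J \<eta> = \<phi> (\<eta> / \<mu>) 0 - \<phi> 0 \<eta>" if "0 \<le> \<eta>" "\<eta> \<le> \<mu> * s" for \<eta>
  proof -
    have "J \<eta> = \<phi> (\<eta> / \<mu>) (\<eta> + (- \<mu>) * (\<eta> / \<mu>)) - \<phi> 0 (\<eta> + (- \<mu>) * 0)"
      unfolding J_def
      by (rule transport_line_integral[OF trR]) (use that pos in \<open>auto simp: R_def field_simps\<close>)
    then show ?thesis using pos by simp
  qed
  have "set_integrable lborel {0..\<mu> * s} (\<lambda>\<eta>. J \<eta> + \<phi> 0 \<eta>)"
  proof (rule set_integral_add)
    show "set_integrable lborel {0..\<mu> * s} J"
      using iJ integrable_mult_indicator[of "{0..\<mu> * s}" lborel J] by (simp add: set_integrable_def)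
    show "set_integrable lborel {0..\<mu> * s} (\<phi> 0)"
      using i0 by (rule set_integrable_subset) (use s in auto)
  qed
  then have "integrable lborel (\<lambda>r. indicator {0..\<mu> * s} (0 + \<mu> * r) * (J (0 + \<mu> * r) + \<phi> 0 (0 + \<mu> * r)))"
    by (rule set_integral_affine(1)[rotated]) (use pos in simp)
  also have "(\<lambda>r. indicator {0..\<mu> * s} (0 + \<mu> * r) * (J (0 + \<mu> * r) + \<phi> 0 (0 + \<mu> * r))) =
     (\<lambda>r. indicator {0..s} r * \<phi> r 0)"
    using J pos by (auto simp: indicator_def fun_eq_iff zero_le_mult_iff)
  finally show ?thesis by (simp add: set_integrable_def)
qed

section \<open>The Volterra transformation along characteristics\<close>

lemma borel_measurable_fst_snd [measurable]:
  "fst \<in> borel_measurable (borel :: (real \<times> real) measure)"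
  "snd \<in> borel_measurable (borel :: (real \<times> real) measure)"
  by (intro borel_measurable_continuous_onI continuous_intros)+

lemma borel_measurable_curried:
  fixes K :: "real \<Rightarrow> real \<Rightarrow> real"
  assumes "case_prod K \<in> borel_measurable borel" "a \<in> borel_measurable M" "b \<in> borel_measurable M"
  shows "(\<lambda>p. K (a p) (b p)) \<in> borel_measurable M"
proof -
  have "(\<lambda>p. case_prod K (a p, b p)) \<in> borel_measurable M"
    by (rule measurable_compose[OF _ assms(1)]) (use assms(2,3) in \<open>simp add: borel_measurable_Pair\<close>)
  then show ?thesis by simp
qed

lemma integrable_bounded_mult:
  fixes f :: "'a \<Rightarrow> real"
  assumes "integrable M f" "k \<in> borel_measurable M" "\<And>x. \<bar>k x\<bar> \<le> C"
  shows "integrable M (\<lambda>x. k x * f x)"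
proof (rule Bochner_Integration.integrable_bound)
  show "integrable M (\<lambda>x. C * f x)" using assms(1) by simp
  have "\<bar>k x * f x\<bar> \<le> \<bar>C * f x\<bar>" for x
    using mult_right_mono[OF assms(3)[of x], of "\<bar>f x\<bar>"] by (simp add: abs_mult) (smt (verit) mult_right_mono abs_ge_zero)
  then show "AE x in M. norm (k x * f x) \<le> norm (C * f x)" by simp
qed (use assms in auto)

lemma set_integrable_bounded_mult:
  fixes f :: "'a \<Rightarrow> real"
  assumes "set_integrable M A f" "k \<in> borel_measurable M" "\<And>x. \<bar>k x\<bar> \<le> C"
  shows "set_integrable M A (\<lambda>x. k x * f x)"
  using integrable_bounded_mult[OF assms(1)[unfolded set_integrable_def] assms(2,3)]
  by (simp add: set_integrable_def mult_ac)

text \<open>Measurability and the bound are imposed on the whole line, so that shifted arguments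
  need no side conditions.\<close>

definition bounded_borel :: "(real \<Rightarrow> real) \<Rightarrow> bool" where
  "bounded_borel h \<longleftrightarrow> h \<in> borel_measurable borel \<and> (\<exists>C. \<forall>x. \<bar>h x\<bar> \<le> C)"

definition bounded_borel2 :: "(real \<Rightarrow> real \<Rightarrow> real) \<Rightarrow> bool" where
  "bounded_borel2 K \<longleftrightarrow> case_prod K \<in> borel_measurable borel \<and> (\<exists>C. \<forall>x \<xi>. \<bar>K x \<xi>\<bar> \<le> C)"

text \<open>Reversing time and exchanging the two families of characteristics carries the equations for
  \<open>(K\<^sup>v\<^sup>v, K\<^sup>v\<^sup>u)\<close> into those for \<open>(K\<^sup>u\<^sup>u, K\<^sup>u\<^sup>v)\<close>, with \<open>\<lambda>, \<mu>, q, \<sigma>\<^sup>+\<^sup>-, \<sigma>\<^sup>-\<^sup>+\<close> replaced by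
  \<open>\<mu>, \<lambda>, 1/q, - \<sigma>\<^sup>-\<^sup>+, - \<sigma>\<^sup>+\<^sup>-\<close>; both rows satisfy the following predicate.\<close>

definition kernel_row ::
  "real \<Rightarrow> real \<Rightarrow> real \<Rightarrow> (real \<Rightarrow> real) \<Rightarrow> (real \<Rightarrow> real) \<Rightarrow>
   (real \<Rightarrow> real \<Rightarrow> real) \<Rightarrow> (real \<Rightarrow> real \<Rightarrow> real) \<Rightarrow> bool" where
  "kernel_row lam \<mu> q spm smp K L \<longleftrightarrow>
     lam > 0 \<and> \<mu> > 0 \<and> bounded_borel spm \<and> bounded_borel smp \<and> bounded_borel2 K \<and> bounded_borel2 L \<and>
     transport_eq triangle lam lam K (\<lambda>x \<xi>. - L x \<xi> * smp \<xi>) \<and>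
     transport_eq triangle lam (- \<mu>) L (\<lambda>x \<xi>. - K x \<xi> * spm \<xi>) \<and>
     (\<forall>x\<in>{0..1}. (lam + \<mu>) * L x x = spm x \<and> \<mu> * L x 0 = lam * q * K x 0)"

definition slab_integrable :: "real \<Rightarrow> (real \<Rightarrow> real \<Rightarrow> real) \<Rightarrow> bool" where
  "slab_integrable s f \<longleftrightarrow> case_prod f \<in> borel_measurable borel \<and>
     integrable (lborel \<Otimes>\<^sub>M lborel) (\<lambda>(r, \<xi>). indicator ({0..s} \<times> {0..1}) (r, \<xi>) * f r \<xi>)"

lemma slab_integrable_add:
  assumes "slab_integrable s f" "slab_integrable s g"
  shows "slab_integrable s (\<lambda>r \<xi>. f r \<xi> + g r \<xi>)"
proof -
  have 1: "case_prod f \<in> borel_measurable borel" "case_prod g \<in> borel_measurable borel"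
    using assms by (auto simp: slab_integrable_def)
  then have "case_prod (\<lambda>r \<xi>. f r \<xi> + g r \<xi>) \<in> borel_measurable borel"
    by (auto simp: case_prod_beta')
  moreover have "integrable (lborel \<Otimes>\<^sub>M lborel) (\<lambda>(r, \<xi>). indicator ({0..s} \<times> {0..1}) (r, \<xi>) * (f r \<xi> + g r \<xi>))"
    using Bochner_Integration.integrable_add[of "lborel \<Otimes>\<^sub>M lborel" "\<lambda>(r, \<xi>). indicator ({0..s} \<times> {0..1}) (r, \<xi>) * f r \<xi>"
      "\<lambda>(r, \<xi>). indicator ({0..s} \<times> {0..1}) (r, \<xi>) * g r \<xi>"] assms
    by (simp add: slab_integrable_def case_prod_beta' algebra_simps)
  ultimately show ?thesis by (simp add: slab_integrable_def)
qed

lemma slab_integrable_mult: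
  assumes "slab_integrable s f" "case_prod k \<in> borel_measurable borel" "\<And>r \<xi>. \<bar>k r \<xi>\<bar> \<le> C"
  shows "slab_integrable s (\<lambda>r \<xi>. k r \<xi> * f r \<xi>)"
proof -
  have "case_prod (\<lambda>r \<xi>. k r \<xi> * f r \<xi>) \<in> borel_measurable borel"
    using assms by (auto simp: slab_integrable_def case_prod_beta')
  moreover have "integrable (lborel \<Otimes>\<^sub>M lborel) (\<lambda>(r, \<xi>). indicator ({0..s} \<times> {0..1}) (r, \<xi>) * (k r \<xi> * f r \<xi>))"
    using integrable_bounded_mult[of "lborel \<Otimes>\<^sub>M lborel" "\<lambda>(r, \<xi>). indicator ({0..s} \<times> {0..1}) (r, \<xi>) * f r \<xi>"
        "case_prod k" C] assms
    by (simp add: slab_integrable_def case_prod_beta' mult_ac borel_measurable_lborel_pair_iff)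
  ultimately show ?thesis by (simp add: slab_integrable_def)
qed

lemma slab_integrable_trapezoid:
  assumes "slab_integrable s f" "0 < lam" "0 \<le> x" "x + lam * s \<le> 1"
  shows "integrable (lborel \<Otimes>\<^sub>M lborel) (\<lambda>(r, \<xi>). indicator (trapezoid lam x s) (r, \<xi>) * f r \<xi>)"
proof -
  have sub: "trapezoid lam x s \<subseteq> {0..s} \<times> {0..1}"
  proof
    fix p assume "p \<in> trapezoid lam x s"
    then obtain r \<xi> where p: "p = (r, \<xi>)" "0 \<le> r" "r \<le> s" "0 \<le> \<xi>" "\<xi> \<le> x + lam * r" by (auto simp: trapezoid_def)
    have "lam * r \<le> lam * s" using p assms by simp
    then have "\<xi> \<le> 1" using p assms by linarith
    then show "p \<in> {0..s} \<times> {0..1}" using p by auto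
  qed
  have "closed (trapezoid lam x s)" unfolding trapezoid_def case_prod_beta'
    by (intro closed_Collect_conj closed_Collect_le continuous_intros)
  then have "trapezoid lam x s \<in> sets (lborel \<Otimes>\<^sub>M lborel)"
    unfolding lborel_pair_sets_borel by (rule borel_closed)
  note IR' = integrable_mult_indicator[OF this, of "\<lambda>(r, \<xi>). indicator ({0..s} \<times> {0..1}) (r, \<xi>) * f r \<xi>"]
  have "(\<lambda>p. indicat_real (trapezoid lam x s) p *\<^sub>R (case p of (r, \<xi>) \<Rightarrow> indicat_real ({0..s} \<times> {0..1}) (r, \<xi>) * f r \<xi>)) =
      (\<lambda>(r, \<xi>). indicator (trapezoid lam x s) (r, \<xi>) * f r \<xi>)"
    using sub by (auto simp: indicator_def fun_eq_iff)
  with IR' assms(1) show ?thesis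
    by (simp add: slab_integrable_def)
qed

text \<open>The transport equations are asked only on the window [0, s], so that the same statement
  serves after a shift of time and after time reversal. The condition at \<xi> = 0 is asked only
  inside the window: a solution satisfies it for positive times, and an end of the window may be
  time 0.\<close>

lemma volterra_transport_local:
  assumes row: "kernel_row lam \<mu> q spm smp K L"
    and s: "0 \<le> s" and x: "0 \<le> x" "x + lam * s \<le> 1"
    and tf: "transport_eq ({0..s} \<times> {0..1}) 1 lam f F"
    and tg: "transport_eq ({0..s} \<times> {0..1}) 1 (- \<mu>) g G"
    and I: "slab_integrable s f" "slab_integrable s g" "slab_integrable s F" "slab_integrable s G"
    and f0: "set_integrable lborel {0..1} (f 0)" and fs: "set_integrable lborel {0..1} (f s)"
    and g0: "set_integrable lborel {0..1} (g 0)" and gs: "set_integrable lborel {0..1} (g s)"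
    and bc: "\<And>r. 0 < r \<Longrightarrow> r < s \<Longrightarrow> f r 0 = q * g r 0"
    and gb: "set_integrable lborel {0..s} (\<lambda>r. g r 0)"
    and gd: "set_integrable lborel {0..s} (\<lambda>r. spm (x + lam * r) * g r (x + lam * r))"
  defines "W \<equiv> \<lambda>r. spm (x + lam * r) * g r (x + lam * r) +
      volterra K L (\<lambda>\<xi>. F r \<xi> - spm \<xi> * g r \<xi>) (\<lambda>\<xi>. G r \<xi> - smp \<xi> * f r \<xi>) (x + lam * r)"
  shows "set_integrable lborel {0..s} W"
    and "volterra K L (f s) (g s) (x + lam * s) - volterra K L (f 0) (g 0) x = (LBINT r:{0..s}. W r)"
proof -
  have pos: "lam > 0" "\<mu> > 0" using row by (auto simp: kernel_row_def)
  have mK: "case_prod K \<in> borel_measurable borel" and mL: "case_prod L \<in> borel_measurable borel"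
    and mp: "spm \<in> borel_measurable borel" and mm: "smp \<in> borel_measurable borel"
    using row by (auto simp: kernel_row_def bounded_borel2_def bounded_borel_def)
  obtain CK CL Cp Cm where C: "\<And>x \<xi>. \<bar>K x \<xi>\<bar> \<le> CK" "\<And>x \<xi>. \<bar>L x \<xi>\<bar> \<le> CL" "\<And>x. \<bar>spm x\<bar> \<le> Cp" "\<And>x. \<bar>smp x\<bar> \<le> Cm"
    using row by (auto simp: kernel_row_def bounded_borel2_def bounded_borel_def)
  have mf: "case_prod f \<in> borel_measurable borel" and mg: "case_prod g \<in> borel_measurable borel"
    using I by (auto simp: slab_integrable_def)
  define \<phi> where "\<phi> = (\<lambda>r \<xi>. K (x + lam * r) \<xi> * f r \<xi>)"
  define \<psi> where "\<psi> = (\<lambda>r \<xi>. L (x + lam * r) \<xi> * g r \<xi>)"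
  define \<Phi> where "\<Phi> = (\<lambda>r \<xi>. (- L (x + lam * r) \<xi> * smp \<xi>) * f r \<xi> + K (x + lam * r) \<xi> * F r \<xi>)"
  define \<Psi> where "\<Psi> = (\<lambda>r \<xi>. (- K (x + lam * r) \<xi> * spm \<xi>) * g r \<xi> + L (x + lam * r) \<xi> * G r \<xi>)"
  let ?R = "trapezoid lam x s"
  have sub: "?R \<subseteq> {0..s} \<times> {0..1}" and inT: "\<And>r \<xi>. (r, \<xi>) \<in> ?R \<Longrightarrow> (x + lam * r, \<xi>) \<in> triangle"
  proof -
    have "\<xi> \<le> 1 \<and> (x + lam * r, \<xi>) \<in> triangle" if "(r, \<xi>) \<in> ?R" for r \<xi>
    proof -
      have r: "0 \<le> r" "r \<le> s" "0 \<le> \<xi>" "\<xi> \<le> x + lam * r" using that by (auto simp: trapezoid_def)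
      then have "lam * r \<le> lam * s" using pos by simp
      then show ?thesis using r x by (auto simp: triangle_def)
    qed
    then show "?R \<subseteq> {0..s} \<times> {0..1}" "\<And>r \<xi>. (r, \<xi>) \<in> ?R \<Longrightarrow> (x + lam * r, \<xi>) \<in> triangle"
      by (auto simp: trapezoid_def)
  qed
  have tK: "transport_eq ?R 1 lam (\<lambda>r \<xi>. K (x + lam * r) \<xi>) (\<lambda>r \<xi>. - L (x + lam * r) \<xi> * smp \<xi>)"
    using transport_eq_pullback[of triangle lam 1 lam K "\<lambda>x \<xi>. - L x \<xi> * smp \<xi>" ?R x] row inT
    by (simp add: kernel_row_def)
  have tL: "transport_eq ?R 1 (- \<mu>) (\<lambda>r \<xi>. L (x + lam * r) \<xi>) (\<lambda>r \<xi>. - K (x + lam * r) \<xi> * spm \<xi>)"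
    using transport_eq_pullback[of triangle lam 1 "- \<mu>" L "\<lambda>x \<xi>. - K x \<xi> * spm \<xi>" ?R x] row inT
    by (simp add: kernel_row_def)
  have t\<phi>: "transport_eq ?R 1 lam \<phi> \<Phi>"
    unfolding \<phi>_def \<Phi>_def by (rule transport_eq_mult[OF tK transport_eq_subset[OF tf sub]])
  have t\<psi>: "transport_eq ?R 1 (- \<mu>) \<psi> \<Psi>"
    unfolding \<psi>_def \<Psi>_def by (rule transport_eq_mult[OF tL transport_eq_subset[OF tg sub]])
  have [measurable]: "(\<lambda>p. K (a p) (b p)) \<in> borel_measurable M" "(\<lambda>p. L (a p) (b p)) \<in> borel_measurable M"
    "(\<lambda>p. f (a p) (b p)) \<in> borel_measurable M" "(\<lambda>p. g (a p) (b p)) \<in> borel_measurable M"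
    if "a \<in> borel_measurable M" "b \<in> borel_measurable M" for a b and M :: "real measure"
    using borel_measurable_curried[OF mK that] borel_measurable_curried[OF mL that]
      borel_measurable_curried[OF mf that] borel_measurable_curried[OF mg that] by auto
  have [measurable]: "(\<lambda>p. K (a p) (b p)) \<in> borel_measurable M" "(\<lambda>p. L (a p) (b p)) \<in> borel_measurable M"
    if "a \<in> borel_measurable M" "b \<in> borel_measurable M" for a b and M :: "(real \<times> real) measure"
    using borel_measurable_curried[OF mK that] borel_measurable_curried[OF mL that] by auto
  note [measurable] = mp mm
  have bd: "\<bar>- u * v\<bar> \<le> A * B" if "\<bar>u\<bar> \<le> A" "\<bar>v\<bar> \<le> B" for u v A B :: real
    using mult_mono[OF that] that by (simp add: abs_mult)
  have CLm: "\<bar>- L a b * smp b\<bar> \<le> CL * Cm" and CKp: "\<bar>- K a b * spm b\<bar> \<le> CK * Cp" for a b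
    using bd C by blast+
  have S\<Phi>: "slab_integrable s \<Phi>"
    unfolding \<Phi>_def
    by (rule slab_integrable_add[OF slab_integrable_mult[OF I(1) _ CLm] slab_integrable_mult[OF I(3) _ C(1)]])
       (simp_all add: case_prod_beta')
  have S\<Psi>: "slab_integrable s \<Psi>"
    unfolding \<Psi>_def
    by (rule slab_integrable_add[OF slab_integrable_mult[OF I(2) _ CKp] slab_integrable_mult[OF I(4) _ C(2)]])
       (simp_all add: case_prod_beta')
  note I\<Phi> = slab_integrable_trapezoid[OF S\<Phi> pos(1) x] and I\<Psi> = slab_integrable_trapezoid[OF S\<Psi> pos(1) x]
  note I\<Phi>\<Psi> = slab_integrable_trapezoid[OF slab_integrable_add[OF S\<Phi> S\<Psi>] pos(1) x]
  have xs: "0 \<le> lam * s" using pos s by simp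
  have i\<phi>0: "set_integrable lborel {0..x} (\<phi> 0)"
    unfolding \<phi>_def by (rule set_integrable_bounded_mult[OF set_integrable_subset[OF f0]]) (use C x xs in auto)
  have i\<psi>0: "set_integrable lborel {0..x} (\<psi> 0)"
    unfolding \<psi>_def by (rule set_integrable_bounded_mult[OF set_integrable_subset[OF g0]]) (use C x xs in auto)
  have i\<phi>s: "set_integrable lborel {0..x + lam * s} (\<phi> s)"
    unfolding \<phi>_def by (rule set_integrable_bounded_mult[OF set_integrable_subset[OF fs]]) (use C x xs in auto)
  have i\<psi>s: "set_integrable lborel {0..x + lam * s} (\<psi> s)"
    unfolding \<psi>_def by (rule set_integrable_bounded_mult[OF set_integrable_subset[OF gs]]) (use C x xs in auto)
  have i\<psi>b: "set_integrable lborel {0..s} (\<lambda>r. \<psi> r 0)"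
    unfolding \<psi>_def by (rule set_integrable_bounded_mult[OF gb]) (use C in auto)
  \<comment> \<open>Equality of the two fluxes through \<xi> = 0; the ends of the window are removed
    as a null set.\<close>
  have bnd: "AE r\<in>{0..s} in lborel. lam * \<phi> r 0 = \<mu> * \<psi> r 0"
  proof -
    have "AE r in lborel. r \<noteq> (0::real)" "AE r in lborel. r \<noteq> s" by (rule AE_lborel_singleton)+
    then show ?thesis
    proof eventually_elim
      case (elim r)
      show ?case
      proof
        assume "r \<in> {0..s}"
        with elim have r: "0 < r" "r < s" by auto
        then have "lam * r \<le> lam * s" "0 \<le> lam * r" using pos by simp_all
        then have "x + lam * r \<in> {0..1}" using x by auto
        then have "\<mu> * L (x + lam * r) 0 = lam * q * K (x + lam * r) 0"
          using row unfolding kernel_row_def by blast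
        then show "lam * \<phi> r 0 = \<mu> * \<psi> r 0" using bc[OF r] by (simp add: \<phi>_def \<psi>_def algebra_simps)
      qed
    qed
  qed
  have m\<phi>[measurable]: "(\<lambda>r. \<phi> r 0) \<in> borel_measurable lborel" and m\<psi>[measurable]: "(\<lambda>r. \<psi> r 0) \<in> borel_measurable lborel"
    by (simp_all add: \<phi>_def \<psi>_def)
  \<comment> \<open>The trace of \<open>f\<close> inherits integrability from that of
    \<open>g\<close> through the equality of fluxes.\<close>
  have "set_integrable lborel {0..s} (\<lambda>r. lam * \<phi> r 0)"
    by (subst set_integrable_cong_AE[OF _ _ bnd]) (use i\<psi>b in auto)
  then have i\<phi>b: "set_integrable lborel {0..s} (\<lambda>r. \<phi> r 0)"
    using pos by simp
  have bnd': "lam * (LBINT r:{0..s}. \<phi> r 0) = \<mu> * (LBINT r:{0..s}. \<psi> r 0)"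
    using set_lebesgue_integral_cong_AE[OF _ _ _ bnd] by simp
  \<comment> \<open>The diagonal condition on \<open>L\<close> turns the flux through the slanted
    side into the coupling term.\<close>
  have dg: "(lam + \<mu>) * \<psi> r (x + lam * r) = spm (x + lam * r) * g r (x + lam * r)" if "0 \<le> r" "r \<le> s" for r
  proof -
    have "lam * r \<le> lam * s" "0 \<le> lam * r" using pos that by simp_all
    then have "x + lam * r \<in> {0..1}" using x by auto
    then have "(lam + \<mu>) * L (x + lam * r) (x + lam * r) = spm (x + lam * r)"
      using row unfolding kernel_row_def by blast
    then show ?thesis by (simp add: \<psi>_def flip: mult.assoc)
  qed
  have "set_integrable lborel {0..s} (\<lambda>r. (lam + \<mu>) * \<psi> r (x + lam * r))"
    using gd by (rule set_integrable_cong[THEN iffD1, rotated 3]) (auto simp: dg)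
  then have i\<psi>d: "set_integrable lborel {0..s} (\<lambda>r. \<psi> r (x + lam * r))"
    using pos by simp
  have dg': "(lam + \<mu>) * (LBINT r:{0..s}. \<psi> r (x + lam * r)) = (LBINT r:{0..s}. spm (x + lam * r) * g r (x + lam * r))"
    unfolding set_integral_mult_right[symmetric] by (rule set_lebesgue_integral_cong) (auto simp: dg)
  have V: "volterra K L (f r) (g r) (x + lam * r) = (LBINT \<xi>:{0..x + lam * r}. \<phi> r \<xi>) + (LBINT \<xi>:{0..x + lam * r}. \<psi> r \<xi>)"
    if "set_integrable lborel {0..x + lam * r} (\<phi> r)" "set_integrable lborel {0..x + lam * r} (\<psi> r)" for r
    unfolding volterra_def using set_integral_add(2)[OF that] by (simp add: \<phi>_def \<psi>_def)
  \<comment> \<open>The cross terms are exchanged: the kernel source in \<open>\<Psi>\<close>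
    completes \<open>F\<close>, and the one in \<open>\<Phi>\<close> completes \<open>G\<close>, to
    a defect.\<close>
  have sumeq: "volterra K L (\<lambda>\<xi>. F r \<xi> - spm \<xi> * g r \<xi>) (\<lambda>\<xi>. G r \<xi> - smp \<xi> * f r \<xi>) (x + lam * r) =
     (LBINT \<xi>:{0..x + lam * r}. \<Phi> r \<xi> + \<Psi> r \<xi>)" for r
    unfolding volterra_def by (rule set_lebesgue_integral_cong) (auto simp: \<Phi>_def \<Psi>_def algebra_simps)
  have iW: "set_integrable lborel {0..s} (\<lambda>r. LBINT \<xi>:{0..x + lam * r}. \<Phi> r \<xi> + \<Psi> r \<xi>)"
    using trapezoid_integral(1)[OF I\<Phi>\<Psi>] .
  show "set_integrable lborel {0..s} W"
    unfolding W_def sumeq using gd iW by (rule set_integral_add)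
  have two: "(LBINT r:{0..s}. LBINT \<xi>:{0..x + lam * r}. \<Phi> r \<xi> + \<Psi> r \<xi>) =
     (LBINT r:{0..s}. LBINT \<xi>:{0..x + lam * r}. \<Phi> r \<xi>) + (LBINT r:{0..s}. LBINT \<xi>:{0..x + lam * r}. \<Psi> r \<xi>)"
    unfolding trapezoid_integral(2)[OF I\<Phi>\<Psi>, symmetric] trapezoid_integral(2)[OF I\<Phi>, symmetric]
      trapezoid_integral(2)[OF I\<Psi>, symmetric]
    lborel_pair.integral_fst[OF I\<Phi>\<Psi>] lborel_pair.integral_fst[OF I\<Phi>] lborel_pair.integral_fst[OF I\<Psi>]
    using Bochner_Integration.integral_add[OF I\<Phi> I\<Psi>]
    by (simp add: case_prod_beta' distrib_left)
  have "volterra K L (f s) (g s) (x + lam * s) - volterra K L (f 0) (g 0) x =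
     (LBINT r:{0..s}. LBINT \<xi>:{0..x + lam * r}. \<Phi> r \<xi>) + (LBINT r:{0..s}. LBINT \<xi>:{0..x + lam * r}. \<Psi> r \<xi>)
     + (lam + \<mu>) * (LBINT r:{0..s}. \<psi> r (x + lam * r))"
    using reynolds_parallel[OF pos(1) s x(1) t\<phi> I\<Phi> i\<phi>0 i\<phi>s i\<phi>b]
      reynolds_transversal[OF pos s x(1) t\<psi> I\<Psi> i\<psi>0 i\<psi>s i\<psi>b i\<psi>d] V[of s] V[of 0] i\<phi>0 i\<psi>0 i\<phi>s i\<psi>s bnd'
    by simp
  also have "\<dots> = (LBINT r:{0..s}. W r)"
    unfolding W_def sumeq set_integral_add(2)[OF gd iW] two dg' by simp
  finally show "volterra K L (f s) (g s) (x + lam * s) - volterra K L (f 0) (g 0) x = (LBINT r:{0..s}. W r)" .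
qed

lemma set_integral_reflect:
  fixes h :: "real \<Rightarrow> real"
  assumes "set_integrable lborel {0..s} h"
  shows "set_integrable lborel {0..s} (\<lambda>r. h (s - r))"
    and "(LBINT r:{0..s}. h (s - r)) = (LBINT r:{0..s}. h r)"
proof -
  have e: "(\<lambda>r. indicat_real {0..s} (s + (- 1) * r) * h (s + (- 1) * r)) = (\<lambda>r. indicat_real {0..s} r * h (s - r))"
    by (auto simp: indicator_def fun_eq_iff)
  show "set_integrable lborel {0..s} (\<lambda>r. h (s - r))"
    using set_integral_affine(1)[OF _ assms, of "-1" s] unfolding e by (simp add: set_integrable_def)
  show "(LBINT r:{0..s}. h (s - r)) = (LBINT r:{0..s}. h r)"
    using set_integral_affine(2)[OF _ assms, of "-1" s] unfolding e by (simp add: set_lebesgue_integral_def)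
qed

text \<open>Reversal of a finite window changes the sign of both the speed and the source, which
  turns the family running to the left into one running to the right.\<close>

lemma transport_eq_reverse:
  assumes tr: "transport_eq ({0..T} \<times> X) 1 c g G"
  shows "transport_eq ({0..T} \<times> X) 1 (- c) (\<lambda>r. g (T - r)) (\<lambda>r \<xi>. - G (T - r) \<xi>)"
proof (rule transport_eqI)
  fix y z s :: real
  assume s: "0 \<le> s" and D: "\<And>r. 0 \<le> r \<Longrightarrow> r \<le> s \<Longrightarrow> (y + 1 * r, z + - c * r) \<in> {0..T} \<times> X"
  have D': "(T - y - s + 1 * r, z - c * s + c * r) \<in> {0..T} \<times> X" if "0 \<le> r" "r \<le> s" for r
    using D[of "s - r"] that by (auto simp: algebra_simps)
  note t = transport_eqD[OF tr s D']
  note r = set_integral_reflect[OF t(1)]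
  have e: "(\<lambda>r. G (T - y - s + 1 * (s - r)) (z - c * s + c * (s - r))) = (\<lambda>r. G (T - (y + 1 * r)) (z + - c * r))"
    by (simp add: fun_eq_iff algebra_simps)
  have "set_integrable lborel {0..s} (\<lambda>r. - G (T - (y + 1 * r)) (z + - c * r))"
    using r(1) unfolding e set_integrable_def by simp
  moreover have "(LBINT r:{0..s}. - G (T - (y + 1 * r)) (z + - c * r)) =
     - (LBINT r:{0..s}. G (T - (y + 1 * r)) (z + - c * r))"
    by (simp add: set_lebesgue_integral_def)
  ultimately show "set_integrable lborel {0..s} (\<lambda>r. - G (T - (y + 1 * r)) (z + - c * r)) \<and>
     g (T - (y + 1 * s)) (z + - c * s) - g (T - y) z = (LBINT r:{0..s}. - G (T - (y + 1 * r)) (z + - c * r))"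
    using t(2) r(2) unfolding e by (simp add: algebra_simps)
qed

lemma transport_eq_time_shift:
  assumes "transport_eq half_strip 1 c f F" "0 \<le> t"
  shows "transport_eq ({0..s} \<times> {0..1}) 1 c (\<lambda>r. f (t + r)) (\<lambda>r. F (t + r))"
  using transport_eq_pullback[of half_strip 1 1 c f F "{0..s} \<times> {0..1}" t] assms
  by (auto simp: half_strip_def)

section \<open>Integrability classes for functions of time and space\<close>

text \<open>Weaker than mean-square continuity, yet preserved by the iteration and sufficient for
  it: a spatial \<open>L1\<close> norm bounded locally in time makes a function integrable on slabs
  and makes its Volterra images bounded.\<close>

definition tame :: "(real \<Rightarrow> real \<Rightarrow> real) \<Rightarrow> bool" where
  "tame h \<longleftrightarrow> case_prod h \<in> borel_measurable borel \<and>
     (\<forall>T. \<exists>C. \<forall>t\<in>{0..T}. set_integrable lborel {0..1} (h t) \<and> (LBINT x:{0..1}. \<bar>h t x\<bar>) \<le> C)"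

lemma tame_measurable: "tame h \<Longrightarrow> case_prod h \<in> borel_measurable borel"
  by (simp add: tame_def)

lemma tame_integrable: "tame h \<Longrightarrow> 0 \<le> t \<Longrightarrow> set_integrable lborel {0..1} (h t)"
  unfolding tame_def by (metis atLeastAtMost_iff order_refl)

lemma tame_bound:
  assumes "tame h"
  obtains C where "0 \<le> C" "\<And>t. 0 \<le> t \<Longrightarrow> t \<le> T \<Longrightarrow> (LBINT x:{0..1}. \<bar>h t x\<bar>) \<le> C"
proof -
  obtain C where "\<forall>t\<in>{0..T}. set_integrable lborel {0..1} (h t) \<and> (LBINT x:{0..1}. \<bar>h t x\<bar>) \<le> C"
    using assms unfolding tame_def by blast
  then show ?thesis by (intro that[of "max 0 C"]) (auto simp: le_max_iff_disj)
qed

lemma tameI: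
  assumes "case_prod h \<in> borel_measurable borel" "\<And>t. 0 \<le> t \<Longrightarrow> set_integrable lborel {0..1} (h t)"
    "\<And>T. 0 \<le> T \<Longrightarrow> \<exists>C. \<forall>t. 0 \<le> t \<longrightarrow> t \<le> T \<longrightarrow> (LBINT x:{0..1}. \<bar>h t x\<bar>) \<le> C"
  shows "tame h"
  unfolding tame_def
proof (intro conjI allI)
  fix T :: real
  show "\<exists>C. \<forall>t\<in>{0..T}. set_integrable lborel {0..1} (h t) \<and> (LBINT x:{0..1}. \<bar>h t x\<bar>) \<le> C"
    using assms(3)[of "max 0 T"] assms(2) by (metis atLeastAtMost_iff max.cobounded1 max.coboundedI2)
qed fact

lemma tame_add:
  assumes f: "tame f" and g: "tame g"
  shows "tame (\<lambda>t x. f t x + g t x)"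
proof (rule tameI)
  show "case_prod (\<lambda>t x. f t x + g t x) \<in> borel_measurable borel"
    using tame_measurable[OF f] tame_measurable[OF g] by (auto simp: case_prod_beta')
  show "set_integrable lborel {0..1} (\<lambda>x. f t x + g t x)" if "0 \<le> t" for t
    using tame_integrable[OF f that] tame_integrable[OF g that] by (rule set_integral_add)
  fix T :: real
  obtain C where C: "\<And>t. 0 \<le> t \<Longrightarrow> t \<le> T \<Longrightarrow> (LBINT x:{0..1}. \<bar>f t x\<bar>) \<le> C" by (rule tame_bound[OF f, of T]) blast
  obtain D where D: "\<And>t. 0 \<le> t \<Longrightarrow> t \<le> T \<Longrightarrow> (LBINT x:{0..1}. \<bar>g t x\<bar>) \<le> D" by (rule tame_bound[OF g, of T]) blast
  have "(LBINT x:{0..1}. \<bar>f t x + g t x\<bar>) \<le> C + D" if "0 \<le> t" "t \<le> T" for t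
  proof -
    note i = tame_integrable[OF f that(1)] tame_integrable[OF g that(1)]
    have "(LBINT x:{0..1}. \<bar>f t x + g t x\<bar>) \<le> (LBINT x:{0..1}. \<bar>f t x\<bar> + \<bar>g t x\<bar>)"
      using i by (intro set_integral_mono set_integral_add set_integrable_abs) auto
    also have "\<dots> = (LBINT x:{0..1}. \<bar>f t x\<bar>) + (LBINT x:{0..1}. \<bar>g t x\<bar>)"
      using i by (intro set_integral_add set_integrable_abs)
    finally show ?thesis using C[OF that] D[OF that] by simp
  qed
  then show "\<exists>C. \<forall>t. 0 \<le> t \<longrightarrow> t \<le> T \<longrightarrow> (LBINT x:{0..1}. \<bar>f t x + g t x\<bar>) \<le> C" by blast
qed

lemma tame_mult:
  assumes f: "tame f" and h: "bounded_borel h"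
  shows "tame (\<lambda>t x. h x * f t x)"
proof -
  obtain B where B: "\<And>x. \<bar>h x\<bar> \<le> B" and mh[measurable]: "h \<in> borel_measurable borel"
    using h by (auto simp: bounded_borel_def)
  have B0: "0 \<le> B" using B[of 0] by simp
  show ?thesis
  proof (rule tameI)
    show "case_prod (\<lambda>t x. h x * f t x) \<in> borel_measurable borel"
      using tame_measurable[OF f] by (auto simp: case_prod_beta')
    show i: "set_integrable lborel {0..1} (\<lambda>x. h x * f t x)" if "0 \<le> t" for t
      using tame_integrable[OF f that] by (rule set_integrable_bounded_mult) (use B in auto)
    fix T :: real
    obtain C where C: "\<And>t. 0 \<le> t \<Longrightarrow> t \<le> T \<Longrightarrow> (LBINT x:{0..1}. \<bar>f t x\<bar>) \<le> C" by (rule tame_bound[OF f, of T]) blast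
    have "(LBINT x:{0..1}. \<bar>h x * f t x\<bar>) \<le> B * C" if "0 \<le> t" "t \<le> T" for t
    proof -
      have "(LBINT x:{0..1}. \<bar>h x * f t x\<bar>) \<le> (LBINT x:{0..1}. B * \<bar>f t x\<bar>)"
        using tame_integrable[OF f that(1)] i[OF that(1)] B
        by (intro set_integral_mono set_integrable_mult_right set_integrable_abs) (auto simp: abs_mult mult_right_mono)
      also have "\<dots> = B * (LBINT x:{0..1}. \<bar>f t x\<bar>)" by simp
      also have "\<dots> \<le> B * C" using C[OF that] B0 by (rule mult_left_mono)
      finally show ?thesis .
    qed
    then show "\<exists>C. \<forall>t. 0 \<le> t \<longrightarrow> t \<le> T \<longrightarrow> (LBINT x:{0..1}. \<bar>h x * f t x\<bar>) \<le> C" by blast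
  qed
qed

lemma bounded_borel_const: "bounded_borel (\<lambda>x. c)"
  by (auto simp: bounded_borel_def)

lemma tame_diff:
  assumes "tame f" "tame g"
  shows "tame (\<lambda>t x. f t x - g t x)"
  using tame_add[OF assms(1) tame_mult[OF assms(2) bounded_borel_const[of "-1"]]] by simp

text \<open>The time change \<open>k\<close> covers both the shift \<open>t + r\<close> and the
  reversed window \<open>t + (s - r)\<close>. Fubini's criterion is met by the bound on the spatial
  norm, uniform over the window.\<close>

lemma tame_slab_integrable:
  assumes f: "tame f" and m: "k \<in> borel_measurable borel" and k: "\<And>r. 0 \<le> r \<Longrightarrow> r \<le> s \<Longrightarrow> 0 \<le> k r \<and> k r \<le> T"
  shows "slab_integrable s (\<lambda>r. f (k r))"
proof -
  note mf = tame_measurable[OF f]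
  have mF: "case_prod (\<lambda>r. f (k r)) \<in> borel_measurable borel"
    unfolding case_prod_beta' using m
    by (intro borel_measurable_curried[OF mf]) (auto intro: measurable_compose[OF borel_measurable_fst_snd(1)])
  let ?S = "{0..s} \<times> {0..1::real}"
  let ?h = "\<lambda>p. indicator ?S p * (case p of (r, \<xi>) \<Rightarrow> f (k r) \<xi>)"
  obtain C where C: "0 \<le> C" "\<And>t. 0 \<le> t \<Longrightarrow> t \<le> T \<Longrightarrow> (LBINT x:{0..1}. \<bar>f t x\<bar>) \<le> C"
    using tame_bound[OF f, of T] by blast
  have "closed ?S" by (intro closed_Times closed_atLeastAtMost)
  then have mh: "?h \<in> borel_measurable (lborel \<Otimes>\<^sub>M lborel)"
    unfolding borel_measurable_lborel_pair_iff using mF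
    by (intro borel_measurable_times borel_measurable_indicator borel_closed) auto
  have inner: "(\<lambda>\<xi>. ?h (r, \<xi>)) = (\<lambda>\<xi>. indicator {0..s} r * (indicator {0..1} \<xi> * f (k r) \<xi>))" for r
    by (auto simp: indicator_def)
  have "integrable (lborel \<Otimes>\<^sub>M lborel) ?h"
  proof (rule lborel_pair.Fubini_integrable[OF mh])
    have sl: "set_integrable lborel {0..1} (f (k r))" if "r \<in> {0..s}" for r
      using tame_integrable[OF f] k that by auto
    show "AE r in lborel. integrable lborel (\<lambda>\<xi>. ?h (r, \<xi>))"
      unfolding inner
    proof (rule AE_I2)
      show "integrable lborel (\<lambda>\<xi>. indicator {0..s} r * (indicator {0..1} \<xi> * f (k r) \<xi>))" for r
        using sl[of r] by (cases "r \<in> {0..s}") (auto simp: set_integrable_def)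
    qed
    show "integrable lborel (\<lambda>r. LBINT \<xi>. norm (?h (r, \<xi>)))"
    proof (rule Bochner_Integration.integrable_bound)
      show "integrable lborel (\<lambda>r. indicator {0..s} r * C)"
        by (intro integrable_mult_left integrable_real_indicator) (auto simp: emeasure_lborel_Icc_eq)
      show "(\<lambda>r. LBINT \<xi>. norm (?h (r, \<xi>))) \<in> borel_measurable lborel"
        using measurable_compose[OF mh borel_measurable_norm] by (intro lborel.borel_measurable_lebesgue_integral) (simp add: case_prod_beta')
      show "AE r in lborel. norm (LBINT \<xi>. norm (?h (r, \<xi>))) \<le> norm (indicator {0..s} r * C)"
      proof (rule AE_I2)
        fix r
        have e: "(LBINT \<xi>. norm (?h (r, \<xi>))) = indicator {0..s} r * (LBINT \<xi>:{0..1}. \<bar>f (k r) \<xi>\<bar>)"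
          by (simp add: inner abs_mult set_lebesgue_integral_def indicator_times)
             (simp add: indicator_def of_bool_def abs_mult)
        have "0 \<le> (LBINT \<xi>:{0..1}. \<bar>f (k r) \<xi>\<bar>)"
          unfolding set_lebesgue_integral_def by (rule Bochner_Integration.integral_nonneg) auto
        then show "norm (LBINT \<xi>. norm (?h (r, \<xi>))) \<le> norm (indicator {0..s} r * C)"
          unfolding e using C k[of r] by (auto simp: indicator_def)
      qed
    qed
  qed
  then have "integrable (lborel \<Otimes>\<^sub>M lborel) (\<lambda>(r, \<xi>). indicator ?S (r, \<xi>) * f (k r) \<xi>)"
    by (simp add: case_prod_beta')
  with mF show ?thesis by (simp add: slab_integrable_def)
qed

text \<open>This is required of \<open>\<sigma>\<^sup>+\<^sup>- g\<close> along the characteristics of \<open>f\<close>, which are transversal to those of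
  \<open>g\<close>.\<close>

definition along_integrable :: "real \<Rightarrow> (real \<Rightarrow> real \<Rightarrow> real) \<Rightarrow> bool" where
  "along_integrable b h \<longleftrightarrow> (\<forall>t x s. 0 \<le> t \<longrightarrow> 0 \<le> s \<longrightarrow> (\<forall>r. 0 \<le> r \<longrightarrow> r \<le> s \<longrightarrow> 0 \<le> x + b * r \<and> x + b * r \<le> 1) \<longrightarrow>
     set_integrable lborel {0..s} (\<lambda>r. h (t + r) (x + b * r)))"

text \<open>The sources \<open>F\<close> and \<open>G\<close> are free, so that Neumann iterates,
  which solve the system only approximately, belong to the class. Integrability of the trace at x =
  0 is required of \<open>g\<close>; for \<open>f\<close> it follows from f = q g.\<close>

definition broad_pair ::
  "real \<Rightarrow> real \<Rightarrow> real \<Rightarrow> (real \<Rightarrow> real) \<Rightarrow> (real \<Rightarrow> real) \<Rightarrow> (real \<Rightarrow> real \<Rightarrow> real) \<Rightarrow> (real \<Rightarrow> real \<Rightarrow> real) \<Rightarrow>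
    (real \<Rightarrow> real \<Rightarrow> real) \<Rightarrow> (real \<Rightarrow> real \<Rightarrow> real) \<Rightarrow> bool" where
  "broad_pair lam \<mu> q spm smp f g F G \<longleftrightarrow> tame f \<and> tame g \<and> tame F \<and> tame G \<and>
     transport_eq half_strip 1 lam f F \<and> transport_eq half_strip 1 (- \<mu>) g G \<and>
     (\<forall>t>0. f t 0 = q * g t 0) \<and>
     (\<forall>t s. 0 \<le> t \<longrightarrow> 0 \<le> s \<longrightarrow> set_integrable lborel {0..s} (\<lambda>r. g (t + r) 0)) \<and>
     along_integrable lam (\<lambda>t x. spm x * g t x) \<and> along_integrable (- \<mu>) (\<lambda>t x. smp x * f t x)"

lemma volterra_transport_right:
  assumes row: "kernel_row lam \<mu> q spm smp K L" and bp: "broad_pair lam \<mu> q spm smp f g F G"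
  shows "transport_eq half_strip 1 lam (\<lambda>t. volterra K L (f t) (g t))
     (\<lambda>t x. spm x * g t x + volterra K L (\<lambda>\<xi>. F t \<xi> - spm \<xi> * g t \<xi>) (\<lambda>\<xi>. G t \<xi> - smp \<xi> * f t \<xi>) x)"
proof (rule transport_eqI)
  fix t x s :: real
  assume s: "0 \<le> s" and D: "\<And>r. 0 \<le> r \<Longrightarrow> r \<le> s \<Longrightarrow> (t + 1 * r, x + lam * r) \<in> half_strip"
  have t: "0 \<le> t" "0 \<le> x" "x + lam * s \<le> 1" using D[of 0] D[of s] s by (auto simp: half_strip_def)
  have tm: "tame f" "tame g" "tame F" "tame G" using bp by (auto simp: broad_pair_def)
  have sl: "slab_integrable s (\<lambda>r. h (t + r))" if "tame h" for h
    by (rule tame_slab_integrable[OF that, of _ _ "t + s"]) (use t in auto)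
  have ts: "0 \<le> t + s" "0 \<le> t + 0" using t s by auto
  have T: "transport_eq half_strip 1 lam f F" "transport_eq half_strip 1 (- \<mu>) g G"
    using bp by (auto simp: broad_pair_def)
  have gb: "set_integrable lborel {0..s} (\<lambda>r. g (t + r) 0)"
    using bp t s by (auto simp: broad_pair_def)
  have "along_integrable lam (\<lambda>t x. spm x * g t x)" using bp by (auto simp: broad_pair_def)
  then have gd: "set_integrable lborel {0..s} (\<lambda>r. spm (x + lam * r) * g (t + r) (x + lam * r))"
    unfolding along_integrable_def using t s D by (simp add: half_strip_def)
  show "set_integrable lborel {0..s} (\<lambda>r. spm (x + lam * r) * g (t + 1 * r) (x + lam * r) +
       volterra K L (\<lambda>\<xi>. F (t + 1 * r) \<xi> - spm \<xi> * g (t + 1 * r) \<xi>) (\<lambda>\<xi>. G (t + 1 * r) \<xi> - smp \<xi> * f (t + 1 * r) \<xi>) (x + lam * r)) \<and>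
     volterra K L (f (t + 1 * s)) (g (t + 1 * s)) (x + lam * s) - volterra K L (f t) (g t) x =
     (LBINT r:{0..s}. spm (x + lam * r) * g (t + 1 * r) (x + lam * r) +
       volterra K L (\<lambda>\<xi>. F (t + 1 * r) \<xi> - spm \<xi> * g (t + 1 * r) \<xi>) (\<lambda>\<xi>. G (t + 1 * r) \<xi> - smp \<xi> * f (t + 1 * r) \<xi>) (x + lam * r))"
    using volterra_transport_local[OF row s t(2,3) transport_eq_time_shift[OF T(1) t(1)] transport_eq_time_shift[OF T(2) t(1)]
       sl[OF tm(1)] sl[OF tm(2)] sl[OF tm(3)] sl[OF tm(4)]
       tame_integrable[OF tm(1) ts(2)] tame_integrable[OF tm(1) ts(1)]
       tame_integrable[OF tm(2) ts(2)] tame_integrable[OF tm(2) ts(1)] _ gb gd] bp t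
    by (auto simp: broad_pair_def)
qed

lemma volterra_swap: "volterra K L f g = volterra L K g f"
  by (simp add: volterra_def fun_eq_iff add.commute)

lemma volterra_uminus: "volterra K L (\<lambda>\<xi>. - f \<xi>) (\<lambda>\<xi>. - g \<xi>) x = - volterra K L f g x"
proof -
  have "(\<lambda>\<xi>. indicat_real {0..x} \<xi> *\<^sub>R (K x \<xi> * - f \<xi> + L x \<xi> * - g \<xi>)) =
      (\<lambda>\<xi>. - (indicat_real {0..x} \<xi> *\<^sub>R (K x \<xi> * f \<xi> + L x \<xi> * g \<xi>)))"
    by (simp add: fun_eq_iff algebra_simps)
  then show ?thesis unfolding volterra_def set_lebesgue_integral_def by simp
qed

text \<open>Run backwards in time, the characteristics of \<open>g\<close> move to the right, and
  the local identity applies to the pair (g, f) with \<open>1 / q\<close> in place of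
  \<open>q\<close>.\<close>

lemma volterra_transport_left:
  assumes row: "kernel_row \<mu> lam (1 / q) (\<lambda>x. - smp x) (\<lambda>x. - spm x) L K" and q: "q \<noteq> 0"
    and bp: "broad_pair lam \<mu> q spm smp f g F G"
  shows "transport_eq half_strip 1 (- \<mu>) (\<lambda>t. volterra K L (f t) (g t))
     (\<lambda>t x. smp x * f t x + volterra K L (\<lambda>\<xi>. F t \<xi> - spm \<xi> * g t \<xi>) (\<lambda>\<xi>. G t \<xi> - smp \<xi> * f t \<xi>) x)"
proof (rule transport_eqI)
  fix t z s :: real
  assume s: "0 \<le> s" and D: "\<And>r. 0 \<le> r \<Longrightarrow> r \<le> s \<Longrightarrow> (t + 1 * r, z + - \<mu> * r) \<in> half_strip"
  \<comment> \<open>The end point of the characteristic, which is the starting point of the reversed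
    one.\<close>
  define x where "x = z - \<mu> * s"
  have t: "0 \<le> t" "0 \<le> x" "x + \<mu> * s \<le> 1" using D[of 0] D[of s] s by (auto simp: half_strip_def x_def)
  have tm: "tame f" "tame g" "tame F" "tame G" using bp by (auto simp: broad_pair_def)
  have tn: "tame (\<lambda>t x. - F t x)" "tame (\<lambda>t x. - G t x)"
    using tame_mult[OF tm(3) bounded_borel_const[of "-1"]] tame_mult[OF tm(4) bounded_borel_const[of "-1"]] by auto
  have sl: "slab_integrable s (\<lambda>r. h (t + (s - r)))" if "tame h" for h
    by (rule tame_slab_integrable[OF that, of _ _ "t + s"]) (use t in auto)
  have ts: "0 \<le> t + (s - 0)" "0 \<le> t + (s - s)" using t s by auto
  have T: "transport_eq half_strip 1 lam f F" "transport_eq half_strip 1 (- \<mu>) g G"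
    using bp by (auto simp: broad_pair_def)
  have T1: "transport_eq ({0..s} \<times> {0..1}) 1 (- lam) (\<lambda>r. f (t + (s - r))) (\<lambda>r \<xi>. - F (t + (s - r)) \<xi>)"
    using transport_eq_reverse[OF transport_eq_time_shift[OF T(1) t(1)]] .
  have T2: "transport_eq ({0..s} \<times> {0..1}) 1 \<mu> (\<lambda>r. g (t + (s - r))) (\<lambda>r \<xi>. - G (t + (s - r)) \<xi>)"
    using transport_eq_reverse[OF transport_eq_time_shift[OF T(2) t(1)]] by simp
  have gb: "set_integrable lborel {0..s} (\<lambda>r. g (t + r) 0)" and bc: "\<And>t. 0 < t \<Longrightarrow> f t 0 = q * g t 0"
    using bp t s by (auto simp: broad_pair_def)
  \<comment> \<open>After the exchange it is the trace of \<open>f\<close> that has to be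
    integrable. If t = 0, the boundary condition may fail at r = 0, so the comparison is almost
    everywhere.\<close>
  have fb: "set_integrable lborel {0..s} (\<lambda>r. f (t + r) 0)"
  proof -
    have "set_integrable lborel {0..s} (\<lambda>r. f (t + r) 0) \<longleftrightarrow> set_integrable lborel {0..s} (\<lambda>r. q * g (t + r) 0)"
    proof (rule set_integrable_cong_AE)
      have "AE r in lborel. r \<noteq> (0::real)" by (rule AE_lborel_singleton)
      then show "AE r\<in>{0..s} in lborel. f (t + r) 0 = q * g (t + r) 0"
        by eventually_elim (use bc t in auto)
    qed (auto intro!: borel_measurable_curried[OF tame_measurable[OF tm(1)]]
        borel_measurable_curried[OF tame_measurable[OF tm(2)]] borel_measurable_times)
    with gb show ?thesis by simp
  qed
  have "along_integrable (- \<mu>) (\<lambda>t x. smp x * f t x)" using bp by (auto simp: broad_pair_def)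
  then have "set_integrable lborel {0..s} (\<lambda>r. smp (z + - \<mu> * r) * f (t + r) (z + - \<mu> * r))"
    unfolding along_integrable_def using t s D by (simp add: half_strip_def)
  from set_integral_reflect(1)[OF this]
  have "set_integrable lborel {0..s} (\<lambda>r. smp (x + \<mu> * r) * f (t + (s - r)) (x + \<mu> * r))"
    by (simp add: x_def algebra_simps)
  then have fd: "set_integrable lborel {0..s} (\<lambda>r. - smp (x + \<mu> * r) * f (t + (s - r)) (x + \<mu> * r))"
    by (simp add: set_integrable_def)
  have bc': "g (t + (s - r)) 0 = 1 / q * f (t + (s - r)) 0" if "0 < r" "r < s" for r
    using bc[of "t + (s - r)"] t that q by simp
  let ?H = "\<lambda>t x. smp x * f t x + volterra K L (\<lambda>\<xi>. F t \<xi> - spm \<xi> * g t \<xi>) (\<lambda>\<xi>. G t \<xi> - smp \<xi> * f t \<xi>) x"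
  \<comment> \<open>The reversed sources and the negated couplings change the sign of the whole
    integrand; the exchange of the end points of the characteristic undoes this.\<close>
  have W: "- smp (x + \<mu> * r) * f (t + (s - r)) (x + \<mu> * r) +
      volterra L K (\<lambda>\<xi>. - G (t + (s - r)) \<xi> - - smp \<xi> * f (t + (s - r)) \<xi>)
        (\<lambda>\<xi>. - F (t + (s - r)) \<xi> - - spm \<xi> * g (t + (s - r)) \<xi>) (x + \<mu> * r) =
      - ?H (t + (s - r)) (z + - \<mu> * (s - r))" for r
    using volterra_uminus[of L K "\<lambda>\<xi>. G (t + (s - r)) \<xi> - smp \<xi> * f (t + (s - r)) \<xi>"
       "\<lambda>\<xi>. F (t + (s - r)) \<xi> - spm \<xi> * g (t + (s - r)) \<xi>"]
    by (simp add: x_def volterra_swap[of K L] algebra_simps)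
  note R = volterra_transport_local[OF row s t(2,3) T2 T1
       sl[OF tm(2)] sl[OF tm(1)] sl[OF tn(2)] sl[OF tn(1)]
       tame_integrable[OF tm(2) ts(1)] tame_integrable[OF tm(2) ts(2)]
       tame_integrable[OF tm(1) ts(1)] tame_integrable[OF tm(1) ts(2)] bc' set_integral_reflect(1)[OF fb] fd, unfolded W]
  have i: "set_integrable lborel {0..s} (\<lambda>r. ?H (t + (s - r)) (z + - \<mu> * (s - r)))"
    using set_integrable_mult_right[of "-1", OF R(1)] by (simp only: mult_minus1 minus_minus)
  have v: "(LBINT r:{0..s}. - ?H (t + (s - r)) (z + - \<mu> * (s - r))) = - (LBINT r:{0..s}. ?H (t + (s - r)) (z + - \<mu> * (s - r)))"
    by (simp only: set_integral_uminus[OF i])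
  show "set_integrable lborel {0..s} (\<lambda>r. ?H (t + 1 * r) (z + - \<mu> * r)) \<and>
     volterra K L (f (t + 1 * s)) (g (t + 1 * s)) (z + - \<mu> * s) - volterra K L (f t) (g t) z =
     (LBINT r:{0..s}. ?H (t + 1 * r) (z + - \<mu> * r))"
    using set_integral_reflect[OF i] R(2)[unfolded v] by (simp add: x_def volterra_swap[of L K])
qed

section \<open>From solutions to the neutral equation\<close>

lemma L2_01_measurable: "L2_01 f \<Longrightarrow> (\<lambda>x. indicator {0..1} x * f x) \<in> borel_measurable borel"
  by (simp add: L2_01_def set_borel_measurable_def)

lemma L2_01_cong:
  assumes "\<And>x. 0 \<le> x \<Longrightarrow> x \<le> 1 \<Longrightarrow> f x = g x"
  shows "L2_01 f = L2_01 g"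
proof -
  have "(\<lambda>x. indicat_real {0..1} x *\<^sub>R f x) = (\<lambda>x. indicat_real {0..1} x *\<^sub>R g x)"
    using assms by (auto simp: fun_eq_iff indicator_def)
  moreover have "(\<lambda>x. indicat_real {0..1} x *\<^sub>R (f x)\<^sup>2) = (\<lambda>x. indicat_real {0..1} x *\<^sub>R (g x)\<^sup>2)"
    using assms by (auto simp: fun_eq_iff indicator_def)
  ultimately show ?thesis unfolding L2_01_def set_borel_measurable_def set_integrable_def by simp
qed

lemma set_integrable_const_01: "set_integrable lborel {0..1::real} (\<lambda>x. c :: real)"
  by (simp add: borel_integrable_atLeastAtMost')

lemma L2_01_bound:
  assumes f: "set_borel_measurable borel {0..1} f" and g: "set_integrable lborel {0..1} g"
    and le: "\<And>x. 0 \<le> x \<Longrightarrow> x \<le> 1 \<Longrightarrow> (f x)\<^sup>2 \<le> g x"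
  shows "L2_01 f"
  unfolding L2_01_def
proof (intro conjI f set_integrable_bound[OF g])
  have "(\<lambda>x. (indicat_real {0..1} x *\<^sub>R f x)\<^sup>2) \<in> borel_measurable borel"
    using f unfolding set_borel_measurable_def by (rule borel_measurable_power)
  also have "(\<lambda>x. (indicat_real {0..1} x *\<^sub>R f x)\<^sup>2) = (\<lambda>x. indicat_real {0..1} x *\<^sub>R (f x)\<^sup>2)"
    by (auto simp: fun_eq_iff indicator_def)
  finally show "set_borel_measurable lborel {0..1} (\<lambda>x. (f x)\<^sup>2)"
    by (simp add: set_borel_measurable_def)
  show "AE x in lborel. x \<in> {0..1} \<longrightarrow> norm ((f x)\<^sup>2) \<le> norm (g x)"
    using le by (intro AE_I2) (auto intro: order_trans[OF _ abs_ge_self])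
qed

lemma L2_01_cmult: "L2_01 f \<Longrightarrow> L2_01 (\<lambda>x. c * f x)"
proof (rule L2_01_bound[where g = "\<lambda>x. c\<^sup>2 * (f x)\<^sup>2"])
  assume f: "L2_01 f"
  have "(\<lambda>x. c * (indicat_real {0..1} x * f x)) \<in> borel_measurable borel"
    using L2_01_measurable[OF f] by simp
  then show "set_borel_measurable borel {0..1} (\<lambda>x. c * f x)"
    by (simp add: set_borel_measurable_def mult_ac)
qed (auto simp: L2_01_def power_mult_distrib)

lemma square_add_le: "(a + b)\<^sup>2 \<le> 2 * a\<^sup>2 + 2 * (b::real)\<^sup>2"
proof -
  have "0 \<le> (a - b)\<^sup>2" by simp
  then show ?thesis by (simp add: power2_eq_square algebra_simps)
qed

lemma L2_01_add:
  assumes "L2_01 f" "L2_01 g"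
  shows "L2_01 (\<lambda>x. f x + g x)"
proof (rule L2_01_bound[where g = "\<lambda>x. 2 * (f x)\<^sup>2 + 2 * (g x)\<^sup>2"])
  have "(\<lambda>x. indicat_real {0..1} x * f x + indicat_real {0..1} x * g x) \<in> borel_measurable borel"
    using L2_01_measurable[OF assms(1)] L2_01_measurable[OF assms(2)] by simp
  then show "set_borel_measurable borel {0..1} (\<lambda>x. f x + g x)"
    by (simp add: set_borel_measurable_def distrib_left)
  show "set_integrable lborel {0..1} (\<lambda>x. 2 * (f x)\<^sup>2 + 2 * (g x)\<^sup>2)"
    using assms by (intro set_integral_add set_integrable_mult_right) (auto simp: L2_01_def)
qed (rule square_add_le)

lemma L2_01_diff: "L2_01 f \<Longrightarrow> L2_01 g \<Longrightarrow> L2_01 (\<lambda>x. f x - g x)"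
  using L2_01_add[OF _ L2_01_cmult[of g "-1"], of f] by simp

lemma L2_01_bounded:
  assumes "set_borel_measurable borel {0..1} f" "\<And>x. 0 \<le> x \<Longrightarrow> x \<le> 1 \<Longrightarrow> \<bar>f x\<bar> \<le> C"
  shows "L2_01 f"
  by (rule L2_01_bound[OF assms(1) set_integrable_const_01[of "C\<^sup>2"]])
     (metis assms(2) abs_ge_zero power2_abs power_mono)

lemma L2_01_integrable:
  assumes "L2_01 f"
  shows "set_integrable lborel {0..1} f" and "(LBINT x:{0..1}. \<bar>f x\<bar>) \<le> 1 + (LBINT x:{0..1}. (f x)\<^sup>2)"
proof -
  have sq: "set_integrable lborel {0..1} (\<lambda>x. (f x)\<^sup>2)" using assms by (simp add: L2_01_def)
  have le: "\<bar>y\<bar> \<le> 1 + y\<^sup>2" for y :: real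
  proof -
    have "0 \<le> (1 - \<bar>y\<bar>)\<^sup>2" by simp
    then show ?thesis by (simp add: power2_diff)
  qed
  have i: "set_integrable lborel {0..1} (\<lambda>x. 1 + (f x)\<^sup>2)"
    using set_integrable_const_01 sq by (rule set_integral_add)
  show f: "set_integrable lborel {0..1} f"
    by (rule set_integrable_bound[OF i])
       (use assms le in \<open>auto simp: L2_01_def set_borel_measurable_def abs_of_nonneg add_nonneg_nonneg\<close>)
  have "(LBINT x:{0..1}. \<bar>f x\<bar>) \<le> (LBINT x:{0..1}. 1 + (f x)\<^sup>2)"
    using f i le by (intro set_integral_mono set_integrable_abs) auto
  also have "\<dots> = (LBINT x:{0..1::real}. 1) + (LBINT x:{0..1}. (f x)\<^sup>2)"
    using set_integrable_const_01 sq by (rule set_integral_add)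
  also have "(LBINT x:{0..1::real}. 1) = (1::real)"
    by (simp add: set_lebesgue_integral_def)
  finally show "(LBINT x:{0..1}. \<bar>f x\<bar>) \<le> 1 + (LBINT x:{0..1}. (f x)\<^sup>2)" .
qed

lemma compact_locally_bounded:
  fixes h :: "real \<Rightarrow> real"
  assumes S: "compact S" and loc: "\<And>t. t \<in> S \<Longrightarrow> \<exists>d>0. \<exists>C. \<forall>s\<in>S. dist t s < d \<longrightarrow> h s \<le> C"
  shows "\<exists>C. \<forall>s\<in>S. h s \<le> C"
proof -
  obtain d C where dC: "\<And>t. t \<in> S \<Longrightarrow> 0 < d t" "\<And>t s. t \<in> S \<Longrightarrow> s \<in> S \<Longrightarrow> dist t s < d t \<Longrightarrow> h s \<le> C t"
    using loc by metis
  obtain S' where S': "S' \<subseteq> S" "finite S'" "S \<subseteq> (\<Union>t\<in>S'. ball t (d t))"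
    by (rule compactE_image[OF S, of S "\<lambda>t. ball t (d t)"]) (use dC in auto)
  have "h s \<le> Max (insert 0 (C ` S'))" if "s \<in> S" for s
  proof -
    obtain t where t: "t \<in> S'" "s \<in> ball t (d t)" using S' \<open>s \<in> S\<close> by auto
    then have "h s \<le> C t" using dC(2)[of t s] S' \<open>s \<in> S\<close> by auto
    also have "\<dots> \<le> Max (insert 0 (C ` S'))" using t S' by (intro Max_ge) auto
    finally show ?thesis .
  qed
  then show ?thesis by blast
qed

text \<open>Continuity bounds the norm only near each time, where the state stays within mean-square
  distance 1 of its value at \<open>t\<close>; compactness of the time interval makes the bound
  uniform.\<close>

lemma L2_continuous_bounded:
  assumes "L2_continuous w"
  shows "\<exists>C. \<forall>t\<in>{0..T}. (LBINT x:{0..1}. (w t x)\<^sup>2) \<le> C"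
proof (rule compact_locally_bounded[OF compact_Icc])
  fix t assume t: "t \<in> {0..T}"
  have L2: "L2_01 (w s)" if "0 \<le> s" for s using assms that by (simp add: L2_continuous_def)
  have "((\<lambda>s. LBINT x:{0..1}. (w s x - w t x)\<^sup>2) \<longlongrightarrow> 0) (at t within {0..})"
    using assms t by (simp add: L2_continuous_def)
  from tendstoD[OF this, of 1]
  obtain d where d: "d > 0" "\<And>s. s \<in> {0..} \<Longrightarrow> s \<noteq> t \<Longrightarrow> dist s t < d \<Longrightarrow> \<bar>LBINT x:{0..1}. (w s x - w t x)\<^sup>2\<bar> < 1"
    by (auto simp: eventually_at)
  have "(LBINT x:{0..1}. (w s x)\<^sup>2) \<le> 2 + 2 * (LBINT x:{0..1}. (w t x)\<^sup>2)" if s: "s \<in> {0..T}" "dist t s < d" for s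
  proof -
    have i: "set_integrable lborel {0..1} (\<lambda>x. (w s x - w t x)\<^sup>2)" "set_integrable lborel {0..1} (\<lambda>x. (w t x)\<^sup>2)"
      "set_integrable lborel {0..1} (\<lambda>x. (w s x)\<^sup>2)"
      using L2_01_diff[OF L2 L2, of s t] L2[of s] L2[of t] s t by (auto simp: L2_01_def)
    have "(LBINT x:{0..1}. (w s x - w t x)\<^sup>2) \<le> 1"
    proof (cases "s = t")
      case False
      with d(2)[of s] s show ?thesis by (simp add: dist_commute abs_less_iff)
    qed simp
    moreover have "(w s x)\<^sup>2 \<le> 2 * (w s x - w t x)\<^sup>2 + 2 * (w t x)\<^sup>2" for x
      using square_add_le[of "w s x - w t x" "w t x"] by simp
    then have "(LBINT x:{0..1}. (w s x)\<^sup>2) \<le> (LBINT x:{0..1}. 2 * (w s x - w t x)\<^sup>2 + 2 * (w t x)\<^sup>2)"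
      using i
      by (intro set_integral_mono set_integral_add set_integrable_mult_right) auto
    moreover have "\<dots> = 2 * (LBINT x:{0..1}. (w s x - w t x)\<^sup>2) + 2 * (LBINT x:{0..1}. (w t x)\<^sup>2)"
      using i by (subst set_integral_add) auto
    ultimately show ?thesis by linarith
  qed
  then show "\<exists>d>0. \<exists>C. \<forall>s\<in>{0..T}. dist t s < d \<longrightarrow> (LBINT x:{0..1}. (w s x)\<^sup>2) \<le> C"
    using d(1) by blast
qed

section \<open>Extension by zero\<close>

text \<open>The hypotheses say nothing outside the half-strip and the triangle, not even
  measurability. Cutting off yields globally Borel functions and changes no value that enters a
  transport equation or a Volterra integral on these sets.\<close>

definition ext2 :: "(real \<times> real) set \<Rightarrow> (real \<Rightarrow> real \<Rightarrow> real) \<Rightarrow> real \<Rightarrow> real \<Rightarrow> real" where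
  "ext2 D f x y = (if (x, y) \<in> D then f x y else 0)"

lemma ext2_in: "(x, y) \<in> D \<Longrightarrow> ext2 D f x y = f x y"
  by (simp add: ext2_def)

lemma ext2_measurable:
  "set_borel_measurable borel D (case_prod f) \<Longrightarrow> case_prod (ext2 D f) \<in> borel_measurable borel"
proof -
  have "(\<lambda>x. indicat_real D x *\<^sub>R case_prod f x) = case_prod (ext2 D f)"
    by (auto simp: fun_eq_iff ext2_def indicator_def)
  then show "set_borel_measurable borel D (case_prod f) \<Longrightarrow> case_prod (ext2 D f) \<in> borel_measurable borel"
    by (simp add: set_borel_measurable_def)
qed

lemma L2_continuous_tame:
  assumes m: "set_borel_measurable borel half_strip (case_prod w)" and L2: "L2_continuous w"
  shows "tame (ext2 half_strip w)"
proof (rule tameI[OF ext2_measurable[OF m]])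
  have e: "ext2 half_strip w t x = w t x" if "0 \<le> t" "0 \<le> x" "x \<le> 1" for t x
    using that by (simp add: ext2_def half_strip_def)
  have L: "L2_01 (w t)" if "0 \<le> t" for t using L2 that by (simp add: L2_continuous_def)
  show "set_integrable lborel {0..1} (ext2 half_strip w t)" if "0 \<le> t" for t
    using L2_01_integrable(1)[OF L[OF that]]
    by (rule set_integrable_cong[THEN iffD1, rotated 3]) (use e that in auto)
  fix T :: real
  obtain C where C: "\<forall>t\<in>{0..T}. (LBINT x:{0..1}. (w t x)\<^sup>2) \<le> C"
    using L2_continuous_bounded[OF L2] by blast
  have "(LBINT x:{0..1}. \<bar>ext2 half_strip w t x\<bar>) \<le> 1 + C" if "0 \<le> t" "t \<le> T" for t
  proof -
    have "(LBINT x:{0..1}. \<bar>ext2 half_strip w t x\<bar>) = (LBINT x:{0..1}. \<bar>w t x\<bar>)"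
      by (rule set_lebesgue_integral_cong) (use e that in auto)
    also have "\<dots> \<le> 1 + (LBINT x:{0..1}. (w t x)\<^sup>2)" by (rule L2_01_integrable(2)[OF L[OF that(1)]])
    also have "\<dots> \<le> 1 + C" using C that by auto
    finally show ?thesis .
  qed
  then show "\<exists>C. \<forall>t. 0 \<le> t \<longrightarrow> t \<le> T \<longrightarrow> (LBINT x:{0..1}. \<bar>ext2 half_strip w t x\<bar>) \<le> C" by blast
qed

lemma Linf_triangle_ext2:
  assumes "Linf_triangle K"
  shows "bounded_borel2 (ext2 triangle K)"
proof -
  obtain C where C: "\<forall>(x, \<xi>)\<in>triangle. \<bar>K x \<xi>\<bar> \<le> C" using assms by (auto simp: Linf_triangle_def)
  have "\<bar>ext2 triangle K x \<xi>\<bar> \<le> max 0 C" for x \<xi> using C by (auto simp: ext2_def le_max_iff_disj)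
  then show ?thesis using assms ext2_measurable unfolding bounded_borel2_def Linf_triangle_def by blast
qed

definition ext1 :: "(real \<Rightarrow> real) \<Rightarrow> real \<Rightarrow> real" where
  "ext1 f x = (if 0 \<le> x \<and> x \<le> 1 then f x else 0)"

lemma Linf_01_ext1:
  assumes "Linf_01 f"
  shows "bounded_borel (ext1 f)"
proof -
  obtain C where C: "\<forall>x\<in>{0..1}. \<bar>f x\<bar> \<le> C" using assms by (auto simp: Linf_01_def)
  have "\<bar>ext1 f x\<bar> \<le> max 0 C" for x using C by (auto simp: ext1_def le_max_iff_disj)
  moreover have "(\<lambda>x. indicat_real {0..1} x *\<^sub>R f x) = ext1 f"
    by (auto simp: fun_eq_iff ext1_def indicator_def)
  ultimately show ?thesis using assms unfolding bounded_borel_def Linf_01_def set_borel_measurable_def by auto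
qed

lemma bounded_borel_uminus: "bounded_borel h \<Longrightarrow> bounded_borel (\<lambda>x. - h x)"
  by (auto simp: bounded_borel_def)

lemma triangle_bounds: "(x, \<xi>) \<in> triangle \<Longrightarrow> 0 \<le> \<xi> \<and> \<xi> \<le> 1"
  by (auto simp: triangle_def)

lemma volterra_cong:
  assumes "\<And>\<xi>. 0 \<le> \<xi> \<Longrightarrow> \<xi> \<le> x \<Longrightarrow> K x \<xi> = K' x \<xi>" "\<And>\<xi>. 0 \<le> \<xi> \<Longrightarrow> \<xi> \<le> x \<Longrightarrow> L x \<xi> = L' x \<xi>"
    "\<And>\<xi>. 0 \<le> \<xi> \<Longrightarrow> \<xi> \<le> x \<Longrightarrow> f \<xi> = f' \<xi>" "\<And>\<xi>. 0 \<le> \<xi> \<Longrightarrow> \<xi> \<le> x \<Longrightarrow> g \<xi> = g' \<xi>"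
  shows "volterra K L f g x = volterra K' L' f' g' x"
  unfolding volterra_def by (rule set_lebesgue_integral_cong) (auto simp: assms)

lemma volterra_ext2:
  assumes "x \<le> 1"
  shows "volterra (ext2 triangle K) (ext2 triangle L) f g x = volterra K L f g x"
  by (rule volterra_cong) (use assms in \<open>auto simp: ext2_def triangle_def\<close>)

text \<open>The boundary trace is controlled on windows of length 1 / \<mu>, the time a
  characteristic needs to cross [0, 1]; longer intervals are pieced together from these.\<close>

lemma set_integrable_windows:
  fixes h :: "real \<Rightarrow> real"
  assumes d: "d > 0" and w: "\<And>t. 0 \<le> t \<Longrightarrow> set_integrable lborel {t..t + d} h"
    and a: "0 \<le> a"
  shows "set_integrable lborel {a..b} h"
proof -
  have n: "set_integrable lborel {0..real n * d} h" for n
  proof (induction n)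
    case 0
    have "set_integrable lborel {0..0 + d} h" by (rule w) simp
    then show ?case by (rule set_integrable_subset) (use d in auto)
  next
    case (Suc n)
    have nd: "0 \<le> real n * d" "0 \<le> d" using d by simp_all
    have "{0..real (Suc n) * d} = {0..real n * d} \<union> {real n * d..real n * d + d}"
      using nd(2) by (auto simp: distrib_right intro: order_trans[OF nd(1)])
    then show ?case using Suc w[OF nd(1)] by (simp add: set_integrable_Un)
  qed
  obtain n where "b \<le> real n * d"
    using reals_Archimedean3[OF d] less_imp_le by blast
  then show ?thesis using a by (intro set_integrable_subset[OF n[of n]]) auto
qed

lemma set_integrable_shift_iff:
  fixes h :: "real \<Rightarrow> real"
  shows "set_integrable lborel {0..s} (\<lambda>r. h (t + r)) \<longleftrightarrow> set_integrable lborel {t..t + s} h"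
proof -
  have "(\<lambda>r. indicator {0..s} r * h (t + r)) = (\<lambda>r. indicator {t..t + s} (t + 1 * r) * h (t + 1 * r))"
    by (auto simp: indicator_def fun_eq_iff)
  then show ?thesis
    using lborel_integrable_real_affine_iff[of 1 "\<lambda>r. indicator {t..t + s} r * h r" t]
    by (simp add: set_integrable_def)
qed

lemma backstepping_kernel_rows:
  assumes pos: "lam > 0" "\<mu> > 0" and q: "q \<noteq> 0" and L: "Linf_01 spm" "Linf_01 smp"
    and bk: "backstepping_kernels lam \<mu> q spm smp Kuu Kuv Kvu Kvv"
  shows "kernel_row lam \<mu> q (ext1 spm) (ext1 smp) (ext2 triangle Kuu) (ext2 triangle Kuv)"
    and "kernel_row \<mu> lam (1 / q) (\<lambda>x. - ext1 smp x) (\<lambda>x. - ext1 spm x) (ext2 triangle Kvv) (ext2 triangle Kvu)"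
proof -
  note b = bk[unfolded backstepping_kernels_def]
  have e: "ext2 triangle A x \<xi> = A x \<xi>" "ext1 h \<xi> = h \<xi>" if "(x, \<xi>) \<in> triangle" for A h x \<xi>
    using that triangle_bounds[OF that] by (auto simp: ext2_in ext1_def)
  have B: "Kvu x x = - smp x / (lam + \<mu>)" "Kvv x 0 = lam * q / \<mu> * Kvu x 0"
      "Kuv x x = spm x / (lam + \<mu>)" "Kuv x 0 = lam * q / \<mu> * Kuu x 0" if "x \<in> {0..1}" for x
    using b that by blast+
  have K: "bounded_borel2 (ext2 triangle Kuu)" "bounded_borel2 (ext2 triangle Kuv)"
    "bounded_borel2 (ext2 triangle Kvu)" "bounded_borel2 (ext2 triangle Kvv)"
    using b by (blast intro: Linf_triangle_ext2)+
  note S = Linf_01_ext1[OF L(1)] Linf_01_ext1[OF L(2)]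
  have tr: "(x, x) \<in> triangle" "(x, 0) \<in> triangle" if "x \<in> {0..1}" for x
    using that by (auto simp: triangle_def)
  note T = b[THEN conjunct2, THEN conjunct2, THEN conjunct2, THEN conjunct2]
  have "transport_eq triangle lam lam (ext2 triangle Kuu) (\<lambda>x \<xi>. - ext2 triangle Kuv x \<xi> * ext1 smp \<xi>)"
    by (rule transport_eq_cong[OF _ _ T[THEN conjunct1]]) (simp_all add: e)
  moreover have "transport_eq triangle lam (- \<mu>) (ext2 triangle Kuv) (\<lambda>x \<xi>. - ext2 triangle Kuu x \<xi> * ext1 spm \<xi>)"
    by (rule transport_eq_cong[OF _ _ T[THEN conjunct2, THEN conjunct1]]) (simp_all add: e)
  moreover have "(lam + \<mu>) * ext2 triangle Kuv x x = ext1 spm x \<and> \<mu> * ext2 triangle Kuv x 0 = lam * q * ext2 triangle Kuu x 0"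
    if "x \<in> {0..1}" for x
    using B[OF that] that pos tr[OF that] by (simp add: ext2_in ext1_def)
  ultimately show "kernel_row lam \<mu> q (ext1 spm) (ext1 smp) (ext2 triangle Kuu) (ext2 triangle Kuv)"
    unfolding kernel_row_def using K S pos by blast
  have "transport_eq triangle \<mu> \<mu> (ext2 triangle Kvv) (\<lambda>x \<xi>. - ext2 triangle Kvu x \<xi> * - ext1 spm \<xi>)"
    by (rule transport_eq_cong[OF _ _ T[THEN conjunct2, THEN conjunct2, THEN conjunct2, THEN conjunct1]]) (simp_all add: e)
  moreover have "transport_eq triangle \<mu> (- lam) (ext2 triangle Kvu) (\<lambda>x \<xi>. - ext2 triangle Kvv x \<xi> * - ext1 smp \<xi>)"
    by (rule transport_eq_cong[OF _ _ T[THEN conjunct2, THEN conjunct2, THEN conjunct1]]) (simp_all add: e)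
  \<comment> \<open>Division by \<open>q\<close> rewrites the condition on \<open>Kvv\<close> at
    \<xi> = 0 in the form required of the exchanged row.\<close>
  moreover have "(\<mu> + lam) * ext2 triangle Kvu x x = - ext1 smp x \<and> lam * ext2 triangle Kvu x 0 = \<mu> * (1 / q) * ext2 triangle Kvv x 0"
    if "x \<in> {0..1}" for x
    using B[OF that] that pos q tr[OF that] by (simp add: ext2_in ext1_def add.commute)
  ultimately show "kernel_row \<mu> lam (1 / q) (\<lambda>x. - ext1 smp x) (\<lambda>x. - ext1 spm x) (ext2 triangle Kvv) (ext2 triangle Kvu)"
    unfolding kernel_row_def using K S[THEN bounded_borel_uminus] pos by blast
qed

text \<open>The sources are the couplings themselves, so their integrability along the transversal
  characteristics is already contained in the transport equations. The trace of \<open>v\<close> at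
  x = 0 comes from windows of length 1 / \<mu>, each started afresh at its own initial time.\<close>

lemma broad_pair_of_solution:
  assumes pos: "lam > 0" "\<mu> > 0" and L: "Linf_01 spm" "Linf_01 smp"
    and sol: "hyperbolic_solution lam \<mu> q \<rho> spm smp U u0 v0 u v"
  defines "u' \<equiv> ext2 half_strip u" and "v' \<equiv> ext2 half_strip v"
  shows "broad_pair lam \<mu> q (ext1 spm) (ext1 smp) u' v' (\<lambda>t x. ext1 spm x * v' t x) (\<lambda>t x. ext1 smp x * u' t x)"
proof -
  note s = sol[unfolded hyperbolic_solution_def]
  have tu: "tame u'" and tv: "tame v'" using s by (auto simp: u'_def v'_def intro: L2_continuous_tame)
  note tF = tame_mult[OF tv Linf_01_ext1[OF L(1)]] and tG = tame_mult[OF tu Linf_01_ext1[OF L(2)]]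
  have hs: "ext1 h x = h x" if "(t, x) \<in> half_strip" for h t x
    using that by (simp add: ext1_def half_strip_def)
  have T1: "transport_eq half_strip 1 lam u' (\<lambda>t x. ext1 spm x * v' t x)"
    by (rule transport_eq_cong[of half_strip u u' "\<lambda>t x. spm x * v t x"])
       (use s in \<open>auto simp: u'_def v'_def ext2_in hs\<close>)
  have T2: "transport_eq half_strip 1 (- \<mu>) v' (\<lambda>t x. ext1 smp x * u' t x)"
    by (rule transport_eq_cong[of half_strip v v' "\<lambda>t x. smp x * u t x"])
       (use s in \<open>auto simp: u'_def v'_def ext2_in hs\<close>)
  have bc: "u' t 0 = q * v' t 0" if "0 < t" for t
    using s that by (simp add: u'_def v'_def ext2_def half_strip_def)
  have al: "along_integrable b H" if "transport_eq half_strip 1 b h H" for b h H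
    unfolding along_integrable_def
  proof (intro allI impI)
    fix t x s :: real
    assume "0 \<le> t" "0 \<le> s" "\<forall>r. 0 \<le> r \<longrightarrow> r \<le> s \<longrightarrow> 0 \<le> x + b * r \<and> x + b * r \<le> 1"
    then show "set_integrable lborel {0..s} (\<lambda>r. H (t + r) (x + b * r))"
      using transport_eqD(1)[OF that, of s t x] by (simp add: half_strip_def)
  qed
  have w: "set_integrable lborel {t..t + 1 / \<mu>} (\<lambda>r. v' r 0)" if "0 \<le> t" for t
  proof -
    have t': "0 \<le> t + 0" using that by simp
    have "set_integrable lborel {0..1 / \<mu>} (\<lambda>r. v' (t + r) 0)"
    proof (rule boundary_trace_integrable[OF pos(2) _ _ transport_eq_time_shift[OF T2 that] _ tame_integrable[OF tv t']])
      have "slab_integrable (1 / \<mu>) (\<lambda>r x. ext1 smp x * u' (t + r) x)"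
        by (rule tame_slab_integrable[OF tG, of _ _ "t + 1 / \<mu>"]) (use that in auto)
      then show "integrable (lborel \<Otimes>\<^sub>M lborel) (\<lambda>(r, \<xi>). indicat_real ({0..1 / \<mu>} \<times> {0..1}) (r, \<xi>) * (ext1 smp \<xi> * u' (t + r) \<xi>))"
        by (simp add: slab_integrable_def)
    qed (use pos in auto)
    then show ?thesis by (simp add: set_integrable_shift_iff[of _ "\<lambda>r. v' r 0"])
  qed
  have "set_integrable lborel {0..s} (\<lambda>r. v' (t + r) 0)" if "0 \<le> t" for t s
    unfolding set_integrable_shift_iff[of _ "\<lambda>r. v' r 0"]
    by (rule set_integrable_windows[OF _ w that]) (use pos in simp)
  then show ?thesis
    unfolding broad_pair_def using tu tv tF tG T1 T2 bc al[OF T1] al[OF T2] by auto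
qed

section \<open>The target system and its boundary history\<close>

lemma volterra_zero: "volterra K L (\<lambda>\<xi>. 0) (\<lambda>\<xi>. 0) x = 0"
  by (simp add: volterra_def)

lemma target_transport:
  assumes pos: "lam > 0" "\<mu> > 0" and q: "q \<noteq> 0" and L: "Linf_01 spm" "Linf_01 smp"
    and bk: "backstepping_kernels lam \<mu> q spm smp Kuu Kuv Kvu Kvv"
    and sol: "hyperbolic_solution lam \<mu> q \<rho> spm smp U u0 v0 u v"
  shows "transport_eq half_strip 1 lam (\<lambda>t x. u t x - volterra Kuu Kuv (u t) (v t) x) (\<lambda>t x. 0)"
    and "transport_eq half_strip 1 (- \<mu>) (\<lambda>t x. v t x - volterra Kvu Kvv (u t) (v t) x) (\<lambda>t x. 0)"
proof -
  let ?u = "ext2 half_strip u" and ?v = "ext2 half_strip v"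
  note bp = broad_pair_of_solution[OF pos L sol]
  note rows = backstepping_kernel_rows[OF pos q L bk]
  have e: "?u t x = u t x" "?v t x = v t x" if "(t, x) \<in> half_strip" for t x
    using that by (simp_all add: ext2_in)
  have V: "volterra (ext2 triangle A) (ext2 triangle B) (?u t) (?v t) x = volterra A B (u t) (v t) x"
    if "(t, x) \<in> half_strip" for A B t x
    using that by (subst volterra_ext2) (auto simp: half_strip_def ext2_def intro!: volterra_cong)
  have T: "transport_eq half_strip 1 lam ?u (\<lambda>t x. ext1 spm x * ?v t x)"
      "transport_eq half_strip 1 (- \<mu>) ?v (\<lambda>t x. ext1 smp x * ?u t x)"
    using bp by (auto simp: broad_pair_def)
  show "transport_eq half_strip 1 lam (\<lambda>t x. u t x - volterra Kuu Kuv (u t) (v t) x) (\<lambda>t x. 0)"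
    by (rule transport_eq_cong[OF _ _ transport_eq_diff[OF T(1) volterra_transport_right[OF rows(1) bp]]])
       (simp_all add: e V volterra_zero)
  show "transport_eq half_strip 1 (- \<mu>) (\<lambda>t x. v t x - volterra Kvu Kvv (u t) (v t) x) (\<lambda>t x. 0)"
    by (rule transport_eq_cong[OF _ _ transport_eq_diff[OF T(2) volterra_transport_left[OF rows(2) q bp]]])
       (simp_all add: e V volterra_zero)
qed

lemma boundary_history_repr:
  assumes pos: "lam > 0" "\<mu> > 0" and q: "q \<noteq> 0"
    and A: "transport_eq half_strip 1 lam A (\<lambda>t x. 0)" and B: "transport_eq half_strip 1 (- \<mu>) B (\<lambda>t x. 0)"
    and bc: "\<And>t. t > 0 \<Longrightarrow> A t 0 = q * B t 0" and x: "0 \<le> x" "x \<le> 1" and t: "0 \<le> t"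
  shows "0 < t \<or> 0 < x \<Longrightarrow> B t x = boundary_history lam \<mu> q A B (t - (1 - x) / \<mu>)"
    and "A t x = q * boundary_history lam \<mu> q A B (t - x / lam - 1 / \<mu>)"
proof -
  have Bc: "B (t + s) (x - \<mu> * s) = B t x" if "0 \<le> t" "0 \<le> s" "0 \<le> x - \<mu> * s" "x \<le> 1" for t s x
  proof -
    have "(t + 1 * r, x + - \<mu> * r) \<in> half_strip" if "0 \<le> r" "r \<le> s" for r
    proof -
      have "\<mu> * r \<le> \<mu> * s" "0 \<le> \<mu> * r" using that pos by simp_all
      then show ?thesis using \<open>0 \<le> t\<close> \<open>0 \<le> x - \<mu> * s\<close> \<open>x \<le> 1\<close> that by (auto simp: half_strip_def)
    qed
    from transport_eqD(2)[OF B \<open>0 \<le> s\<close> this] show ?thesis by simp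
  qed
  have Ac: "A (t + s) (x + lam * s) = A t x" if "0 \<le> t" "0 \<le> s" "0 \<le> x" "x + lam * s \<le> 1" for t s x
  proof -
    have "(t + 1 * r, x + lam * r) \<in> half_strip" if "0 \<le> r" "r \<le> s" for r
    proof -
      have "lam * r \<le> lam * s" "0 \<le> lam * r" using that pos by simp_all
      then show ?thesis using \<open>0 \<le> t\<close> \<open>0 \<le> x\<close> \<open>x + lam * s \<le> 1\<close> that by (auto simp: half_strip_def)
    qed
    from transport_eqD(2)[OF A \<open>0 \<le> s\<close> this] show ?thesis by simp
  qed
  \<comment> \<open>Proved for all points, since the representation of \<open>A\<close> uses it on x
    = 0.\<close>
  have R: "B t x = boundary_history lam \<mu> q A B (t - (1 - x) / \<mu>)" if "0 < t \<or> 0 < x" "0 \<le> x" "x \<le> 1" "0 \<le> t" for t x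
  proof (cases "0 \<le> t - (1 - x) / \<mu>")
    case True
    have "B (t - (1 - x) / \<mu> + (1 - x) / \<mu>) (1 - \<mu> * ((1 - x) / \<mu>)) = B (t - (1 - x) / \<mu>) 1"
      by (rule Bc) (use True that pos in auto)
    then show ?thesis using True pos by (simp add: boundary_history_def)
  next
    case False
    have less: "- (1 / \<mu>) < t - (1 - x) / \<mu>"
    proof -
      have "0 < t + x / \<mu>" using that pos by (auto intro: add_pos_nonneg add_nonneg_pos)
      then show ?thesis by (simp add: diff_divide_distrib)
    qed
    have le: "x + \<mu> * t \<le> 1" using False pos by (simp add: field_simps)
    have "B (0 + t) (x + \<mu> * t - \<mu> * t) = B 0 (x + \<mu> * t)"
      by (rule Bc) (use le that in auto)
    moreover have "1 + \<mu> * (t - (1 - x) / \<mu>) = x + \<mu> * t" using pos by (simp add: field_simps)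
    ultimately show ?thesis using False less by (simp add: boundary_history_def)
  qed
  show "0 < t \<or> 0 < x \<Longrightarrow> B t x = boundary_history lam \<mu> q A B (t - (1 - x) / \<mu>)"
    using R x t by blast
  show "A t x = q * boundary_history lam \<mu> q A B (t - x / lam - 1 / \<mu>)"
  \<comment> \<open>Strict, because the reflection at x = 0 uses the boundary condition at a
    positive time; the characteristic from the corner itself is settled by the initial value of
    \<open>A\<close>.\<close>
  proof (cases "0 < t - x / lam")
    case True
    have "A (t - x / lam + x / lam) (0 + lam * (x / lam)) = A (t - x / lam) 0"
      by (rule Ac) (use True x pos in auto)
    also have "\<dots> = q * B (t - x / lam) 0" using bc[OF True] .
    also have "B (t - x / lam) 0 = boundary_history lam \<mu> q A B (t - x / lam - (1 - 0) / \<mu>)"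
      by (rule R) (use True in auto)
    finally show ?thesis using pos by simp
  next
    case False
    have le: "lam * t \<le> x" using False pos by (simp add: field_simps)
    have "A (0 + t) (x - lam * t + lam * t) = A 0 (x - lam * t)"
      by (rule Ac) (use le t x in auto)
    moreover have "- lam * (t - x / lam - 1 / \<mu> + 1 / \<mu>) = x - lam * t" using pos by (simp add: field_simps)
    moreover have "0 < 1 / \<mu>" using pos by simp
    then have "\<not> 0 \<le> t - x / lam - 1 / \<mu>" "\<not> - (1 / \<mu>) < t - x / lam - 1 / \<mu>" using False by linarith+
    ultimately show ?thesis using q by (simp add: boundary_history_def)
  qed
qed

lemma Linf_triangle_row:
  assumes "Linf_triangle A" "set_integrable lborel {0..1} h"
  shows "set_integrable lborel {0..1} (\<lambda>\<xi>. A 1 \<xi> * h \<xi>)"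
proof -
  have b: "bounded_borel2 (ext2 triangle A)" using assms(1) by (rule Linf_triangle_ext2)
  then obtain C where C: "\<And>x \<xi>. \<bar>ext2 triangle A x \<xi>\<bar> \<le> C" by (auto simp: bounded_borel2_def)
  have "(\<lambda>\<xi>. ext2 triangle A 1 \<xi>) \<in> borel_measurable lborel"
    by (rule borel_measurable_curried) (use b in \<open>simp_all add: bounded_borel2_def\<close>)
  then have "set_integrable lborel {0..1} (\<lambda>\<xi>. ext2 triangle A 1 \<xi> * h \<xi>)"
    by (rule set_integrable_bounded_mult[OF assms(2) _ C])
  then show ?thesis
    by (rule set_integrable_cong[THEN iffD1, rotated 3]) (auto simp: ext2_def triangle_def)
qed

text \<open>The substitutions \<xi> = lam \<nu> - lam / \<mu> and \<xi> = 1 - \<mu> \<nu> turn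
  [0, 1] into the delays [1 / \<mu>, \<tau>] and [0, 1 / \<mu>]; the Jacobians give the factors
  \<open>lam\<close> and \<mu>, and \<open>q\<close> comes from \<open>ha\<close>. \<open>H\<close>
  is kept arbitrary because it is the history of a solution in one direction and a given neutral
  solution in the other.\<close>

lemma distributed_delay_integral:
  assumes pos: "lam > 0" "\<mu> > 0" and \<tau>: "\<tau> = 1 / lam + 1 / \<mu>"
    and L: "Linf_triangle Laa" "Linf_triangle Lab" "Linf_triangle Lba" "Linf_triangle Lbb"
    and a: "set_integrable lborel {0..1} a" and b: "set_integrable lborel {0..1} b"
    and ha: "\<And>\<xi>. 0 \<le> \<xi> \<Longrightarrow> \<xi> \<le> 1 \<Longrightarrow> a \<xi> = q * H (t - \<xi> / lam - 1 / \<mu>)"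
    and hb: "\<And>\<xi>. 0 \<le> \<xi> \<Longrightarrow> \<xi> \<le> 1 \<Longrightarrow> b \<xi> = H (t - (1 - \<xi>) / \<mu>)"
  shows "set_integrable lborel {0..\<tau>} (\<lambda>\<nu>. N_tilde lam \<mu> q \<rho> Laa Lab Lba Lbb \<nu> * H (t - \<nu>))"
    and "(LBINT \<nu>:{0..\<tau>}. N_tilde lam \<mu> q \<rho> Laa Lab Lba Lbb \<nu> * H (t - \<nu>)) =
       volterra Lba Lbb a b 1 - \<rho> * volterra Laa Lab a b 1"
proof -
  let ?Na = "N_alpha \<rho> Laa Lba" and ?Nb = "N_beta \<rho> Lab Lbb"
  note i = Linf_triangle_row[OF L(1) a] Linf_triangle_row[OF L(2) b] Linf_triangle_row[OF L(3) a] Linf_triangle_row[OF L(4) b]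
  have ia: "set_integrable lborel {0..1} (\<lambda>\<xi>. ?Na \<xi> * a \<xi>)"
    using set_integral_diff(1)[OF i(3) set_integrable_mult_right[of \<rho>, OF i(1)]]
    by (simp add: N_alpha_def algebra_simps)
  have ib: "set_integrable lborel {0..1} (\<lambda>\<xi>. ?Nb \<xi> * b \<xi>)"
    using set_integral_diff(1)[OF i(4) set_integrable_mult_right[of \<rho>, OF i(2)]]
    by (simp add: N_beta_def algebra_simps)
  let ?A = "\<lambda>\<nu>. indicator {0..1} (- lam / \<mu> + lam * \<nu>) * (?Na (- lam / \<mu> + lam * \<nu>) * a (- lam / \<mu> + lam * \<nu>))"
  let ?B = "\<lambda>\<nu>. indicator {0..1} (1 + (- \<mu>) * \<nu>) * (?Nb (1 + (- \<mu>) * \<nu>) * b (1 + (- \<mu>) * \<nu>))"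
  have lne: "lam \<noteq> 0" "- \<mu> \<noteq> 0" using pos by auto
  note sA = set_integral_affine[OF lne(1) ia, of "- lam / \<mu>"] and sB = set_integral_affine[OF lne(2) ib, of 1]
  have eq: "(\<lambda>\<nu>. indicator {0..\<tau>} \<nu> *\<^sub>R (N_tilde lam \<mu> q \<rho> Laa Lab Lba Lbb \<nu> * H (t - \<nu>))) = (\<lambda>\<nu>. lam * ?A \<nu> + \<mu> * ?B \<nu>)"
  proof
    fix \<nu>
    have cA: "- lam / \<mu> + lam * \<nu> \<in> {0..1} \<longleftrightarrow> \<nu> \<in> {1 / \<mu>..\<tau>}"
    proof -
      have "0 \<le> - lam / \<mu> + lam * \<nu> \<longleftrightarrow> lam * (1 / \<mu>) \<le> lam * \<nu>" by simp
      moreover have "- lam / \<mu> + lam * \<nu> \<le> 1 \<longleftrightarrow> lam * \<nu> \<le> lam * \<tau>" using pos by (auto simp: \<tau> distrib_left)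
      ultimately show ?thesis using pos by (simp only: mult_le_cancel_left_pos atLeastAtMost_iff)
    qed
    have cB: "1 + (- \<mu>) * \<nu> \<in> {0..1} \<longleftrightarrow> \<nu> \<in> {0..1 / \<mu>}"
      using pos by (auto simp: field_simps zero_le_mult_iff)
    have iA: "indicator {0..1} (- lam / \<mu> + lam * \<nu>) = (indicator {1 / \<mu>..\<tau>} \<nu> :: real)"
      and iB: "indicator {0..1} (1 + (- \<mu>) * \<nu>) = (indicator {0..1 / \<mu>} \<nu> :: real)"
      using cA cB by (simp_all only: indicator_def)
    have vA: "a (- lam / \<mu> + lam * \<nu>) = q * H (t - \<nu>)" if "\<nu> \<in> {1 / \<mu>..\<tau>}"
    proof -
      have "t - (- lam / \<mu> + lam * \<nu>) / lam - 1 / \<mu> = t - \<nu>" using pos by (simp add: field_simps)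
      moreover have "- lam / \<mu> + lam * \<nu> \<in> {0..1}" using that cA by blast
      then have "0 \<le> - lam / \<mu> + lam * \<nu>" "- lam / \<mu> + lam * \<nu> \<le> 1" by (simp_all only: atLeastAtMost_iff)
      note ha[OF this]
      ultimately show ?thesis by (simp only:)
    qed
    have vB: "b (1 + (- \<mu>) * \<nu>) = H (t - \<nu>)" if "\<nu> \<in> {0..1 / \<mu>}"
    proof -
      have "t - (1 - (1 + (- \<mu>) * \<nu>)) / \<mu> = t - \<nu>" using pos by simp
      moreover have "1 + (- \<mu>) * \<nu> \<in> {0..1}" using that cB by blast
      then have "0 \<le> 1 + (- \<mu>) * \<nu>" "1 + (- \<mu>) * \<nu> \<le> 1" by (simp_all only: atLeastAtMost_iff)
      note hb[OF this]
      ultimately show ?thesis by (simp only:)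
    qed
    \<comment> \<open>The indicators are named so that the rearrangement uses only \<open>wp\<close>
      and \<open>wr\<close>: both supports lie in [0, \<tau>].\<close>
    define w p r :: real where "w = indicator {0..\<tau>} \<nu>" and "p = indicator {1 / \<mu>..\<tau>} \<nu>" and "r = indicator {0..1 / \<mu>} \<nu>"
    have "0 < 1 / \<mu>" "1 / \<mu> < \<tau>" using pos by (simp_all add: \<tau>)
    then have "{1 / \<mu>..\<tau>} \<subseteq> {0..\<tau>}" "{0..1 / \<mu>} \<subseteq> {0..\<tau>}" by (simp_all only: atLeastatMost_subset_iff) linarith+
    moreover have "indicator A \<nu> * indicator B \<nu> = (indicator B \<nu> :: real)" if "B \<subseteq> A" for A B :: "real set"
      using that by (auto simp: indicator_def)
    ultimately have wp: "w * p = p" and wr: "w * r = r"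
      unfolding w_def p_def r_def by blast+
    have "w * (N_tilde lam \<mu> q \<rho> Laa Lab Lba Lbb \<nu> * H (t - \<nu>)) =
        q * lam * ?Na (- lam / \<mu> + lam * \<nu>) * (w * p) * H (t - \<nu>) + \<mu> * ?Nb (1 + (- \<mu>) * \<nu>) * (w * r) * H (t - \<nu>)"
      by (simp add: N_tilde_def \<tau>[symmetric] p_def r_def distrib_left distrib_right mult_ac)
    also have "\<dots> = lam * (p * (?Na (- lam / \<mu> + lam * \<nu>) * (q * H (t - \<nu>)))) +
        \<mu> * (r * (?Nb (1 + (- \<mu>) * \<nu>) * H (t - \<nu>)))"
      unfolding wp wr by (simp only: mult_ac)
    also have "p * (?Na (- lam / \<mu> + lam * \<nu>) * (q * H (t - \<nu>))) = p * (?Na (- lam / \<mu> + lam * \<nu>) * a (- lam / \<mu> + lam * \<nu>))"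
      using vA by (cases "\<nu> \<in> {1 / \<mu>..\<tau>}") (simp_all only: p_def indicator_simps mult_zero_left not_False_eq_True)
    also have "r * (?Nb (1 + (- \<mu>) * \<nu>) * H (t - \<nu>)) = r * (?Nb (1 + (- \<mu>) * \<nu>) * b (1 + (- \<mu>) * \<nu>))"
      using vB by (cases "\<nu> \<in> {0..1 / \<mu>}") (simp_all only: r_def indicator_simps mult_zero_left not_False_eq_True)
    finally show "indicator {0..\<tau>} \<nu> *\<^sub>R (N_tilde lam \<mu> q \<rho> Laa Lab Lba Lbb \<nu> * H (t - \<nu>)) = lam * ?A \<nu> + \<mu> * ?B \<nu>"
      unfolding iA iB real_scaleR_def w_def p_def r_def .
  qed
  show "set_integrable lborel {0..\<tau>} (\<lambda>\<nu>. N_tilde lam \<mu> q \<rho> Laa Lab Lba Lbb \<nu> * H (t - \<nu>))"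
    unfolding set_integrable_def eq using sA(1) sB(1) by simp
  have "(LBINT \<nu>:{0..\<tau>}. N_tilde lam \<mu> q \<rho> Laa Lab Lba Lbb \<nu> * H (t - \<nu>)) =
      (LBINT \<xi>:{0..1}. ?Na \<xi> * a \<xi>) + (LBINT \<xi>:{0..1}. ?Nb \<xi> * b \<xi>)"
    unfolding set_lebesgue_integral_def[of lborel "{0..\<tau>}"] eq
    using sA sB pos by simp
  also have "\<dots> = volterra Lba Lbb a b 1 - \<rho> * volterra Laa Lab a b 1"
    unfolding volterra_def set_integral_add(2)[OF i(3,4)] set_integral_add(2)[OF i(1,2)] N_alpha_def N_beta_def
    using i by (simp add: algebra_simps set_integral_diff set_integral_add)
  finally show "(LBINT \<nu>:{0..\<tau>}. N_tilde lam \<mu> q \<rho> Laa Lab Lba Lbb \<nu> * H (t - \<nu>)) =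
       volterra Lba Lbb a b 1 - \<rho> * volterra Laa Lab a b 1" .
qed

section \<open>Estimates for Volterra operators\<close>

text \<open>If \<phi> is not integrable, its integral is 0 by convention and \<psi> is nonnegative.
  This spares measurability arguments in the estimates below.\<close>

lemma abs_integral_le:
  fixes \<phi> \<psi> :: "'a \<Rightarrow> real"
  assumes "integrable M \<psi>" "\<And>x. \<bar>\<phi> x\<bar> \<le> \<psi> x"
  shows "\<bar>integral\<^sup>L M \<phi>\<bar> \<le> integral\<^sup>L M \<psi>"
proof (cases "integrable M \<phi>")
  case True
  have "\<bar>integral\<^sup>L M \<phi>\<bar> \<le> (\<integral>x. \<bar>\<phi> x\<bar> \<partial>M)" by (rule integral_abs_bound)
  also have "\<dots> \<le> integral\<^sup>L M \<psi>"
    by (rule integral_mono) (use True assms in auto)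
  finally show ?thesis .
next
  case False
  have "0 \<le> \<psi> x" for x using assms(2)[of x] by linarith
  then show ?thesis using False by (simp add: not_integrable_integral_eq)
qed

lemma abs_set_integral_le:
  fixes \<phi> \<psi> :: "'a \<Rightarrow> real"
  assumes "set_integrable M A \<psi>" "\<And>x. x \<in> A \<Longrightarrow> \<bar>\<phi> x\<bar> \<le> \<psi> x"
  shows "\<bar>LINT x:A|M. \<phi> x\<bar> \<le> (LINT x:A|M. \<psi> x)"
  unfolding set_lebesgue_integral_def
  by (rule abs_integral_le) (use assms in \<open>auto simp: set_integrable_def indicator_def\<close>)

text \<open>A gain of regularity, from integrable data to bounded images: this is why the
  reconstructed states differ from \<alpha> and \<beta> by bounded functions even if \<alpha> and
  \<beta> are unbounded.\<close>

lemma volterra_bound: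
  assumes K: "\<And>x \<xi>. \<bar>K x \<xi>\<bar> \<le> C" and L: "\<And>x \<xi>. \<bar>L x \<xi>\<bar> \<le> C"
    and f: "set_integrable lborel {0..1} f" and g: "set_integrable lborel {0..1} g" and x: "x \<le> 1"
  shows "\<bar>volterra K L f g x\<bar> \<le> C * ((LBINT \<xi>:{0..1}. \<bar>f \<xi>\<bar>) + (LBINT \<xi>:{0..1}. \<bar>g \<xi>\<bar>))"
proof -
  have C: "0 \<le> C" using K[of 0 0] by linarith
  note i = set_integrable_abs[OF f] set_integrable_abs[OF g]
  note i' = set_integrable_mult_right[of C, OF set_integral_add(1)[OF i]]
  have b: "\<bar>K x \<xi> * f \<xi> + L x \<xi> * g \<xi>\<bar> \<le> C * (\<bar>f \<xi>\<bar> + \<bar>g \<xi>\<bar>)" for \<xi>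
    using mult_right_mono[OF K[of x \<xi>], of "\<bar>f \<xi>\<bar>"] mult_right_mono[OF L[of x \<xi>], of "\<bar>g \<xi>\<bar>"]
      abs_triangle_ineq[of "K x \<xi> * f \<xi>" "L x \<xi> * g \<xi>"]
    by (simp add: abs_mult distrib_left)
  have "\<bar>volterra K L f g x\<bar> \<le> (LBINT \<xi>:{0..1}. C * (\<bar>f \<xi>\<bar> + \<bar>g \<xi>\<bar>))"
    unfolding volterra_def set_lebesgue_integral_def
  proof (rule abs_integral_le)
    show "integrable lborel (\<lambda>\<xi>. indicat_real {0..1} \<xi> *\<^sub>R (C * (\<bar>f \<xi>\<bar> + \<bar>g \<xi>\<bar>)))"
      using i' by (simp add: set_integrable_def)
    show "\<bar>indicat_real {0..x} \<xi> *\<^sub>R (K x \<xi> * f \<xi> + L x \<xi> * g \<xi>)\<bar> \<le> indicat_real {0..1} \<xi> *\<^sub>R (C * (\<bar>f \<xi>\<bar> + \<bar>g \<xi>\<bar>))" for \<xi>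
      using b[of \<xi>] C x by (auto simp: indicator_def)
  qed
  also have "\<dots> = C * ((LBINT \<xi>:{0..1}. \<bar>f \<xi>\<bar>) + (LBINT \<xi>:{0..1}. \<bar>g \<xi>\<bar>))"
    using i by (simp add: set_integral_add)
  finally show ?thesis .
qed

text \<open>In the supremum norm weighted by \<open>exp (\<gamma> * x)\<close> the integral up to
  \<open>x\<close> gains a factor 1 / \<gamma>, so two kernels bounded by \<open>C\<close> give a
  norm of at most 2 C / \<gamma> \<le> 1 / 4. The value 1 / 4, rather than 1 / 2, leaves room for
  the coupling term in the estimate of the defects.\<close>

lemma volterra_exp_bound:
  assumes K: "\<And>x \<xi>. \<bar>K x \<xi>\<bar> \<le> C" and L: "\<And>x \<xi>. \<bar>L x \<xi>\<bar> \<le> C" and \<gamma>: "\<gamma> > 0" "8 * C \<le> \<gamma>"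
    and f: "\<And>\<xi>. 0 \<le> \<xi> \<Longrightarrow> \<xi> \<le> 1 \<Longrightarrow> \<bar>f \<xi>\<bar> \<le> d * exp (\<gamma> * \<xi>)"
    and g: "\<And>\<xi>. 0 \<le> \<xi> \<Longrightarrow> \<xi> \<le> 1 \<Longrightarrow> \<bar>g \<xi>\<bar> \<le> d * exp (\<gamma> * \<xi>)" and x: "0 \<le> x" "x \<le> 1"
  shows "\<bar>volterra K L f g x\<bar> \<le> d / 4 * exp (\<gamma> * x)"
proof -
  have C: "0 \<le> C" using K[of 0 0] by linarith
  have d: "0 \<le> d" using f[of 0] by simp
  have b: "\<bar>K x \<xi> * f \<xi> + L x \<xi> * g \<xi>\<bar> \<le> 2 * C * d * exp (\<gamma> * \<xi>)" if "0 \<le> \<xi>" "\<xi> \<le> 1" for \<xi>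
  proof -
    have "\<bar>K x \<xi>\<bar> * \<bar>f \<xi>\<bar> \<le> C * (d * exp (\<gamma> * \<xi>))" "\<bar>L x \<xi>\<bar> * \<bar>g \<xi>\<bar> \<le> C * (d * exp (\<gamma> * \<xi>))"
      using K L f[OF that] g[OF that] C by (auto intro!: mult_mono)
    then show ?thesis using abs_triangle_ineq[of "K x \<xi> * f \<xi>" "L x \<xi> * g \<xi>"] by (simp add: abs_mult)
  qed
  have ex: "set_integrable lborel {0..x} (\<lambda>\<xi>. exp (\<gamma> * \<xi>))"
    by (intro borel_integrable_atLeastAtMost' continuous_intros)
  have "(\<integral>\<xi>. exp (\<gamma> * \<xi>) * indicator {0..x} \<xi> \<partial>lborel) = exp (\<gamma> * x) / \<gamma> - exp (\<gamma> * 0) / \<gamma>"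
    using x \<gamma> by (intro integral_FTC_Icc_real) (auto intro!: derivative_eq_intros continuous_intros)
  then have I: "(LBINT \<xi>:{0..x}. exp (\<gamma> * \<xi>)) = exp (\<gamma> * x) / \<gamma> - 1 / \<gamma>"
    by (simp add: set_lebesgue_integral_def mult.commute)
  have "\<bar>volterra K L f g x\<bar> \<le> (LBINT \<xi>:{0..x}. 2 * C * d * exp (\<gamma> * \<xi>))"
    unfolding volterra_def using ex b x
    by (intro abs_set_integral_le set_integrable_mult_right) auto
  also have "\<dots> = 2 * C * d * (exp (\<gamma> * x) / \<gamma> - 1 / \<gamma>)" using I by simp
  also have "\<dots> \<le> 2 * C * d * (exp (\<gamma> * x) / \<gamma>)"
    using C d \<gamma> by (intro mult_left_mono) auto
  also have "\<dots> = (8 * C) / \<gamma> * (d / 4 * exp (\<gamma> * x))" by simp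
  also have "\<dots> \<le> 1 * (d / 4 * exp (\<gamma> * x))"
    using \<gamma> d by (intro mult_right_mono) auto
  finally show ?thesis by simp
qed

text \<open>The moving upper limit becomes the indicator of a closed set in all three variables,
  after which measurability of integrals depending on a parameter applies.\<close>

lemma volterra_measurable:
  fixes f g :: "real \<Rightarrow> real \<Rightarrow> real"
  assumes "bounded_borel2 K" "bounded_borel2 L" "case_prod f \<in> borel_measurable borel" "case_prod g \<in> borel_measurable borel"
  shows "case_prod (\<lambda>t. volterra K L (f t) (g t)) \<in> borel_measurable borel"
proof -
  have K: "case_prod K \<in> borel_measurable borel" and L: "case_prod L \<in> borel_measurable borel"
    using assms by (auto simp: bounded_borel2_def)
  let ?h = "\<lambda>p \<xi>. indicat_real {(p, \<xi>). 0 \<le> \<xi> \<and> \<xi> \<le> snd p} (p, \<xi>) * (K (snd p) \<xi> * f (fst p) \<xi> + L (snd p) \<xi> * g (fst p) \<xi>)"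
  have cl: "closed {(p, \<xi>). 0 \<le> \<xi> \<and> \<xi> \<le> snd (p :: real \<times> real)}"
    unfolding case_prod_beta' by (intro closed_Collect_conj closed_Collect_le continuous_intros)
  have b: "(\<lambda>p. fst (fst p)) \<in> borel_measurable (borel :: ((real \<times> real) \<times> real) measure)"
    "(\<lambda>p. snd (fst p)) \<in> borel_measurable (borel :: ((real \<times> real) \<times> real) measure)"
    "(\<lambda>p. snd p) \<in> borel_measurable (borel :: ((real \<times> real) \<times> real) measure)"
    by (intro borel_measurable_continuous_onI continuous_intros)+
  have m: "case_prod ?h \<in> borel_measurable borel"
    unfolding case_prod_beta'
    by (intro borel_measurable_times borel_measurable_add borel_measurable_curried[OF K] borel_measurable_curried[OF L]
        borel_measurable_curried[OF assms(3)] borel_measurable_curried[OF assms(4)] b)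
       (use borel_closed[OF cl] in \<open>simp add: case_prod_beta'\<close>)
  have "sets ((borel :: (real \<times> real) measure) \<Otimes>\<^sub>M lborel) = sets (borel \<Otimes>\<^sub>M (borel :: real measure))"
    by (rule sets_pair_measure_cong) simp_all
  also have "\<dots> = sets borel" by (simp only: borel_prod)
  finally have "case_prod ?h \<in> borel_measurable ((borel :: (real \<times> real) measure) \<Otimes>\<^sub>M lborel)"
    using m measurable_cong_sets by blast
  then have "(\<lambda>p. LBINT \<xi>. ?h p \<xi>) \<in> borel_measurable (borel :: (real \<times> real) measure)"
    by (rule lborel.borel_measurable_lebesgue_integral)
  also have "(\<lambda>p. LBINT \<xi>. ?h p \<xi>) = case_prod (\<lambda>t. volterra K L (f t) (g t))"
  proof
    fix p :: "real \<times> real"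
    show "(LBINT \<xi>. ?h p \<xi>) = case_prod (\<lambda>t. volterra K L (f t) (g t)) p"
      unfolding volterra_def set_lebesgue_integral_def case_prod_beta'
      by (rule Bochner_Integration.integral_cong) (auto simp: indicator_def)
  qed
  finally show ?thesis .
qed

text \<open>The class into which Volterra operators send tame pairs
  (\<open>slab_bounded_volterra\<close>). The bound is local in time because states may
  grow.\<close>

definition slab_bounded :: "(real \<Rightarrow> real \<Rightarrow> real) \<Rightarrow> bool" where
  "slab_bounded h \<longleftrightarrow> case_prod h \<in> borel_measurable borel \<and>
     (\<forall>T. \<exists>C. \<forall>t x. 0 \<le> t \<longrightarrow> t \<le> T \<longrightarrow> 0 \<le> x \<longrightarrow> x \<le> 1 \<longrightarrow> \<bar>h t x\<bar> \<le> C)"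

lemma slab_boundedE:
  assumes "slab_bounded h"
  obtains C where "\<And>t x. 0 \<le> t \<Longrightarrow> t \<le> T \<Longrightarrow> 0 \<le> x \<Longrightarrow> x \<le> 1 \<Longrightarrow> \<bar>h t x\<bar> \<le> C"
  using assms unfolding slab_bounded_def by blast

lemma slab_bounded_add:
  assumes "slab_bounded f" "slab_bounded g"
  shows "slab_bounded (\<lambda>t x. f t x + g t x)"
  unfolding slab_bounded_def
proof (intro conjI allI)
  show "case_prod (\<lambda>t x. f t x + g t x) \<in> borel_measurable borel"
    using assms by (auto simp: slab_bounded_def case_prod_beta')
  fix T
  obtain C where C: "\<And>t x. 0 \<le> t \<Longrightarrow> t \<le> T \<Longrightarrow> 0 \<le> x \<Longrightarrow> x \<le> 1 \<Longrightarrow> \<bar>f t x\<bar> \<le> C"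
    using slab_boundedE[OF assms(1), of T] by blast
  obtain D where D: "\<And>t x. 0 \<le> t \<Longrightarrow> t \<le> T \<Longrightarrow> 0 \<le> x \<Longrightarrow> x \<le> 1 \<Longrightarrow> \<bar>g t x\<bar> \<le> D"
    using slab_boundedE[OF assms(2), of T] by blast
  have "\<bar>f t x + g t x\<bar> \<le> C + D" if "0 \<le> t" "t \<le> T" "0 \<le> x" "x \<le> 1" for t x
    using C[OF that] D[OF that] by linarith
  then show "\<exists>C. \<forall>t x. 0 \<le> t \<longrightarrow> t \<le> T \<longrightarrow> 0 \<le> x \<longrightarrow> x \<le> 1 \<longrightarrow> \<bar>f t x + g t x\<bar> \<le> C" by blast
qed

lemma slab_bounded_mult:
  assumes "bounded_borel h" "slab_bounded f"
  shows "slab_bounded (\<lambda>t x. h x * f t x)"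
  unfolding slab_bounded_def
proof (intro conjI allI)
  have [measurable]: "h \<in> borel_measurable borel" using assms by (simp add: bounded_borel_def)
  show "case_prod (\<lambda>t x. h x * f t x) \<in> borel_measurable borel"
    using assms by (auto simp: slab_bounded_def case_prod_beta')
  fix T
  obtain D where D: "\<And>x. \<bar>h x\<bar> \<le> D" using assms by (auto simp: bounded_borel_def)
  obtain C where C: "\<And>t x. 0 \<le> t \<Longrightarrow> t \<le> T \<Longrightarrow> 0 \<le> x \<Longrightarrow> x \<le> 1 \<Longrightarrow> \<bar>f t x\<bar> \<le> C"
    using slab_boundedE[OF assms(2), of T] by blast
  have "\<bar>h x * f t x\<bar> \<le> D * C" if "0 \<le> t" "t \<le> T" "0 \<le> x" "x \<le> 1" for t x
    unfolding abs_mult using C[OF that] D[of x] by (intro mult_mono) auto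
  then show "\<exists>C. \<forall>t x. 0 \<le> t \<longrightarrow> t \<le> T \<longrightarrow> 0 \<le> x \<longrightarrow> x \<le> 1 \<longrightarrow> \<bar>h x * f t x\<bar> \<le> C" by blast
qed

lemma slab_bounded_diff:
  assumes "slab_bounded f" "slab_bounded g"
  shows "slab_bounded (\<lambda>t x. f t x - g t x)"
  using slab_bounded_add[OF assms(1) slab_bounded_mult[OF bounded_borel_const[of "-1"] assms(2)]] by simp

lemma slab_bounded_tame:
  assumes "slab_bounded h"
  shows "tame h"
proof (rule tameI)
  show m: "case_prod h \<in> borel_measurable borel" using assms by (simp add: slab_bounded_def)
  have ms: "h t \<in> borel_measurable borel" for t
    by (rule borel_measurable_curried[of h "\<lambda>_. t" borel "\<lambda>x. x", OF m]) simp_all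
  show i: "set_integrable lborel {0..1} (h t)" if t: "0 \<le> t" for t
  proof -
    obtain C where C: "\<And>r x. 0 \<le> r \<Longrightarrow> r \<le> t \<Longrightarrow> 0 \<le> x \<Longrightarrow> x \<le> 1 \<Longrightarrow> \<bar>h r x\<bar> \<le> C"
      by (rule slab_boundedE[OF assms, of t]) blast
    show ?thesis
    proof (rule set_integrable_bound[OF set_integrable_const_01[of C]])
      show "AE x in lborel. x \<in> {0..1} \<longrightarrow> norm (h t x) \<le> norm C"
        using C[OF t order_refl] by (intro AE_I2 impI) (auto intro: order_trans[OF _ abs_ge_self])
      show "set_borel_measurable lborel {0..1} (h t)"
        using ms unfolding set_borel_measurable_def by simp
    qed
  qed
  fix T :: real
  obtain C where C: "\<And>t x. 0 \<le> t \<Longrightarrow> t \<le> T \<Longrightarrow> 0 \<le> x \<Longrightarrow> x \<le> 1 \<Longrightarrow> \<bar>h t x\<bar> \<le> C"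
    using slab_boundedE[OF assms, of T] by blast
  have "(LBINT x:{0..1}. \<bar>h t x\<bar>) \<le> C" if "0 \<le> t" "t \<le> T" for t
  proof -
    have "(LBINT x:{0..1}. \<bar>h t x\<bar>) \<le> (LBINT x:{0..1::real}. C)"
      using i[OF that(1)] C[OF that] by (intro set_integral_mono set_integrable_abs set_integrable_const_01) auto
    then show ?thesis by (simp add: set_lebesgue_integral_def)
  qed
  then show "\<exists>C. \<forall>t. 0 \<le> t \<longrightarrow> t \<le> T \<longrightarrow> (LBINT x:{0..1}. \<bar>h t x\<bar>) \<le> C" by blast
qed

lemma bounded_borel2_common:
  assumes "bounded_borel2 K" "bounded_borel2 L"
  obtains C where "0 \<le> C" "\<And>x \<xi>. \<bar>K x \<xi>\<bar> \<le> C" "\<And>x \<xi>. \<bar>L x \<xi>\<bar> \<le> C"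
proof -
  obtain A B where "\<And>x \<xi>. \<bar>K x \<xi>\<bar> \<le> A" "\<And>x \<xi>. \<bar>L x \<xi>\<bar> \<le> B"
    using assms by (auto simp: bounded_borel2_def)
  then show ?thesis
    by (intro that[of "max 0 (max A B)"]) (auto simp: le_max_iff_disj)
qed

lemma slab_bounded_volterra:
  assumes K: "bounded_borel2 K" "bounded_borel2 L" and f: "tame f" and g: "tame g"
  shows "slab_bounded (\<lambda>t. volterra K L (f t) (g t))"
  unfolding slab_bounded_def
proof (intro conjI allI)
  show "case_prod (\<lambda>t. volterra K L (f t) (g t)) \<in> borel_measurable borel"
    by (rule volterra_measurable[OF K tame_measurable[OF f] tame_measurable[OF g]])
  fix T
  obtain C where C: "0 \<le> C" "\<And>x \<xi>. \<bar>K x \<xi>\<bar> \<le> C" "\<And>x \<xi>. \<bar>L x \<xi>\<bar> \<le> C"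
    using bounded_borel2_common[OF K] by metis
  obtain A where A: "\<And>t. 0 \<le> t \<Longrightarrow> t \<le> T \<Longrightarrow> (LBINT x:{0..1}. \<bar>f t x\<bar>) \<le> A" by (rule tame_bound[OF f, of T]) blast
  obtain B where B: "\<And>t. 0 \<le> t \<Longrightarrow> t \<le> T \<Longrightarrow> (LBINT x:{0..1}. \<bar>g t x\<bar>) \<le> B" by (rule tame_bound[OF g, of T]) blast
  have "\<bar>volterra K L (f t) (g t) x\<bar> \<le> C * (A + B)" if "0 \<le> t" "t \<le> T" "0 \<le> x" "x \<le> 1" for t x
    using volterra_bound[of K C L, OF C(2,3) tame_integrable[OF f that(1)] tame_integrable[OF g that(1)] that(4)]
      mult_left_mono[OF add_mono[OF A[OF that(1,2)] B[OF that(1,2)]] C(1)] by linarith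
  then show "\<exists>C. \<forall>t x. 0 \<le> t \<longrightarrow> t \<le> T \<longrightarrow> 0 \<le> x \<longrightarrow> x \<le> 1 \<longrightarrow> \<bar>volterra K L (f t) (g t) x\<bar> \<le> C" by blast
qed

lemma along_integrable_add:
  "along_integrable b f \<Longrightarrow> along_integrable b g \<Longrightarrow> along_integrable b (\<lambda>t x. f t x + g t x)"
  unfolding along_integrable_def by (simp add: set_integral_add)

lemma along_integrable_bounded:
  assumes "slab_bounded h"
  shows "along_integrable b h"
  unfolding along_integrable_def
proof (intro allI impI)
  fix t x s :: real
  assume t: "0 \<le> t" and s: "0 \<le> s" and D: "\<forall>r. 0 \<le> r \<longrightarrow> r \<le> s \<longrightarrow> 0 \<le> x + b * r \<and> x + b * r \<le> 1"
  obtain C where C: "\<And>r x. 0 \<le> r \<Longrightarrow> r \<le> t + s \<Longrightarrow> 0 \<le> x \<Longrightarrow> x \<le> 1 \<Longrightarrow> \<bar>h r x\<bar> \<le> C"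
    using slab_boundedE[OF assms, of "t + s"] by blast
  have m: "(\<lambda>r. h (t + r) (x + b * r)) \<in> borel_measurable borel"
    by (rule borel_measurable_curried[of h]) (use assms in \<open>auto simp: slab_bounded_def\<close>)
  show "set_integrable lborel {0..s} (\<lambda>r. h (t + r) (x + b * r))"
  proof (rule set_integrable_bound)
    show "set_integrable lborel {0..s} (\<lambda>r. C)" by (simp add: borel_integrable_atLeastAtMost')
    show "AE r in lborel. r \<in> {0..s} \<longrightarrow> norm (h (t + r) (x + b * r)) \<le> norm C"
    proof (intro AE_I2 impI)
      fix r assume "r \<in> {0..s}"
      then have "\<bar>h (t + r) (x + b * r)\<bar> \<le> C" using C t D by simp
      then show "norm (h (t + r) (x + b * r)) \<le> norm C" by simp
    qed
  qed (use m in \<open>simp add: set_borel_measurable_def\<close>)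
qed

lemma along_integrable_mult:
  assumes h: "bounded_borel h" and f: "along_integrable b f"
  shows "along_integrable b (\<lambda>t x. h x * f t x)"
  unfolding along_integrable_def
proof (intro allI impI)
  fix t x s :: real
  assume "0 \<le> t" and "0 \<le> s" and "\<forall>r. 0 \<le> r \<longrightarrow> r \<le> s \<longrightarrow> 0 \<le> x + b * r \<and> x + b * r \<le> 1"
  then have i: "set_integrable lborel {0..s} (\<lambda>r. f (t + r) (x + b * r))"
    using f by (simp add: along_integrable_def)
  obtain C where C: "\<And>x. \<bar>h x\<bar> \<le> C" and [measurable]: "h \<in> borel_measurable borel"
    using h by (auto simp: bounded_borel_def)
  show "set_integrable lborel {0..s} (\<lambda>r. h (x + b * r) * f (t + r) (x + b * r))"
    by (rule set_integrable_bounded_mult[OF i _ C]) simp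
qed

text \<open>Broad solutions pass to limits that are locally uniform in both the function and its
  source: the error consists of the two end values and of the source integrated over the
  segment.\<close>

lemma transport_eq_limit:
  assumes W: "along_integrable c W"
    and approx: "\<And>T \<epsilon>. \<epsilon> > 0 \<Longrightarrow> \<exists>f F. transport_eq half_strip 1 c f F \<and>
      (\<forall>t x. 0 \<le> t \<longrightarrow> t \<le> T \<longrightarrow> 0 \<le> x \<longrightarrow> x \<le> 1 \<longrightarrow> \<bar>w t x - f t x\<bar> \<le> \<epsilon> \<and> \<bar>W t x - F t x\<bar> \<le> \<epsilon>)"
  shows "transport_eq half_strip 1 c w W"
proof (rule transport_eqI)
  fix y z s :: real
  assume s: "0 \<le> s" and D: "\<And>r. 0 \<le> r \<Longrightarrow> r \<le> s \<Longrightarrow> (y + 1 * r, z + c * r) \<in> half_strip"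
  have yz: "0 \<le> y" and zb: "\<And>r. 0 \<le> r \<Longrightarrow> r \<le> s \<Longrightarrow> 0 \<le> z + c * r \<and> z + c * r \<le> 1"
    using D[of 0] D s by (auto simp: half_strip_def)
  have iW: "set_integrable lborel {0..s} (\<lambda>r. W (y + 1 * r) (z + c * r))"
    using W yz s zb by (simp add: along_integrable_def)
  let ?d = "\<bar>w (y + 1 * s) (z + c * s) - w y z - (LBINT r:{0..s}. W (y + 1 * r) (z + c * r))\<bar>"
  have "?d \<le> e" if "e > 0" for e
  proof -
    \<comment> \<open>The two end points contribute \<epsilon> each, and the segment contributes s
      \<epsilon>.\<close>
    define \<epsilon> where "\<epsilon> = e / (2 + s)"
    have "\<epsilon> > 0" using that s by (simp add: \<epsilon>_def)
    then obtain f F where tr: "transport_eq half_strip 1 c f F" and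
      b: "\<And>t x. 0 \<le> t \<Longrightarrow> t \<le> y + s \<Longrightarrow> 0 \<le> x \<Longrightarrow> x \<le> 1 \<Longrightarrow> \<bar>w t x - f t x\<bar> \<le> \<epsilon>"
         "\<And>t x. 0 \<le> t \<Longrightarrow> t \<le> y + s \<Longrightarrow> 0 \<le> x \<Longrightarrow> x \<le> 1 \<Longrightarrow> \<bar>W t x - F t x\<bar> \<le> \<epsilon>"
      using approx[of \<epsilon> "y + s"] by blast
    note T = transport_eqD[OF tr s D]
    have "\<bar>LBINT r:{0..s}. W (y + 1 * r) (z + c * r) - F (y + 1 * r) (z + c * r)\<bar> \<le> (LBINT r:{0..s}. \<epsilon>)"
      by (rule abs_set_integral_le) (use b(2) yz zb in \<open>auto simp: borel_integrable_atLeastAtMost'\<close>)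
    moreover have c: "(LBINT r:{0..s}. \<epsilon>) = s * \<epsilon>" using s by (simp add: set_lebesgue_integral_def)
    ultimately have "\<bar>(LBINT r:{0..s}. W (y + 1 * r) (z + c * r)) - (LBINT r:{0..s}. F (y + 1 * r) (z + c * r))\<bar> \<le> s * \<epsilon>"
      by (simp only: set_integral_diff(2)[OF iW T(1)])
    moreover have "\<bar>w (y + 1 * s) (z + c * s) - f (y + 1 * s) (z + c * s)\<bar> \<le> \<epsilon>" "\<bar>w y z - f y z\<bar> \<le> \<epsilon>"
      using b(1)[of "y + 1 * s" "z + c * s"] b(1)[of y z] yz s zb[of 0] zb[of s] by auto
    ultimately have "?d \<le> \<epsilon> + \<epsilon> + s * \<epsilon>" using T(2) by linarith
    also have "\<dots> = (2 + s) * \<epsilon>" by (simp add: algebra_simps)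
    also have "\<dots> = e" using s by (simp add: \<epsilon>_def)
    finally show ?thesis .
  qed
  then have "?d \<le> 0" by (rule field_le_epsilon[of _ 0, simplified])
  then show "set_integrable lborel {0..s} (\<lambda>r. W (y + 1 * r) (z + c * r)) \<and>
     w (y + 1 * s) (z + c * s) - w y z = (LBINT r:{0..s}. W (y + 1 * r) (z + c * r))"
    using iW by simp
qed

lemma volterra_diff:
  assumes K: "bounded_borel2 K" "bounded_borel2 L" and x: "x \<le> 1"
    and i: "set_integrable lborel {0..1} f" "set_integrable lborel {0..1} g"
      "set_integrable lborel {0..1} f'" "set_integrable lborel {0..1} g'"
  shows "volterra K L (\<lambda>\<xi>. f \<xi> - f' \<xi>) (\<lambda>\<xi>. g \<xi> - g' \<xi>) x = volterra K L f g x - volterra K L f' g' x"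
proof -
  obtain C where C: "0 \<le> C" "\<And>x \<xi>. \<bar>K x \<xi>\<bar> \<le> C" "\<And>x \<xi>. \<bar>L x \<xi>\<bar> \<le> C"
    using bounded_borel2_common[OF K] by metis
  have m: "K x \<in> borel_measurable lborel"
    by (rule borel_measurable_curried[of K "\<lambda>_. x" lborel "\<lambda>\<xi>. \<xi>"]) (use K in \<open>simp_all add: bounded_borel2_def\<close>)
  have m': "L x \<in> borel_measurable lborel"
    by (rule borel_measurable_curried[of L "\<lambda>_. x" lborel "\<lambda>\<xi>. \<xi>"]) (use K in \<open>simp_all add: bounded_borel2_def\<close>)
  have ix: "set_integrable lborel {0..x} h" if "set_integrable lborel {0..1} h" for h :: "real \<Rightarrow> real"
    using that by (rule set_integrable_subset) (use x in auto)
  have a: "set_integrable lborel {0..x} (\<lambda>\<xi>. K x \<xi> * f \<xi> + L x \<xi> * g \<xi>)"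
    by (intro set_integral_add set_integrable_bounded_mult[OF ix[OF i(1)] m C(2)] set_integrable_bounded_mult[OF ix[OF i(2)] m' C(3)])
  have b: "set_integrable lborel {0..x} (\<lambda>\<xi>. K x \<xi> * f' \<xi> + L x \<xi> * g' \<xi>)"
    by (intro set_integral_add set_integrable_bounded_mult[OF ix[OF i(3)] m C(2)] set_integrable_bounded_mult[OF ix[OF i(4)] m' C(3)])
  show ?thesis
    unfolding volterra_def set_integral_diff(2)[OF a b, symmetric]
    by (rule set_lebesgue_integral_cong) (auto simp: algebra_simps)
qed

text \<open>Consequently neither transformation changes the trace at x = 0, and the boundary
  condition there is shared by states, targets and iterates.\<close>

lemma volterra_at_0: "volterra K L f g 0 = 0"
proof -
  have "AE \<xi> in lborel. \<xi> \<noteq> (0::real)" by (rule AE_lborel_singleton)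
  then have "AE \<xi> in lborel. indicat_real {0..0} \<xi> *\<^sub>R (K 0 \<xi> * f \<xi> + L 0 \<xi> * g \<xi>) = 0"
    by eventually_elim (simp add: indicator_def)
  then show ?thesis unfolding volterra_def set_lebesgue_integral_def by (rule integral_eq_zero_AE)
qed

section \<open>The Neumann iteration\<close>

text \<open>The target system in the format of \<open>broad_pair\<close> with zero sources.
  Integrability along transversal lines is asked of \<alpha> and \<beta> themselves; the bounded
  couplings are multiplied in later.\<close>

definition target_pair ::
  "real \<Rightarrow> real \<Rightarrow> real \<Rightarrow> (real \<Rightarrow> real \<Rightarrow> real) \<Rightarrow> (real \<Rightarrow> real \<Rightarrow> real) \<Rightarrow> bool" where
  "target_pair lam \<mu> q \<alpha> \<beta> \<longleftrightarrow> tame \<alpha> \<and> tame \<beta> \<and>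
     transport_eq half_strip 1 lam \<alpha> (\<lambda>t x. 0) \<and> transport_eq half_strip 1 (- \<mu>) \<beta> (\<lambda>t x. 0) \<and>
     (\<forall>t>0. \<alpha> t 0 = q * \<beta> t 0) \<and>
     (\<forall>t s. 0 \<le> t \<longrightarrow> 0 \<le> s \<longrightarrow> set_integrable lborel {0..s} (\<lambda>r. \<beta> (t + r) 0)) \<and>
     along_integrable lam \<beta> \<and> along_integrable (- \<mu>) \<alpha>"

lemma slab_bounded_zero: "slab_bounded (\<lambda>t x. 0)"
  by (auto simp: slab_bounded_def case_prod_beta')

lemma target_pair_broad_pair:
  assumes tp: "target_pair lam \<mu> q \<alpha> \<beta>" and b: "bounded_borel spm" "bounded_borel smp"
  shows "broad_pair lam \<mu> q spm smp \<alpha> \<beta> (\<lambda>t x. 0) (\<lambda>t x. 0)"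
  using tp b unfolding target_pair_def broad_pair_def
  by (auto intro: along_integrable_mult slab_bounded_tame slab_bounded_zero)

text \<open>By the transport formula the defect of the new first component is \<open>spm\<close>
  times the change of \<open>g\<close> plus a Volterra image of the old defects. The new pair equals
  (\<alpha>, \<beta>) at x = 0 and differs from it by bounded functions elsewhere, so integrability
  of the trace and along transversal lines is inherited from the target pair.\<close>

lemma neumann_step:
  assumes row1: "kernel_row lam \<mu> q spm smp Kuu Kuv"
    and row2: "kernel_row \<mu> lam (1 / q) (\<lambda>x. - smp x) (\<lambda>x. - spm x) Kvv Kvu" and q: "q \<noteq> 0"
    and tp: "target_pair lam \<mu> q \<alpha> \<beta>" and bp: "broad_pair lam \<mu> q spm smp f g F G"
  defines "P \<equiv> \<lambda>t \<xi>. F t \<xi> - spm \<xi> * g t \<xi>" and "Q \<equiv> \<lambda>t \<xi>. G t \<xi> - smp \<xi> * f t \<xi>"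
  shows "broad_pair lam \<mu> q spm smp (\<lambda>t x. \<alpha> t x + volterra Kuu Kuv (f t) (g t) x) (\<lambda>t x. \<beta> t x + volterra Kvu Kvv (f t) (g t) x)
     (\<lambda>t x. spm x * g t x + volterra Kuu Kuv (P t) (Q t) x) (\<lambda>t x. smp x * f t x + volterra Kvu Kvv (P t) (Q t) x)"
proof -
  have b: "bounded_borel spm" "bounded_borel smp" and K: "bounded_borel2 Kuu" "bounded_borel2 Kuv" "bounded_borel2 Kvu" "bounded_borel2 Kvv"
    using row1 row2 by (auto simp: kernel_row_def)
  have t: "tame f" "tame g" "tame F" "tame G" "tame \<alpha>" "tame \<beta>" using bp tp by (auto simp: broad_pair_def target_pair_def)
  have PQ: "tame P" "tame Q"
    unfolding P_def Q_def by (intro tame_diff tame_mult t b)+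
  note V = slab_bounded_volterra[OF K(1,2) t(1,2)] slab_bounded_volterra[OF K(3,4) t(1,2)]
  note W = slab_bounded_volterra[OF K(1,2) PQ] slab_bounded_volterra[OF K(3,4) PQ]
  have Ta: "transport_eq half_strip 1 lam \<alpha> (\<lambda>t x. 0)" "transport_eq half_strip 1 (- \<mu>) \<beta> (\<lambda>t x. 0)"
    using tp by (auto simp: target_pair_def)
  have T1: "transport_eq half_strip 1 lam (\<lambda>t x. \<alpha> t x + volterra Kuu Kuv (f t) (g t) x) (\<lambda>t x. spm x * g t x + volterra Kuu Kuv (P t) (Q t) x)"
    using transport_eq_add[OF Ta(1) volterra_transport_right[OF row1 bp]] by (simp add: P_def Q_def)
  have T2: "transport_eq half_strip 1 (- \<mu>) (\<lambda>t x. \<beta> t x + volterra Kvu Kvv (f t) (g t) x) (\<lambda>t x. smp x * f t x + volterra Kvu Kvv (P t) (Q t) x)"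
    using transport_eq_add[OF Ta(2) volterra_transport_left[OF row2 q bp]] by (simp add: P_def Q_def)
  have tA: "along_integrable lam \<beta>" "along_integrable (- \<mu>) \<alpha>" using tp by (auto simp: target_pair_def)
  note A = along_integrable_mult[OF b(1) along_integrable_add[OF tA(1) along_integrable_bounded[OF V(2)]]]
    along_integrable_mult[OF b(2) along_integrable_add[OF tA(2) along_integrable_bounded[OF V(1)]]]
  show ?thesis
    unfolding broad_pair_def
    using T1 T2 A tp
    by (simp add: volterra_at_0 target_pair_def tame_add tame_mult slab_bounded_tame V W t b)
qed

lemma volterra_solution_transport:
  assumes row1: "kernel_row lam \<mu> q spm smp Kuu Kuv"
    and row2: "kernel_row \<mu> lam (1 / q) (\<lambda>x. - smp x) (\<lambda>x. - spm x) Kvv Kvu" and q: "q \<noteq> 0"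
    and tp: "target_pair lam \<mu> q \<alpha> \<beta>"
    and bd: "slab_bounded (\<lambda>t x. u t x - \<alpha> t x)" "slab_bounded (\<lambda>t x. v t x - \<beta> t x)"
    and u: "\<And>t x. 0 \<le> t \<Longrightarrow> 0 \<le> x \<Longrightarrow> x \<le> 1 \<Longrightarrow> u t x = \<alpha> t x + volterra Kuu Kuv (u t) (v t) x"
    and v: "\<And>t x. 0 \<le> t \<Longrightarrow> 0 \<le> x \<Longrightarrow> x \<le> 1 \<Longrightarrow> v t x = \<beta> t x + volterra Kvu Kvv (u t) (v t) x"
  shows "transport_eq half_strip 1 lam u (\<lambda>t x. spm x * v t x)"
    and "transport_eq half_strip 1 (- \<mu>) v (\<lambda>t x. smp x * u t x)"
proof -
  have b: "bounded_borel spm" "bounded_borel smp" and K: "bounded_borel2 Kuu" "bounded_borel2 Kuv" "bounded_borel2 Kvu" "bounded_borel2 Kvv"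
    using row1 row2 by (auto simp: kernel_row_def)
  obtain C1 where C1: "0 \<le> C1" "\<And>x \<xi>. \<bar>Kuu x \<xi>\<bar> \<le> C1" "\<And>x \<xi>. \<bar>Kuv x \<xi>\<bar> \<le> C1"
    using bounded_borel2_common[OF K(1,2)] by metis
  obtain C2 where C2: "0 \<le> C2" "\<And>x \<xi>. \<bar>Kvu x \<xi>\<bar> \<le> C2" "\<And>x \<xi>. \<bar>Kvv x \<xi>\<bar> \<le> C2"
    using bounded_borel2_common[OF K(3,4)] by metis
  obtain S1 S2 where S12: "\<And>x. \<bar>spm x\<bar> \<le> S1" "\<And>x. \<bar>smp x\<bar> \<le> S2"
    using b by (auto simp: bounded_borel_def)
  define S where "S = max 0 (max S1 S2)"
  have S: "0 \<le> S" "\<bar>spm x\<bar> \<le> S" "\<bar>smp x\<bar> \<le> S" for x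
    using S12[of x] by (auto simp: S_def)
  have SB: "\<bar>spm x * y\<bar> \<le> S * z" "\<bar>smp x * y\<bar> \<le> S * z" if "\<bar>y\<bar> \<le> z" for x y z
    unfolding abs_mult using that S by (simp_all add: mult_mono)
  \<comment> \<open>Large enough for the weighted estimate of both rows; the added 1 keeps \<gamma>
    positive.\<close>
  define \<gamma> where "\<gamma> = 8 * (C1 + C2) + 1"
  have \<gamma>: "\<gamma> > 0" "8 * C1 \<le> \<gamma>" "8 * C2 \<le> \<gamma>" using C1 C2 by (auto simp: \<gamma>_def)
  \<comment> \<open>The defects get a weight \<open>\<kappa>\<close> that absorbs the coupling: 5 S
    / 4 + \<kappa> / 4 \<le> \<kappa> / 2 holds as soon as \<kappa> \<ge> 5 S.\<close>
  define \<kappa> where "\<kappa> = 5 * (S + 1)"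
  have \<kappa>: "\<kappa> \<ge> 1" using S by (simp add: \<kappa>_def)
  have ta: "tame \<alpha>" "tame \<beta>" using tp by (auto simp: target_pair_def)
  have tu: "tame u" "tame v"
    using tame_add[OF slab_bounded_tame[OF bd(1)] ta(1)] tame_add[OF slab_bounded_tame[OF bd(2)] ta(2)] by simp_all
  \<comment> \<open>One number \<open>d\<close> controls the distance to (u, v) and, with weight
    \<open>\<kappa>\<close>, both defects; a Neumann step halves it.\<close>
  define close where "close = (\<lambda>T d f g F G. \<forall>t x. 0 \<le> t \<longrightarrow> t \<le> T \<longrightarrow> 0 \<le> x \<longrightarrow> x \<le> 1 \<longrightarrow>
     \<bar>u t x - f t x\<bar> \<le> d * exp (\<gamma> * x) \<and> \<bar>v t x - g t x\<bar> \<le> d * exp (\<gamma> * x) \<and>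
     \<bar>F t x - spm x * g t x\<bar> \<le> \<kappa> * d * exp (\<gamma> * x) \<and> \<bar>G t x - smp x * f t x\<bar> \<le> \<kappa> * d * exp (\<gamma> * x))"
  have vdiff: "u t x - (\<alpha> t x + volterra Kuu Kuv (f t) (g t) x) = volterra Kuu Kuv (\<lambda>\<xi>. u t \<xi> - f t \<xi>) (\<lambda>\<xi>. v t \<xi> - g t \<xi>) x"
      "v t x - (\<beta> t x + volterra Kvu Kvv (f t) (g t) x) = volterra Kvu Kvv (\<lambda>\<xi>. u t \<xi> - f t \<xi>) (\<lambda>\<xi>. v t \<xi> - g t \<xi>) x"
    if "tame f" "tame g" "0 \<le> t" "0 \<le> x" "x \<le> 1" for f g t x
    using volterra_diff[OF K(1,2) that(5) tame_integrable[OF tu(1) that(3)] tame_integrable[OF tu(2) that(3)]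
         tame_integrable[OF that(1,3)] tame_integrable[OF that(2,3)]]
      volterra_diff[OF K(3,4) that(5) tame_integrable[OF tu(1) that(3)] tame_integrable[OF tu(2) that(3)]
         tame_integrable[OF that(1,3)] tame_integrable[OF that(2,3)]] u[OF that(3-5)] v[OF that(3-5)] by simp_all
  have step: "\<exists>f' g' F' G'. broad_pair lam \<mu> q spm smp f' g' F' G' \<and> close T (d / 2) f' g' F' G'"
    if bp: "broad_pair lam \<mu> q spm smp f g F G" and cl: "close T d f g F G" and d: "0 \<le> d" for f g F G T d
  proof -
    have tf: "tame f" "tame g" using bp by (auto simp: broad_pair_def)
    let ?P = "\<lambda>t \<xi>. F t \<xi> - spm \<xi> * g t \<xi>" and ?Q = "\<lambda>t \<xi>. G t \<xi> - smp \<xi> * f t \<xi>"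
    let ?f = "\<lambda>t x. \<alpha> t x + volterra Kuu Kuv (f t) (g t) x" and ?g = "\<lambda>t x. \<beta> t x + volterra Kvu Kvv (f t) (g t) x"
    let ?F = "\<lambda>t x. spm x * g t x + volterra Kuu Kuv (?P t) (?Q t) x" and ?G = "\<lambda>t x. smp x * f t x + volterra Kvu Kvv (?P t) (?Q t) x"
    have "close T (d / 2) ?f ?g ?F ?G"
      unfolding close_def
    proof (intro allI impI)
      fix t x :: real
      assume t: "0 \<le> t" "t \<le> T" and x: "0 \<le> x" "x \<le> 1"
      let ?E = "exp (\<gamma> * x)"
      have c: "\<bar>u t \<xi> - f t \<xi>\<bar> \<le> d * exp (\<gamma> * \<xi>)" "\<bar>v t \<xi> - g t \<xi>\<bar> \<le> d * exp (\<gamma> * \<xi>)"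
        "\<bar>?P t \<xi>\<bar> \<le> \<kappa> * d * exp (\<gamma> * \<xi>)" "\<bar>?Q t \<xi>\<bar> \<le> \<kappa> * d * exp (\<gamma> * \<xi>)" if "0 \<le> \<xi>" "\<xi> \<le> 1" for \<xi>
        using cl t that unfolding close_def by blast+
      have 1: "\<bar>u t x - ?f t x\<bar> \<le> d / 4 * ?E" "\<bar>v t x - ?g t x\<bar> \<le> d / 4 * ?E"
        unfolding vdiff[OF tf t(1) x]
        using volterra_exp_bound[of Kuu C1 Kuv, OF C1(2,3) \<gamma>(1,2) c(1,2) x]
          volterra_exp_bound[of Kvu C2 Kvv, OF C2(2,3) \<gamma>(1,3) c(1,2) x] by blast+
      have 2: "\<bar>volterra Kuu Kuv (?P t) (?Q t) x\<bar> \<le> \<kappa> * d / 4 * ?E" "\<bar>volterra Kvu Kvv (?P t) (?Q t) x\<bar> \<le> \<kappa> * d / 4 * ?E"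
        using volterra_exp_bound[of Kuu C1 Kuv, OF C1(2,3) \<gamma>(1,2) c(3,4) x]
          volterra_exp_bound[of Kvu C2 Kvv, OF C2(2,3) \<gamma>(1,3) c(3,4) x] by blast+
      have dE: "0 \<le> d * ?E" using d by simp
      \<comment> \<open>5/4 = 1 + 1/4: the distance of the old iterate from (u, v) plus that of the
        new one.\<close>
      have "\<bar>g t x - ?g t x\<bar> \<le> 5 / 4 * (d * ?E)" "\<bar>f t x - ?f t x\<bar> \<le> 5 / 4 * (d * ?E)"
        using 1 c(1,2)[OF x] by linarith+
      then have 3: "\<bar>spm x * (g t x - ?g t x)\<bar> \<le> S * (5 / 4 * (d * ?E))" "\<bar>smp x * (f t x - ?f t x)\<bar> \<le> S * (5 / 4 * (d * ?E))"
        by (simp_all only: SB)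
      have 4: "S * (5 / 4 * (d * ?E)) + \<kappa> * d / 4 * ?E \<le> \<kappa> * (d / 2) * ?E"
      proof -
        define e where "e = d * ?E"
        have "\<kappa> * d / 4 * ?E = \<kappa> / 4 * e" "\<kappa> * (d / 2) * ?E = \<kappa> / 2 * e" by (simp_all add: e_def)
        moreover have "S * (5 / 4 * e) + \<kappa> / 4 * e \<le> \<kappa> / 2 * e"
          using dE unfolding \<kappa>_def e_def[symmetric] by (simp add: field_simps)
        ultimately show ?thesis unfolding e_def by simp
      qed
      have "\<bar>?F t x - spm x * ?g t x\<bar> \<le> \<kappa> * (d / 2) * ?E"
      proof -
        have "?F t x - spm x * ?g t x = spm x * (g t x - ?g t x) + volterra Kuu Kuv (?P t) (?Q t) x" by (simp add: algebra_simps)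
        then show ?thesis using 2(1) 3(1) 4 by linarith
      qed
      moreover have "\<bar>?G t x - smp x * ?f t x\<bar> \<le> \<kappa> * (d / 2) * ?E"
      proof -
        have "?G t x - smp x * ?f t x = smp x * (f t x - ?f t x) + volterra Kvu Kvv (?P t) (?Q t) x" by (simp add: algebra_simps)
        then show ?thesis using 2(2) 3(2) 4 by linarith
      qed
      moreover have "d / 4 * ?E \<le> d / 2 * ?E" using dE by simp
      ultimately show "\<bar>u t x - ?f t x\<bar> \<le> d / 2 * ?E \<and> \<bar>v t x - ?g t x\<bar> \<le> d / 2 * ?E \<and>
          \<bar>?F t x - spm x * ?g t x\<bar> \<le> \<kappa> * (d / 2) * ?E \<and> \<bar>?G t x - smp x * ?f t x\<bar> \<le> \<kappa> * (d / 2) * ?E"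
        using 1 by linarith
    qed
    with neumann_step[OF row1 row2 q tp bp] show ?thesis by blast
  qed
  \<comment> \<open>The start is the first iterate, not (\<alpha>, \<beta>): the defect -
    \<open>spm\<close> \<beta> of the latter may be unbounded, whereas after one step only Volterra
    images, multiplied by bounded couplings, remain.\<close>
  have base: "\<exists>d f g F G. 0 \<le> d \<and> broad_pair lam \<mu> q spm smp f g F G \<and> close T d f g F G" for T
  proof -
    note bp = target_pair_broad_pair[OF tp b]
    let ?P = "\<lambda>t \<xi>. 0 - spm \<xi> * \<beta> t \<xi>" and ?Q = "\<lambda>t \<xi>. 0 - smp \<xi> * \<alpha> t \<xi>"
    let ?f = "\<lambda>t x. \<alpha> t x + volterra Kuu Kuv (\<alpha> t) (\<beta> t) x" and ?g = "\<lambda>t x. \<beta> t x + volterra Kvu Kvv (\<alpha> t) (\<beta> t) x"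
    let ?F = "\<lambda>t x. spm x * \<beta> t x + volterra Kuu Kuv (?P t) (?Q t) x" and ?G = "\<lambda>t x. smp x * \<alpha> t x + volterra Kvu Kvv (?P t) (?Q t) x"
    have PQ: "tame ?P" "tame ?Q"
      by (intro tame_diff tame_mult ta b slab_bounded_tame[OF slab_bounded_zero])+
    note V = slab_bounded_volterra[OF K(1,2) ta] slab_bounded_volterra[OF K(3,4) ta]
      slab_bounded_volterra[OF K(1,2) PQ] slab_bounded_volterra[OF K(3,4) PQ]
    have sb: "slab_bounded (\<lambda>t x. u t x - \<alpha> t x - volterra Kuu Kuv (\<alpha> t) (\<beta> t) x)"
      "slab_bounded (\<lambda>t x. v t x - \<beta> t x - volterra Kvu Kvv (\<alpha> t) (\<beta> t) x)"
      "slab_bounded (\<lambda>t x. volterra Kuu Kuv (?P t) (?Q t) x - spm x * volterra Kvu Kvv (\<alpha> t) (\<beta> t) x)"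
      "slab_bounded (\<lambda>t x. volterra Kvu Kvv (?P t) (?Q t) x - smp x * volterra Kuu Kuv (\<alpha> t) (\<beta> t) x)"
      by (intro slab_bounded_diff slab_bounded_mult bd V b)+
    obtain M1 where M1: "\<And>t x. 0 \<le> t \<Longrightarrow> t \<le> T \<Longrightarrow> 0 \<le> x \<Longrightarrow> x \<le> 1 \<Longrightarrow> \<bar>u t x - \<alpha> t x - volterra Kuu Kuv (\<alpha> t) (\<beta> t) x\<bar> \<le> M1"
      using slab_boundedE[OF sb(1), of T] by blast
    obtain M2 where M2: "\<And>t x. 0 \<le> t \<Longrightarrow> t \<le> T \<Longrightarrow> 0 \<le> x \<Longrightarrow> x \<le> 1 \<Longrightarrow> \<bar>v t x - \<beta> t x - volterra Kvu Kvv (\<alpha> t) (\<beta> t) x\<bar> \<le> M2"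
      using slab_boundedE[OF sb(2), of T] by blast
    obtain M3 where M3: "\<And>t x. 0 \<le> t \<Longrightarrow> t \<le> T \<Longrightarrow> 0 \<le> x \<Longrightarrow> x \<le> 1 \<Longrightarrow>
        \<bar>volterra Kuu Kuv (?P t) (?Q t) x - spm x * volterra Kvu Kvv (\<alpha> t) (\<beta> t) x\<bar> \<le> M3"
      using slab_boundedE[OF sb(3), of T] by blast
    obtain M4 where M4: "\<And>t x. 0 \<le> t \<Longrightarrow> t \<le> T \<Longrightarrow> 0 \<le> x \<Longrightarrow> x \<le> 1 \<Longrightarrow>
        \<bar>volterra Kvu Kvv (?P t) (?Q t) x - smp x * volterra Kuu Kuv (\<alpha> t) (\<beta> t) x\<bar> \<le> M4"
      using slab_boundedE[OF sb(4), of T] by blast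
    define d where "d = \<bar>M1\<bar> + \<bar>M2\<bar> + \<bar>M3\<bar> + \<bar>M4\<bar>"
    have "close T d ?f ?g ?F ?G"
      unfolding close_def
    proof (intro allI impI)
      fix t x :: real
      assume tx: "0 \<le> t" "t \<le> T" "0 \<le> x" "x \<le> 1"
      have E: "1 \<le> exp (\<gamma> * x)" using \<gamma> tx by simp
      have d: "0 \<le> d" by (simp add: d_def)
      have dE: "d \<le> d * exp (\<gamma> * x)" using mult_left_mono[OF E d] by simp
      also have "d * exp (\<gamma> * x) \<le> \<kappa> * (d * exp (\<gamma> * x))"
        using mult_right_mono[OF \<kappa>, of "d * exp (\<gamma> * x)"] d by simp
      finally have kE: "d \<le> \<kappa> * d * exp (\<gamma> * x)" by (simp add: mult.assoc)
      have e: "?F t x - spm x * ?g t x = volterra Kuu Kuv (?P t) (?Q t) x - spm x * volterra Kvu Kvv (\<alpha> t) (\<beta> t) x"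
        "?G t x - smp x * ?f t x = volterra Kvu Kvv (?P t) (?Q t) x - smp x * volterra Kuu Kuv (\<alpha> t) (\<beta> t) x"
        "u t x - ?f t x = u t x - \<alpha> t x - volterra Kuu Kuv (\<alpha> t) (\<beta> t) x"
        "v t x - ?g t x = v t x - \<beta> t x - volterra Kvu Kvv (\<alpha> t) (\<beta> t) x"
        by (simp_all add: algebra_simps)
      have M: "M1 \<le> d" "M2 \<le> d" "M3 \<le> d" "M4 \<le> d" unfolding d_def by linarith+
      show "\<bar>u t x - ?f t x\<bar> \<le> d * exp (\<gamma> * x) \<and> \<bar>v t x - ?g t x\<bar> \<le> d * exp (\<gamma> * x) \<and>
          \<bar>?F t x - spm x * ?g t x\<bar> \<le> \<kappa> * d * exp (\<gamma> * x) \<and> \<bar>?G t x - smp x * ?f t x\<bar> \<le> \<kappa> * d * exp (\<gamma> * x)"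
        unfolding e using M1[OF tx] M2[OF tx] M3[OF tx] M4[OF tx] M dE kE by linarith
    qed
    moreover have "0 \<le> d" by (simp add: d_def)
    ultimately show ?thesis using neumann_step[OF row1 row2 q tp bp] by blast
  qed
  have approx: "\<exists>f g F G. broad_pair lam \<mu> q spm smp f g F G \<and> (\<forall>t x. 0 \<le> t \<longrightarrow> t \<le> T \<longrightarrow> 0 \<le> x \<longrightarrow> x \<le> 1 \<longrightarrow>
      \<bar>u t x - f t x\<bar> \<le> \<epsilon> \<and> \<bar>v t x - g t x\<bar> \<le> \<epsilon> \<and> \<bar>spm x * v t x - F t x\<bar> \<le> \<epsilon> \<and> \<bar>smp x * u t x - G t x\<bar> \<le> \<epsilon>)"
    if \<epsilon>: "\<epsilon> > 0" for \<epsilon> T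
  proof -
    obtain d0 f0 g0 F0 G0 where d0: "0 \<le> d0" and i0: "broad_pair lam \<mu> q spm smp f0 g0 F0 G0" "close T d0 f0 g0 F0 G0"
      using base[of T] by blast
    have iter: "\<exists>f g F G. broad_pair lam \<mu> q spm smp f g F G \<and> close T (d0 / 2 ^ n) f g F G" for n
    proof (induction n)
      case 0
      then show ?case using i0 by auto
    next
      case (Suc n)
      then obtain f g F G where "broad_pair lam \<mu> q spm smp f g F G" "close T (d0 / 2 ^ n) f g F G" by blast
      from step[OF this] d0 show ?case by (simp add: mult.commute)
    qed
    \<comment> \<open>Collects all errors: \<open>\<kappa>\<close> for the defect, \<open>S\<close>
      for replacing \<open>g\<close> by \<open>v\<close> in the coupling, 1 for the state itself,
      and \<open>exp \<gamma>\<close> for the weight on [0, 1].\<close>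
    define D where "D = (\<kappa> + S + 1) * exp \<gamma>"
    have D: "D > 0" using \<kappa> S by (simp add: D_def)
    obtain n where n: "d0 * D / \<epsilon> < 2 ^ n" using real_arch_pow[of 2] by auto
    define d where "d = d0 / 2 ^ n"
    have d: "0 \<le> d" using d0 by (simp add: d_def)
    have dD: "d * D \<le> \<epsilon>" using n \<epsilon> by (simp add: d_def field_simps)
    obtain f g F G where bp: "broad_pair lam \<mu> q spm smp f g F G" and cl: "close T d f g F G"
      using iter[of n] by (auto simp: d_def)
    have "\<bar>u t x - f t x\<bar> \<le> \<epsilon> \<and> \<bar>v t x - g t x\<bar> \<le> \<epsilon> \<and> \<bar>spm x * v t x - F t x\<bar> \<le> \<epsilon> \<and> \<bar>smp x * u t x - G t x\<bar> \<le> \<epsilon>"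
      if tx: "0 \<le> t" "t \<le> T" "0 \<le> x" "x \<le> 1" for t x
    proof -
      let ?E = "exp (\<gamma> * x)"
      have c: "\<bar>u t x - f t x\<bar> \<le> d * ?E" "\<bar>v t x - g t x\<bar> \<le> d * ?E"
        "\<bar>F t x - spm x * g t x\<bar> \<le> \<kappa> * d * ?E" "\<bar>G t x - smp x * f t x\<bar> \<le> \<kappa> * d * ?E"
        using cl tx unfolding close_def by blast+
      have s: "\<bar>spm x * (v t x - g t x)\<bar> \<le> S * (d * ?E)" "\<bar>smp x * (u t x - f t x)\<bar> \<le> S * (d * ?E)"
        using c(1,2) by (simp_all only: SB)
      have "?E \<le> exp \<gamma>" using \<gamma> tx by (simp add: mult_left_le)
      then have "(\<kappa> + S + 1) * (d * ?E) \<le> (\<kappa> + S + 1) * (d * exp \<gamma>)"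
        using d \<kappa> S by (intro mult_left_mono) auto
      also have "\<dots> \<le> \<epsilon>" using dD by (simp add: D_def mult_ac)
      finally have tot: "\<kappa> * (d * ?E) + S * (d * ?E) + d * ?E \<le> \<epsilon>" by (simp add: algebra_simps)
      have nn: "0 \<le> d * ?E" "0 \<le> S * (d * ?E)" "0 \<le> \<kappa> * (d * ?E)" using d S \<kappa> by simp_all
      have e: "spm x * v t x - F t x = spm x * (v t x - g t x) - (F t x - spm x * g t x)"
        "smp x * u t x - G t x = smp x * (u t x - f t x) - (G t x - smp x * f t x)" by (simp_all add: algebra_simps)
      show ?thesis unfolding e using c s tot nn by (auto simp: mult.assoc)
    qed
    then show ?thesis using bp by blast
  qed
  have al: "along_integrable lam (\<lambda>t x. spm x * v t x)" "along_integrable (- \<mu>) (\<lambda>t x. smp x * u t x)"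
    using along_integrable_mult[OF b(1) along_integrable_add[OF along_integrable_bounded[OF bd(2)], of lam \<beta>]]
      along_integrable_mult[OF b(2) along_integrable_add[OF along_integrable_bounded[OF bd(1)], of "- \<mu>" \<alpha>]] tp
    by (simp_all add: target_pair_def)
  show "transport_eq half_strip 1 lam u (\<lambda>t x. spm x * v t x)"
  proof (rule transport_eq_limit[OF al(1)])
    fix T \<epsilon> :: real assume "\<epsilon> > 0"
    from approx[OF this, of T] show "\<exists>f F. transport_eq half_strip 1 lam f F \<and>
      (\<forall>t x. 0 \<le> t \<longrightarrow> t \<le> T \<longrightarrow> 0 \<le> x \<longrightarrow> x \<le> 1 \<longrightarrow> \<bar>u t x - f t x\<bar> \<le> \<epsilon> \<and> \<bar>spm x * v t x - F t x\<bar> \<le> \<epsilon>)"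
      unfolding broad_pair_def by blast
  qed
  show "transport_eq half_strip 1 (- \<mu>) v (\<lambda>t x. smp x * u t x)"
  proof (rule transport_eq_limit[OF al(2)])
    fix T \<epsilon> :: real assume "\<epsilon> > 0"
    from approx[OF this, of T] show "\<exists>f F. transport_eq half_strip 1 (- \<mu>) f F \<and>
      (\<forall>t x. 0 \<le> t \<longrightarrow> t \<le> T \<longrightarrow> 0 \<le> x \<longrightarrow> x \<le> 1 \<longrightarrow> \<bar>v t x - f t x\<bar> \<le> \<epsilon> \<and> \<bar>smp x * u t x - F t x\<bar> \<le> \<epsilon>)"
      unfolding broad_pair_def by blast
  qed
qed

section \<open>Continuity of translations in mean square\<close>

text \<open>Stated along sequences, the form in which dominated convergence delivers it.\<close>

definition L1_translation_continuous :: "(real \<Rightarrow> real) \<Rightarrow> bool" where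
  "L1_translation_continuous f \<longleftrightarrow>
     (\<forall>X. X \<longlonglongrightarrow> (0::real) \<longrightarrow> (\<lambda>n. LBINT x. \<bar>f (X n + x) - f x\<bar>) \<longlonglongrightarrow> 0)"

lemma lborel_translate:
  fixes f :: "real \<Rightarrow> real"
  shows "integrable lborel f \<Longrightarrow> integrable lborel (\<lambda>x. f (h + x))" and "(LBINT x. f (h + x)) = (LBINT x. f x)"
  using lborel_integrable_real_affine[of f 1 h] lborel_integral_real_affine[of 1 f h] by simp_all

text \<open>Translation preserves the distance of \<open>f\<close> and \<open>g\<close>, so the
  approximation error enters twice and the modulus of \<open>g\<close> once, each at most a quarter
  of \<open>r\<close>.\<close>

lemma L1_translation_approx:
  assumes f: "integrable lborel f"
    and approx: "\<And>e. e > 0 \<Longrightarrow> \<exists>g. integrable lborel g \<and> L1_translation_continuous g \<and> (LBINT x. \<bar>f x - g x\<bar>) \<le> e"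
  shows "L1_translation_continuous f"
  unfolding L1_translation_continuous_def
proof (intro allI impI LIMSEQ_I)
  fix X :: "nat \<Rightarrow> real" and r :: real
  assume X: "X \<longlonglongrightarrow> 0" and r: "0 < r"
  obtain g where g: "integrable lborel g" "L1_translation_continuous g" "(LBINT x. \<bar>f x - g x\<bar>) \<le> r / 4"
    using approx[of "r / 4"] r by auto
  have "(\<lambda>n. LBINT x. \<bar>g (X n + x) - g x\<bar>) \<longlonglongrightarrow> 0" using g(2) X by (simp add: L1_translation_continuous_def)
  from LIMSEQ_D[OF this, of "r / 4"] r
  obtain N where N: "\<And>n. N \<le> n \<Longrightarrow> \<bar>LBINT x. \<bar>g (X n + x) - g x\<bar>\<bar> < r / 4" by auto
  have "norm ((LBINT x. \<bar>f (X n + x) - f x\<bar>) - 0) < r" if n: "N \<le> n" for n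
  proof -
    let ?h = "X n"
    have i: "integrable lborel (\<lambda>x. \<bar>f (?h + x) - g (?h + x)\<bar>)" "integrable lborel (\<lambda>x. \<bar>f x - g x\<bar>)"
      "integrable lborel (\<lambda>x. \<bar>g (?h + x) - g x\<bar>)" "integrable lborel (\<lambda>x. \<bar>f (?h + x) - f x\<bar>)"
      using f g(1) lborel_translate(1)[OF f, of ?h] lborel_translate(1)[OF g(1), of ?h] by auto
    have "(LBINT x. \<bar>f (?h + x) - f x\<bar>) \<le> (LBINT x. \<bar>f (?h + x) - g (?h + x)\<bar> + \<bar>f x - g x\<bar> + \<bar>g (?h + x) - g x\<bar>)"
      using i by (intro integral_mono) auto
    also have "\<dots> = (LBINT x. \<bar>f (?h + x) - g (?h + x)\<bar>) + (LBINT x. \<bar>f x - g x\<bar>) + (LBINT x. \<bar>g (?h + x) - g x\<bar>)"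
      using i by simp
    also have "(LBINT x. \<bar>f (?h + x) - g (?h + x)\<bar>) = (LBINT x. \<bar>f x - g x\<bar>)"
      by (rule lborel_translate(2)[of "\<lambda>x. \<bar>f x - g x\<bar>"])
    finally have "(LBINT x. \<bar>f (?h + x) - f x\<bar>) < r" using g(3) N[OF n] r by linarith
    moreover have "0 \<le> (LBINT x. \<bar>f (?h + x) - f x\<bar>)" by (rule Bochner_Integration.integral_nonneg) simp
    ultimately show ?thesis by simp
  qed
  then show "\<exists>no. \<forall>n\<ge>no. norm ((LBINT x. \<bar>f (X n + x) - f x\<bar>) - 0) < r" by blast
qed

text \<open>For an open set, x \<in> U forces X n + x \<in> U eventually, so the positive part of
  u(x) - u(X n + x) tends to 0 and is dominated by \<open>u\<close>. The negative part has the same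
  integral, because \<open>u\<close> and its translate have; hence the factor 2.\<close>

lemma L1_translation_open:
  assumes U: "open U" and fin: "emeasure lborel U < \<infinity>"
  shows "L1_translation_continuous (\<lambda>x. indicator U x * c)"
  unfolding L1_translation_continuous_def
proof (intro allI impI)
  fix X :: "nat \<Rightarrow> real" assume X: "X \<longlonglongrightarrow> 0"
  have [measurable]: "U \<in> sets borel" using U by simp
  define u where "u = (indicator U :: real \<Rightarrow> real)"
  have iu: "integrable lborel u" using fin by (simp add: u_def)
  have mu[measurable]: "u \<in> borel_measurable borel" by (simp add: u_def)
  have it: "integrable lborel (\<lambda>x. u (h + x))" for h by (rule lborel_translate(1)[OF iu])
  have lim: "(\<lambda>n. LBINT x. max 0 (u x - u (X n + x))) \<longlonglongrightarrow> (LBINT x :: real. 0)"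
  proof (rule Bochner_Integration.integral_dominated_convergence[where w = u])
    show "AE x in lborel. (\<lambda>n. max 0 (u x - u (X n + x))) \<longlonglongrightarrow> 0"
    proof (rule AE_I2)
      fix x
      show "(\<lambda>n. max 0 (u x - u (X n + x))) \<longlonglongrightarrow> 0"
      proof (cases "x \<in> U")
        case True
        have "(\<lambda>n. X n + x) \<longlonglongrightarrow> 0 + x" by (intro tendsto_intros X)
        then have "eventually (\<lambda>n. X n + x \<in> U) sequentially"
          using topological_tendstoD[OF _ U] True by simp
        then have "eventually (\<lambda>n. max 0 (u x - u (X n + x)) = 0) sequentially"
          by eventually_elim (simp add: u_def True)
        then show ?thesis by (rule tendsto_eventually)
      next
        case False
        then show ?thesis by (simp add: u_def indicator_def)
      qed
    qed
    show "AE x in lborel. norm (max 0 (u x - u (X n + x))) \<le> u x" for n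
      by (intro AE_I2) (auto simp: u_def indicator_def)
  qed (use iu in auto)
  have "(LBINT x. \<bar>indicator U (X n + x) * c - indicator U x * c\<bar>) = \<bar>c\<bar> * (2 * (LBINT x. max 0 (u x - u (X n + x))))" for n
  proof -
    have i1: "integrable lborel (\<lambda>x. max 0 (u x - u (X n + x)))" using iu it by auto
    have "(\<lambda>x. \<bar>indicator U (X n + x) * c - indicator U x * c\<bar>) =
        (\<lambda>x. \<bar>c\<bar> * (2 * max 0 (u x - u (X n + x)) - (u x - u (X n + x))))"
      by (auto simp: u_def indicator_def fun_eq_iff)
    then have "(LBINT x. \<bar>indicator U (X n + x) * c - indicator U x * c\<bar>) =
       \<bar>c\<bar> * (2 * (LBINT x. max 0 (u x - u (X n + x))) - ((LBINT x. u x) - (LBINT x. u (X n + x))))"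
      using i1 iu it by simp
    then show ?thesis using lborel_translate(2)[of u "X n"] by simp
  qed
  then show "(\<lambda>n. LBINT x. \<bar>indicator U (X n + x) * c - indicator U x * c\<bar>) \<longlonglongrightarrow> 0"
    using tendsto_mult_left[OF tendsto_mult_left[OF lim, of 2], of "\<bar>c\<bar>"] by simp
qed

text \<open>Induction over integrable functions; Borel sets of finite measure are reached from open
  ones by outer regularity.\<close>

lemma L1_translation:
  fixes f :: "real \<Rightarrow> real"
  assumes "integrable lborel f"
  shows "L1_translation_continuous f"
  using assms
proof (induction rule: integrable_induct)
  case (base A c)
  then have [measurable]: "A \<in> sets borel" by simp
  have iA: "integrable lborel (\<lambda>x. indicator A x *\<^sub>R c)" using base by simp
  show ?case
  proof (rule L1_translation_approx[OF iA])
    fix e :: real assume e: "e > 0"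
    \<comment> \<open>The added 1 covers c = 0.\<close>
    define d where "d = e / (\<bar>c\<bar> + 1)"
    have d: "d > 0" using e by (simp add: d_def)
    obtain U where U: "open U" "A \<subseteq> U" "emeasure lborel (U - A) < ennreal d"
      using outer_regular_lborel[of A d] d by auto
    have [measurable]: "U \<in> sets borel" using U by simp
    have "emeasure lborel U = emeasure lborel (A \<union> (U - A))" using U(2) by (simp add: Un_absorb1)
    also have "\<dots> \<le> emeasure lborel A + emeasure lborel (U - A)" by (rule emeasure_subadditive) simp_all
    also have "\<dots> < \<infinity>" using base(2) U(3) by (auto simp: ennreal_add_less_top intro: less_trans[OF U(3)])
    finally have fin: "emeasure lborel U < \<infinity>" .
    have "(LBINT x. \<bar>indicator A x *\<^sub>R c - indicator U x * c\<bar>) = (LBINT x. \<bar>c\<bar> * indicator (U - A) x)"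
      using U(2) by (intro Bochner_Integration.integral_cong) (auto simp: indicator_def)
    also have "\<dots> = \<bar>c\<bar> * measure lborel (U - A)" by simp
    also have "\<dots> \<le> \<bar>c\<bar> * d"
      using U(3) d by (intro mult_left_mono) (auto simp: measure_def enn2real_leI)
    also have "\<dots> \<le> e"
    proof -
      have "\<bar>c\<bar> * d \<le> (\<bar>c\<bar> + 1) * d" using d by simp
      also have "\<dots> = e" by (simp add: d_def add_nonneg_eq_0_iff)
      finally show ?thesis .
    qed
    finally have "(LBINT x. \<bar>indicator A x *\<^sub>R c - indicator U x * c\<bar>) \<le> e" .
    moreover have "integrable lborel (\<lambda>x. indicator U x * c)" using fin by simp
    ultimately show "\<exists>g. integrable lborel g \<and> L1_translation_continuous g \<and> (LBINT x. \<bar>indicator A x *\<^sub>R c - g x\<bar>) \<le> e"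
      using L1_translation_open[OF U(1) fin] by blast
  qed
next
  case (add f g)
  show ?case
    unfolding L1_translation_continuous_def
  proof (intro allI impI)
    fix X :: "nat \<Rightarrow> real" assume X: "X \<longlonglongrightarrow> 0"
    have l: "(\<lambda>n. (LBINT x. \<bar>f (X n + x) - f x\<bar>) + (LBINT x. \<bar>g (X n + x) - g x\<bar>)) \<longlonglongrightarrow> 0"
      using add X tendsto_add[of "\<lambda>n. LBINT x. \<bar>f (X n + x) - f x\<bar>" 0 sequentially "\<lambda>n. LBINT x. \<bar>g (X n + x) - g x\<bar>" 0]
      by (simp add: L1_translation_continuous_def)
    show "(\<lambda>n. LBINT x. \<bar>f (X n + x) + g (X n + x) - (f x + g x)\<bar>) \<longlonglongrightarrow> 0"
    proof (rule tendsto_sandwich[OF _ _ tendsto_const l])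
      show "eventually (\<lambda>n. 0 \<le> (LBINT x. \<bar>f (X n + x) + g (X n + x) - (f x + g x)\<bar>)) sequentially"
        by (intro always_eventually allI Bochner_Integration.integral_nonneg) simp
      have "(LBINT x. \<bar>f (h + x) + g (h + x) - (f x + g x)\<bar>) \<le> (LBINT x. \<bar>f (h + x) - f x\<bar>) + (LBINT x. \<bar>g (h + x) - g x\<bar>)" for h
      proof -
        note i = add.hyps lborel_translate(1)[OF add.hyps(1), of h] lborel_translate(1)[OF add.hyps(2), of h]
        have "(LBINT x. \<bar>f (h + x) + g (h + x) - (f x + g x)\<bar>) \<le> (LBINT x. \<bar>f (h + x) - f x\<bar> + \<bar>g (h + x) - g x\<bar>)"
          using i by (intro integral_mono) auto
        also have "\<dots> = (LBINT x. \<bar>f (h + x) - f x\<bar>) + (LBINT x. \<bar>g (h + x) - g x\<bar>)" using i by simp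
        finally show ?thesis .
      qed
      then show "eventually (\<lambda>n. (LBINT x. \<bar>f (X n + x) + g (X n + x) - (f x + g x)\<bar>) \<le>
          (LBINT x. \<bar>f (X n + x) - f x\<bar>) + (LBINT x. \<bar>g (X n + x) - g x\<bar>)) sequentially"
        by simp
    qed
  qed
next
  case (lim f s)
  show ?case
  proof (rule L1_translation_approx[OF lim.hyps(4)])
    fix e :: real assume e: "e > 0"
    have m: "f \<in> borel_measurable lborel" "\<And>i. s i \<in> borel_measurable lborel"
      using lim.hyps by auto
    have "(\<lambda>i. LBINT x. \<bar>f x - s i x\<bar>) \<longlonglongrightarrow> (LBINT x :: real. 0)"
    \<comment> \<open>The approximating functions are bounded by 2 |f|, hence the differences by 3
      |f|.\<close>
    proof (rule Bochner_Integration.integral_dominated_convergence[where w = "\<lambda>x. 3 * \<bar>f x\<bar>"])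
      show "AE x in lborel. (\<lambda>i. \<bar>f x - s i x\<bar>) \<longlonglongrightarrow> 0"
      proof (rule AE_I2)
        fix x
        have "(\<lambda>i. s i x) \<longlonglongrightarrow> f x" using lim.hyps(2) by simp
        then have "(\<lambda>i. \<bar>f x - s i x\<bar>) \<longlonglongrightarrow> \<bar>f x - f x\<bar>" by (intro tendsto_intros)
        then show "(\<lambda>i. \<bar>f x - s i x\<bar>) \<longlonglongrightarrow> 0" by simp
      qed
      show "AE x in lborel. norm \<bar>f x - s i x\<bar> \<le> 3 * \<bar>f x\<bar>" for i
      proof (rule AE_I2)
        fix x
        have "\<bar>s i x\<bar> \<le> 2 * \<bar>f x\<bar>" using lim.hyps(3)[of x i] by simp
        then show "norm \<bar>f x - s i x\<bar> \<le> 3 * \<bar>f x\<bar>" by simp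
      qed
    qed (use lim.hyps m in auto)
    from LIMSEQ_D[OF this, of e] e obtain i where "\<bar>LBINT x. \<bar>f x - s i x\<bar>\<bar> < e" by auto
    then have "(LBINT x. \<bar>f x - s i x\<bar>) \<le> e" by linarith
    then show "\<exists>g. integrable lborel g \<and> L1_translation_continuous g \<and> (LBINT x. \<bar>f x - g x\<bar>) \<le> e"
      using lim.hyps(1) lim.IH by blast
  qed
qed

text \<open>For \<open>a, b \<ge> 0\<close> one has \<open>(a - b)\<^sup>2 \<le> \<bar>a\<^sup>2 - b\<^sup>2\<bar>\<close>; applied to positive and negative parts
  this reduces the \<open>L\<^sup>2\<close> statement to the \<open>L\<^sup>1\<close> one.\<close>

lemma L2_translation:
  fixes b :: "real \<Rightarrow> real"
  assumes b[measurable]: "b \<in> borel_measurable borel" and i: "integrable lborel (\<lambda>x. (b x)\<^sup>2)" and X: "X \<longlonglongrightarrow> 0"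
  shows "(\<lambda>n. LBINT x. (b (X n + x) - b x)\<^sup>2) \<longlonglongrightarrow> 0" and "integrable lborel (\<lambda>x. (b (h + x) - b x)\<^sup>2)"
proof -
  define P where "P = (\<lambda>x. (max 0 (b x))\<^sup>2)"
  define M where "M = (\<lambda>x. (max 0 (- b x))\<^sup>2)"
  have iP: "integrable lborel P" and iM: "integrable lborel M"
    by (rule Bochner_Integration.integrable_bound[OF i]; auto simp: P_def M_def max_def)+
  have sq: "(x - y)\<^sup>2 \<le> \<bar>x\<^sup>2 - y\<^sup>2\<bar>" if "0 \<le> x" "0 \<le> y" for x y :: real
  proof -
    have "(x - y)\<^sup>2 = \<bar>x - y\<bar> * \<bar>x - y\<bar>" by (simp add: power2_eq_square)
    also have "\<dots> \<le> \<bar>x - y\<bar> * (x + y)" using that by (intro mult_left_mono) auto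
    also have "\<dots> = \<bar>x\<^sup>2 - y\<^sup>2\<bar>"
      using that by (simp add: power2_eq_square square_diff_square_factored abs_mult mult.commute)
    finally show ?thesis .
  qed
  have le: "(b y - b x)\<^sup>2 \<le> 2 * \<bar>P y - P x\<bar> + 2 * \<bar>M y - M x\<bar>" for x y
  proof -
    have "b y - b x = (max 0 (b y) - max 0 (b x)) + (max 0 (- b x) - max 0 (- b y))" by (auto simp: max_def)
    then have "(b y - b x)\<^sup>2 \<le> 2 * (max 0 (b y) - max 0 (b x))\<^sup>2 + 2 * (max 0 (- b x) - max 0 (- b y))\<^sup>2"
      using square_add_le by metis
    also have "\<dots> \<le> 2 * \<bar>P y - P x\<bar> + 2 * \<bar>M x - M y\<bar>"
      unfolding P_def M_def by (intro add_mono mult_left_mono sq) auto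
    finally show ?thesis by (simp add: abs_minus_commute)
  qed
  have i2: "integrable lborel (\<lambda>x. 2 * \<bar>P (h + x) - P x\<bar> + 2 * \<bar>M (h + x) - M x\<bar>)" for h
    using iP iM lborel_translate(1)[OF iP, of h] lborel_translate(1)[OF iM, of h] by auto
  show i1: "integrable lborel (\<lambda>x. (b (h + x) - b x)\<^sup>2)" for h
    by (rule Bochner_Integration.integrable_bound[OF i2[of h]]) (auto intro!: order_trans[OF le] abs_ge_self)
  have l: "(\<lambda>n. 2 * (LBINT x. \<bar>P (X n + x) - P x\<bar>) + 2 * (LBINT x. \<bar>M (X n + x) - M x\<bar>)) \<longlonglongrightarrow> 2 * 0 + 2 * 0"
    using L1_translation[OF iP] L1_translation[OF iM] X unfolding L1_translation_continuous_def
    by (intro tendsto_add tendsto_mult_left) blast+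
  show "(\<lambda>n. LBINT x. (b (X n + x) - b x)\<^sup>2) \<longlonglongrightarrow> 0"
  proof (rule tendsto_sandwich[OF _ _ tendsto_const])
    show "(\<lambda>n. 2 * (LBINT x. \<bar>P (X n + x) - P x\<bar>) + 2 * (LBINT x. \<bar>M (X n + x) - M x\<bar>)) \<longlonglongrightarrow> 0" using l by simp
    show "eventually (\<lambda>n. 0 \<le> (LBINT x. (b (X n + x) - b x)\<^sup>2)) sequentially"
      by (intro always_eventually allI Bochner_Integration.integral_nonneg) simp
    have "(LBINT x. (b (h + x) - b x)\<^sup>2) \<le> 2 * (LBINT x. \<bar>P (h + x) - P x\<bar>) + 2 * (LBINT x. \<bar>M (h + x) - M x\<bar>)" for h
    proof -
      have "(LBINT x. (b (h + x) - b x)\<^sup>2) \<le> (LBINT x. 2 * \<bar>P (h + x) - P x\<bar> + 2 * \<bar>M (h + x) - M x\<bar>)"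
        using i1 i2 le by (intro integral_mono) auto
      also have "\<dots> = 2 * (LBINT x. \<bar>P (h + x) - P x\<bar>) + 2 * (LBINT x. \<bar>M (h + x) - M x\<bar>)"
        using iP iM lborel_translate(1)[OF iP, of h] lborel_translate(1)[OF iM, of h] by simp
      finally show ?thesis .
    qed
    then show "eventually (\<lambda>n. (LBINT x. (b (X n + x) - b x)\<^sup>2) \<le>
        2 * (LBINT x. \<bar>P (X n + x) - P x\<bar>) + 2 * (LBINT x. \<bar>M (X n + x) - M x\<bar>)) sequentially" by simp
  qed
qed

section \<open>Mean-square continuity of waves and of Volterra images\<close>

lemma L2_continuousI:
  assumes "\<And>t. 0 \<le> t \<Longrightarrow> L2_01 (w t)"
    and "\<And>t X. 0 \<le> t \<Longrightarrow> (\<And>n. 0 \<le> X n) \<Longrightarrow> X \<longlonglongrightarrow> t \<Longrightarrow> (\<lambda>n. LBINT x:{0..1}. (w (X n) x - w t x)\<^sup>2) \<longlonglongrightarrow> 0"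
  shows "L2_continuous w"
  unfolding L2_continuous_def tendsto_at_iff_sequentially comp_def using assms by auto

text \<open>A travelling wave evolves by translation, so continuity of translations applies once
  \<open>b\<close> is cut to a window that contains all arguments read up to time t + 1. The change
  of variables in x costs the factor 1 / |k|.\<close>

lemma L2_continuous_wave:
  fixes b :: "real \<Rightarrow> real"
  assumes b[measurable]: "b \<in> borel_measurable borel" and i: "\<And>T. set_integrable lborel {a..T} (\<lambda>x. (b x)\<^sup>2)"
    and k: "k \<noteq> 0" and D: "\<And>x. 0 \<le> x \<Longrightarrow> x \<le> 1 \<Longrightarrow> a \<le> d + k * x \<and> d + k * x \<le> M"
    and w: "\<And>t x. 0 \<le> t \<Longrightarrow> 0 \<le> x \<Longrightarrow> x \<le> 1 \<Longrightarrow> w t x = c * b (t + d + k * x)"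
  shows "L2_continuous w"
proof (rule L2_continuousI)
  have ia: "integrable lborel (\<lambda>x. h (e + k * x))" "(LBINT x. h (e + k * x)) = (LBINT x. h x) / \<bar>k\<bar>"
    if "integrable lborel h" for h :: "real \<Rightarrow> real" and e
    using lborel_integrable_real_affine[OF that k, of e] lborel_integral_real_affine[OF k, of h e] k by simp_all
  show "L2_01 (w t)" if t: "0 \<le> t" for t
  proof (rule L2_01_bound)
    have "(\<lambda>x. indicat_real {0..1} x *\<^sub>R w t x) = (\<lambda>x. indicat_real {0..1} x * (c * b (t + d + k * x)))"
      using w[OF t] by (auto simp: fun_eq_iff indicator_def)
    then show "set_borel_measurable borel {0..1} (w t)"
      unfolding set_borel_measurable_def by simp
    have "integrable lborel (\<lambda>x. indicator {a..t + M} (t + d + k * x) * (b (t + d + k * x))\<^sup>2)"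
      using ia(1)[of "\<lambda>x. indicator {a..t + M} x * (b x)\<^sup>2" "t + d"] i[of "t + M"] by (simp add: set_integrable_def)
    then have "set_integrable lborel UNIV (\<lambda>x. c\<^sup>2 * (indicator {a..t + M} (t + d + k * x) * (b (t + d + k * x))\<^sup>2))"
      by (simp add: set_integrable_def)
    then show "set_integrable lborel {0..1} (\<lambda>x. c\<^sup>2 * (indicator {a..t + M} (t + d + k * x) * (b (t + d + k * x))\<^sup>2))"
      by (rule set_integrable_subset) auto
    show "(w t x)\<^sup>2 \<le> c\<^sup>2 * (indicator {a..t + M} (t + d + k * x) * (b (t + d + k * x))\<^sup>2)" if "0 \<le> x" "x \<le> 1" for x
      using D[OF that] t by (simp add: w[OF t that] power_mult_distrib indicator_def)
  qed
  fix t :: real and X :: "nat \<Rightarrow> real"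
  assume t: "0 \<le> t" and X0: "\<And>n. 0 \<le> X n" and X: "X \<longlonglongrightarrow> t"
  define B where "B = (\<lambda>x. indicator {a..t + 1 + M} x * b x)"
  have [measurable]: "B \<in> borel_measurable borel" by (simp add: B_def)
  have "(\<lambda>x. (B x)\<^sup>2) = (\<lambda>x. indicator {a..t + 1 + M} x * (b x)\<^sup>2)"
    by (auto simp: B_def fun_eq_iff indicator_def)
  then have iB: "integrable lborel (\<lambda>x. (B x)\<^sup>2)" using i[of "t + 1 + M"] by (simp add: set_integrable_def)
  have X': "(\<lambda>n. X n - t) \<longlonglongrightarrow> 0" using X by (simp add: LIM_zero)
  note T = L2_translation[OF \<open>B \<in> borel_measurable borel\<close> iB X']
  have wB: "w s x = c * B (s + d + k * x)" if "0 \<le> s" "s \<le> t + 1" "0 \<le> x" "x \<le> 1" for s x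
    using w[OF that(1,3,4)] D[OF that(3,4)] that by (simp add: B_def indicator_def)
  have le: "(LBINT x:{0..1}. (w (X n) x - w t x)\<^sup>2) \<le> c\<^sup>2 * ((LBINT x. (B (X n - t + x) - B x)\<^sup>2) / \<bar>k\<bar>)" if n: "X n \<le> t + 1" for n
  proof -
    let ?g = "\<lambda>x. (B (X n - t + x) - B x)\<^sup>2"
    have "(LBINT x:{0..1}. (w (X n) x - w t x)\<^sup>2) \<le> (LBINT x. c\<^sup>2 * ?g (t + d + k * x))"
      unfolding set_lebesgue_integral_def
    proof (rule order_trans[OF abs_ge_self abs_integral_le])
      show "integrable lborel (\<lambda>x. c\<^sup>2 * ?g (t + d + k * x))"
        by (intro integrable_mult_right ia(1)[OF T(2)])
      fix x
      show "\<bar>indicat_real {0..1} x *\<^sub>R (w (X n) x - w t x)\<^sup>2\<bar> \<le> c\<^sup>2 * ?g (t + d + k * x)"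
      proof (cases "0 \<le> x \<and> x \<le> 1")
        case True
        have "w (X n) x - w t x = c * (B (X n - t + (t + d + k * x)) - B (t + d + k * x))"
          using True wB[OF X0 n] wB[OF t] by (simp add: algebra_simps)
        then have "(w (X n) x - w t x)\<^sup>2 = c\<^sup>2 * ?g (t + d + k * x)" by (simp only: power_mult_distrib)
        then show ?thesis by (simp add: indicator_def)
      qed (auto simp: indicator_def)
    qed
    also have "\<dots> = c\<^sup>2 * (LBINT x. ?g (t + d + k * x))" by (rule integral_mult_right_zero)
    also have "(LBINT x. ?g (t + d + k * x)) = (LBINT x. ?g x) / \<bar>k\<bar>" by (rule ia(2)[OF T(2)])
    finally show ?thesis .
  qed
  have l: "(\<lambda>n. c\<^sup>2 * ((LBINT x. (B (X n - t + x) - B x)\<^sup>2) / \<bar>k\<bar>)) \<longlonglongrightarrow> c\<^sup>2 * (0 / \<bar>k\<bar>)"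
    using k by (intro tendsto_intros T(1)) auto
  show "(\<lambda>n. LBINT x:{0..1}. (w (X n) x - w t x)\<^sup>2) \<longlonglongrightarrow> 0"
  proof (rule tendsto_sandwich[OF _ _ tendsto_const])
    show "(\<lambda>n. c\<^sup>2 * ((LBINT x. (B (X n - t + x) - B x)\<^sup>2) / \<bar>k\<bar>)) \<longlonglongrightarrow> 0" using l by simp
    show "eventually (\<lambda>n. 0 \<le> (LBINT x:{0..1}. (w (X n) x - w t x)\<^sup>2)) sequentially"
      unfolding set_lebesgue_integral_def by (intro always_eventually allI Bochner_Integration.integral_nonneg) auto
    have "eventually (\<lambda>n. X n < t + 1) sequentially" using order_tendstoD(2)[OF X] by simp
    then show "eventually (\<lambda>n. (LBINT x:{0..1}. (w (X n) x - w t x)\<^sup>2) \<le> c\<^sup>2 * ((LBINT x. (B (X n - t + x) - B x)\<^sup>2) / \<bar>k\<bar>)) sequentially"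
      by eventually_elim (rule le, simp)
  qed
qed

lemma L2_continuous_dominated:
  assumes L2: "\<And>t. 0 \<le> t \<Longrightarrow> L2_01 (w t)" and f: "L2_continuous f" and g: "L2_continuous g" and C: "0 \<le> C"
    and le: "\<And>s t. 0 \<le> s \<Longrightarrow> 0 \<le> t \<Longrightarrow> (LBINT x:{0..1}. (w s x - w t x)\<^sup>2) \<le>
       C * ((LBINT x:{0..1}. (f s x - f t x)\<^sup>2) + (LBINT x:{0..1}. (g s x - g t x)\<^sup>2))"
  shows "L2_continuous w"
  unfolding L2_continuous_def
proof (intro conjI allI impI L2)
  fix t :: real assume t: "0 \<le> t"
  have l: "((\<lambda>s. C * ((LBINT x:{0..1}. (f s x - f t x)\<^sup>2) + (LBINT x:{0..1}. (g s x - g t x)\<^sup>2))) \<longlongrightarrow> C * (0 + 0)) (at t within {0..})"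
    using f g t by (intro tendsto_intros) (auto simp: L2_continuous_def)
  show "((\<lambda>s. LBINT x:{0..1}. (w s x - w t x)\<^sup>2) \<longlongrightarrow> 0) (at t within {0..})"
  proof (rule tendsto_sandwich[OF _ _ tendsto_const])
    show "((\<lambda>s. C * ((LBINT x:{0..1}. (f s x - f t x)\<^sup>2) + (LBINT x:{0..1}. (g s x - g t x)\<^sup>2))) \<longlongrightarrow> 0) (at t within {0..})" using l by simp
    show "eventually (\<lambda>s. 0 \<le> (LBINT x:{0..1}. (w s x - w t x)\<^sup>2)) (at t within {0..})"
      unfolding set_lebesgue_integral_def by (intro always_eventually allI Bochner_Integration.integral_nonneg) auto
    show "eventually (\<lambda>s. (LBINT x:{0..1}. (w s x - w t x)\<^sup>2) \<le>
       C * ((LBINT x:{0..1}. (f s x - f t x)\<^sup>2) + (LBINT x:{0..1}. (g s x - g t x)\<^sup>2))) (at t within {0..})"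
      unfolding eventually_at_filter by (intro always_eventually allI impI) (auto intro: le t)
  qed
qed

lemma L2_continuous_add:
  assumes f: "L2_continuous f" and g: "L2_continuous g"
  shows "L2_continuous (\<lambda>t x. f t x + g t x)"
proof (rule L2_continuous_dominated[OF _ f g, of _ 2])
  have L: "L2_01 (f t)" "L2_01 (g t)" if "0 \<le> t" for t using f g that by (auto simp: L2_continuous_def)
  show "L2_01 (\<lambda>x. f t x + g t x)" if "0 \<le> t" for t using L[OF that] by (rule L2_01_add)
  fix s t :: real assume s: "0 \<le> s" and t: "0 \<le> t"
  note d = L2_01_diff[OF L(1)[OF s] L(1)[OF t]] L2_01_diff[OF L(2)[OF s] L(2)[OF t]]
  then have i: "set_integrable lborel {0..1} (\<lambda>x. (f s x - f t x)\<^sup>2)" "set_integrable lborel {0..1} (\<lambda>x. (g s x - g t x)\<^sup>2)"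
    by (auto simp: L2_01_def)
  have "(LBINT x:{0..1}. (f s x + g s x - (f t x + g t x))\<^sup>2) \<le> (LBINT x:{0..1}. 2 * (f s x - f t x)\<^sup>2 + 2 * (g s x - g t x)\<^sup>2)"
  proof (rule order_trans[OF abs_ge_self abs_set_integral_le])
    show "set_integrable lborel {0..1} (\<lambda>x. 2 * (f s x - f t x)\<^sup>2 + 2 * (g s x - g t x)\<^sup>2)"
      using i by (intro set_integral_add set_integrable_mult_right) auto
    show "\<bar>(f s x + g s x - (f t x + g t x))\<^sup>2\<bar> \<le> 2 * (f s x - f t x)\<^sup>2 + 2 * (g s x - g t x)\<^sup>2" for x
      using square_add_le[of "f s x - f t x" "g s x - g t x"] by (simp add: algebra_simps)
  qed
  also have "\<dots> = 2 * ((LBINT x:{0..1}. (f s x - f t x)\<^sup>2) + (LBINT x:{0..1}. (g s x - g t x)\<^sup>2))"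
    using i by (subst set_integral_add) auto
  finally show "(LBINT x:{0..1}. (f s x + g s x - (f t x + g t x))\<^sup>2) \<le> 2 * ((LBINT x:{0..1}. (f s x - f t x)\<^sup>2) + (LBINT x:{0..1}. (g s x - g t x)\<^sup>2))" .
qed simp

text \<open>Cauchy-Schwarz on an interval of length 1, from the nonnegativity of the variance of
  |f|.\<close>

lemma L1_le_L2:
  assumes "L2_01 f"
  shows "(LBINT x:{0..1}. \<bar>f x\<bar>)\<^sup>2 \<le> (LBINT x:{0..1}. (f x)\<^sup>2)"
proof -
  define m where "m = (LBINT x:{0..1}. \<bar>f x\<bar>)"
  have sq: "set_integrable lborel {0..1} (\<lambda>x. (f x)\<^sup>2)" using assms by (simp add: L2_01_def)
  note a = set_integrable_abs[OF L2_01_integrable(1)[OF assms]]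
  note c = set_integrable_const_01[of "m\<^sup>2"]
  note ma = set_integrable_mult_right[of "2 * m", OF a]
  have "0 \<le> (LBINT x:{0..1}. (\<bar>f x\<bar> - m)\<^sup>2)"
    unfolding set_lebesgue_integral_def by (rule Bochner_Integration.integral_nonneg) auto
  also have "\<dots> = (LBINT x:{0..1}. (f x)\<^sup>2 - 2 * m * \<bar>f x\<bar> + m\<^sup>2)"
    by (rule set_lebesgue_integral_cong) (auto simp: power2_diff)
  also have "\<dots> = (LBINT x:{0..1}. (f x)\<^sup>2) - 2 * m * m + (LBINT x:{0..1::real}. m\<^sup>2)"
    unfolding set_integral_add(2)[OF set_integral_diff(1)[OF sq ma] c] set_integral_diff(2)[OF sq ma]
    by (simp add: m_def)
  also have "(LBINT x:{0..1::real}. m\<^sup>2) = m\<^sup>2" by (simp add: set_lebesgue_integral_def)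
  finally show ?thesis by (simp add: m_def power2_eq_square)
qed

lemma volterra_L2:
  assumes K: "bounded_borel2 K" "bounded_borel2 L" and f: "L2_01 f" and g: "L2_01 g"
  shows "L2_01 (volterra K L f g)"
proof -
  obtain C where C: "0 \<le> C" "\<And>x \<xi>. \<bar>K x \<xi>\<bar> \<le> C" "\<And>x \<xi>. \<bar>L x \<xi>\<bar> \<le> C"
    using bounded_borel2_common[OF K] by metis
  have m: "ext1 h \<in> borel_measurable borel" if "L2_01 h" for h
  proof -
    have "(\<lambda>x. indicator {0..1} x * h x) = ext1 h" by (auto simp: fun_eq_iff ext1_def indicator_def)
    then show ?thesis using L2_01_measurable[OF that] by simp
  qed
  have mm: "case_prod (\<lambda>t :: real. ext1 h) \<in> borel_measurable borel" if "L2_01 h" for h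
    unfolding case_prod_beta' using measurable_compose[OF borel_measurable_fst_snd(2) m[OF that]] by simp
  have "(\<lambda>x. volterra K L (ext1 f) (ext1 g) x) \<in> borel_measurable borel"
    by (rule borel_measurable_curried[OF volterra_measurable[OF K mm[OF f] mm[OF g]], of "\<lambda>_. 0" borel "\<lambda>x. x"]) simp_all
  then have b: "(\<lambda>x. indicat_real {0..1} x * volterra K L (ext1 f) (ext1 g) x) \<in> borel_measurable borel" by simp
  have "(\<lambda>x. indicat_real {0..1} x * volterra K L (ext1 f) (ext1 g) x) = (\<lambda>x. indicat_real {0..1} x *\<^sub>R volterra K L f g x)"
  proof
    fix x
    show "indicat_real {0..1} x * volterra K L (ext1 f) (ext1 g) x = indicat_real {0..1} x *\<^sub>R volterra K L f g x"
    proof (cases "0 \<le> x \<and> x \<le> 1")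
      case True
      have "volterra K L (ext1 f) (ext1 g) x = volterra K L f g x"
        by (rule volterra_cong) (use True in \<open>auto simp: ext1_def\<close>)
      then show ?thesis by simp
    qed (simp add: indicator_def)
  qed
  with b have "set_borel_measurable borel {0..1} (volterra K L f g)" by (simp add: set_borel_measurable_def)
  then show ?thesis
    by (rule L2_01_bounded) (rule volterra_bound[of K C L, OF C(2,3) L2_01_integrable(1)[OF f] L2_01_integrable(1)[OF g]])
qed

text \<open>The difference of two images is bounded pointwise by the \<open>L1\<close> norms of the
  differences of the data, hence by their mean-square norms.\<close>

lemma L2_continuous_volterra:
  assumes K: "bounded_borel2 K" "bounded_borel2 L" and f: "L2_continuous f" and g: "L2_continuous g"
  shows "L2_continuous (\<lambda>t. volterra K L (f t) (g t))"
proof -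
  obtain C where C: "0 \<le> C" "\<And>x \<xi>. \<bar>K x \<xi>\<bar> \<le> C" "\<And>x \<xi>. \<bar>L x \<xi>\<bar> \<le> C"
    using bounded_borel2_common[OF K] by metis
  have L: "L2_01 (f t)" "L2_01 (g t)" if "0 \<le> t" for t using f g that by (auto simp: L2_continuous_def)
  show ?thesis
  proof (rule L2_continuous_dominated[OF _ f g, of _ "2 * C\<^sup>2"])
    show "L2_01 (volterra K L (f t) (g t))" if "0 \<le> t" for t by (rule volterra_L2[OF K L[OF that]])
    fix s t :: real assume s: "0 \<le> s" and t: "0 \<le> t"
    note d = L2_01_diff[OF L(1)[OF s] L(1)[OF t]] L2_01_diff[OF L(2)[OF s] L(2)[OF t]]
    note i = L2_01_integrable(1)[OF L(1)[OF s]] L2_01_integrable(1)[OF L(2)[OF s]]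
      L2_01_integrable(1)[OF L(1)[OF t]] L2_01_integrable(1)[OF L(2)[OF t]]
    define m where "m = (LBINT x:{0..1}. \<bar>f s x - f t x\<bar>)"
    define n where "n = (LBINT x:{0..1}. \<bar>g s x - g t x\<bar>)"
    have b: "\<bar>volterra K L (f s) (g s) x - volterra K L (f t) (g t) x\<bar> \<le> C * (m + n)" if "x \<le> 1" for x
      using volterra_bound[of K C L, OF C(2,3) L2_01_integrable(1)[OF d(1)] L2_01_integrable(1)[OF d(2)] that]
      unfolding volterra_diff[OF K that i] m_def n_def .
    have "(LBINT x:{0..1}. (volterra K L (f s) (g s) x - volterra K L (f t) (g t) x)\<^sup>2) \<le> (LBINT x:{0..1::real}. (C * (m + n))\<^sup>2)"
    proof (rule order_trans[OF abs_ge_self abs_set_integral_le[OF set_integrable_const_01]])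
      show "\<bar>(volterra K L (f s) (g s) x - volterra K L (f t) (g t) x)\<^sup>2\<bar> \<le> (C * (m + n))\<^sup>2" if "x \<in> {0..1}" for x
        using power_mono[OF b[of x], of 2] that by simp
    qed
    also have "\<dots> = C\<^sup>2 * (m + n)\<^sup>2" by (simp add: set_lebesgue_integral_def power_mult_distrib)
    also have "\<dots> \<le> C\<^sup>2 * (2 * m\<^sup>2 + 2 * n\<^sup>2)" by (intro mult_left_mono square_add_le) simp
    also have "\<dots> \<le> C\<^sup>2 * (2 * (LBINT x:{0..1}. (f s x - f t x)\<^sup>2) + 2 * (LBINT x:{0..1}. (g s x - g t x)\<^sup>2))"
      using L1_le_L2[OF d(1)] L1_le_L2[OF d(2)] unfolding m_def n_def by (intro mult_left_mono add_mono) auto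
    finally show "(LBINT x:{0..1}. (volterra K L (f s) (g s) x - volterra K L (f t) (g t) x)\<^sup>2) \<le>
       2 * C\<^sup>2 * ((LBINT x:{0..1}. (f s x - f t x)\<^sup>2) + (LBINT x:{0..1}. (g s x - g t x)\<^sup>2))"
      by (simp add: algebra_simps)
  qed (use C in simp)
qed

section \<open>Equivalence with the neutral equation\<close>

lemma volterra_L2_triangle:
  assumes "Linf_triangle A" "Linf_triangle B" "L2_01 f" "L2_01 g"
  shows "L2_01 (volterra A B f g)"
  using volterra_L2[OF Linf_triangle_ext2[OF assms(1)] Linf_triangle_ext2[OF assms(2)] assms(3,4)]
  by (rule L2_01_cong[THEN iffD1, rotated]) (rule volterra_ext2)

section \<open>Square integrability of the boundary history\<close>

definition L2_on :: "real set \<Rightarrow> (real \<Rightarrow> real) \<Rightarrow> bool" where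
  "L2_on S h \<longleftrightarrow> S \<in> sets borel \<and> set_borel_measurable borel S h \<and> set_integrable lborel S (\<lambda>x. (h x)\<^sup>2)"

lemma L2_on_Un:
  assumes "L2_on S h" "L2_on S' h"
  shows "L2_on (S \<union> S') h"
proof -
  have [measurable]: "S \<in> sets borel" "S' \<in> sets borel"
    and m: "(\<lambda>x. indicator S x * h x) \<in> borel_measurable borel" "(\<lambda>x. indicator S' x * h x) \<in> borel_measurable borel"
    using assms by (auto simp: L2_on_def set_borel_measurable_def)
  have "(\<lambda>x. indicator S x * h x + indicator (- S) x * (indicator S' x * h x)) \<in> borel_measurable borel"
    by (intro borel_measurable_add borel_measurable_times[OF _ m(2)] m(1)) auto
  also have "(\<lambda>x. indicator S x * h x + indicator (- S) x * (indicator S' x * h x)) = (\<lambda>x. indicator (S \<union> S') x * h x)"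
    by (auto simp: fun_eq_iff indicator_def)
  finally show ?thesis
    using assms by (auto simp: L2_on_def set_borel_measurable_def intro: set_integrable_Un)
qed

lemma L2_on_subset:
  assumes "L2_on S h" "S' \<subseteq> S" "S' \<in> sets borel"
  shows "L2_on S' h"
proof -
  have "(\<lambda>x. indicator S x * h x) \<in> borel_measurable borel"
    using assms by (simp add: L2_on_def set_borel_measurable_def)
  then have "(\<lambda>x. indicator S' x * (indicator S x * h x)) \<in> borel_measurable borel"
    by (rule borel_measurable_times[rotated]) (use assms(3) in simp)
  also have "(\<lambda>x. indicator S' x * (indicator S x * h x)) = (\<lambda>x. indicator S' x * h x)"
    using assms(2) by (auto simp: fun_eq_iff indicator_def)
  finally show ?thesis
    using assms by (auto simp: L2_on_def set_borel_measurable_def intro: set_integrable_subset)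
qed

text \<open>On \<open>A\<close> the function \<open>h\<close> is a rescaled copy of a piece of
  \<open>f\<close>; the boundary history is assembled from such copies.\<close>

lemma L2_on_affine:
  assumes f: "L2_01 f" and k: "k \<noteq> 0" and A: "A \<in> sets borel"
    and h: "\<And>r. r \<in> A \<Longrightarrow> 0 \<le> d + k * r \<and> d + k * r \<le> 1 \<and> h r = c * f (d + k * r)"
  shows "L2_on A h"
proof -
  note [measurable] = A L2_01_measurable[OF f]
  have "(\<lambda>r. indicator A r * (c * (indicator {0..1} (d + k * r) * f (d + k * r)))) \<in> borel_measurable borel"
    by (intro borel_measurable_times[OF _ borel_measurable_times[OF borel_measurable_const
          measurable_compose[OF _ L2_01_measurable[OF f]]]]) simp_all
  also have "(\<lambda>r. indicator A r * (c * (indicator {0..1} (d + k * r) * f (d + k * r)))) = (\<lambda>r. indicator A r * h r)"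
    using h by (auto simp: fun_eq_iff indicator_def)
  finally have m: "set_borel_measurable borel A h" by (simp add: set_borel_measurable_def)
  have "integrable lborel (\<lambda>r. c\<^sup>2 * (indicator {0..1} (d + k * r) * (f (d + k * r))\<^sup>2))"
    using set_integral_affine(1)[OF k, of "{0..1}" "\<lambda>x. (f x)\<^sup>2" d] f by (simp add: L2_01_def)
  from integrable_mult_indicator[OF _ this, of A]
  have "integrable lborel (\<lambda>r. indicator A r * (c\<^sup>2 * (indicator {0..1} (d + k * r) * (f (d + k * r))\<^sup>2)))"
    by simp
  also have "(\<lambda>r. indicator A r * (c\<^sup>2 * (indicator {0..1} (d + k * r) * (f (d + k * r))\<^sup>2))) = (\<lambda>r. indicator A r *\<^sub>R (h r)\<^sup>2)"
    using h by (auto simp: fun_eq_iff indicator_def power_mult_distrib)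
  finally show ?thesis using A m by (simp add: L2_on_def set_integrable_def)
qed

text \<open>Each value \<open>\<beta>(n/\<mu>, \<cdot>)\<close> is a copy of the history over a window of length \<open>1/\<mu>\<close>, so no regularity of
  the trace \<open>\<beta>(\<cdot>, 1)\<close> itself has to be known beforehand.\<close>

lemma boundary_history_L2:
  assumes pos: "lam > 0" "\<mu> > 0" and q: "q \<noteq> 0" and \<tau>: "\<tau> = 1 / lam + 1 / \<mu>"
    and A: "transport_eq half_strip 1 lam A (\<lambda>t x. 0)" and B: "transport_eq half_strip 1 (- \<mu>) B (\<lambda>t x. 0)"
    and bc: "\<And>t. t > 0 \<Longrightarrow> A t 0 = q * B t 0"
    and L: "L2_01 (A 0)" "\<And>t. 0 \<le> t \<Longrightarrow> L2_01 (B t)"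
  shows "L2_on {- \<tau>..T} (boundary_history lam \<mu> q A B)"
proof -
  let ?H = "boundary_history lam \<mu> q A B"
  \<comment> \<open>Stage 0 ends at time - 1 / \<mu> and is the part of the history read off from
    \<open>A\<close>; each further stage adds one crossing time.\<close>
  have n: "L2_on {- \<tau>..(real n - 1) / \<mu>} ?H" for n
  proof (induction n)
    case 0
    show ?case
    proof (rule L2_on_affine[OF L(1), of "- lam" _ "- lam / \<mu>" _ "1 / q"])
      fix r assume "r \<in> {- \<tau>..(real 0 - 1) / \<mu>}"
      then have r: "- \<tau> \<le> r" "r \<le> - (1 / \<mu>)" by (simp_all add: \<tau>)
      define x where "x = - lam / \<mu> + - lam * r"
      have e: "x = lam * (- (1 / \<mu>) - r)" by (simp add: x_def algebra_simps)
      have "0 \<le> x" unfolding e using r pos by simp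
      moreover have "x \<le> 1"
      proof -
        have "x \<le> lam * (1 / lam)" unfolding e using r pos by (intro mult_left_mono) (auto simp: \<tau>)
        then show ?thesis using pos by simp
      qed
      moreover have "0 - x / lam - 1 / \<mu> = r" unfolding e using pos by simp
      ultimately have "0 \<le> x \<and> x \<le> 1 \<and> ?H r = 1 / q * A 0 x"
        using boundary_history_repr(2)[OF pos q A B bc, of x 0] q by simp
      then show "0 \<le> - lam / \<mu> + - lam * r \<and> - lam / \<mu> + - lam * r \<le> 1 \<and> ?H r = 1 / q * A 0 (- lam / \<mu> + - lam * r)"
        unfolding x_def .
    qed (use pos in auto)
  next
    case (Suc n)
    \<comment> \<open>Open on the left: the left end corresponds to x = 0, which for n = 0 is the
      corner where the representation of \<open>B\<close> fails.\<close>
    have "L2_on {(real n - 1) / \<mu><..(real (Suc n) - 1) / \<mu>} ?H"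
    proof (rule L2_on_affine[OF L(2), of "real n / \<mu>" \<mu> _ "1 - real n" _ 1])
      fix r assume "r \<in> {(real n - 1) / \<mu><..(real (Suc n) - 1) / \<mu>}"
      then have r: "(real n - 1) / \<mu> < r" "r \<le> real n / \<mu>" by simp_all
      define x where "x = 1 - real n + \<mu> * r"
      have x: "0 < x" "x \<le> 1" using r pos by (simp_all add: x_def field_simps)
      have e: "real n / \<mu> - (1 - x) / \<mu> = r" using pos by (simp add: x_def field_simps)
      have "0 \<le> x \<and> x \<le> 1 \<and> ?H r = 1 * B (real n / \<mu>) x"
        using boundary_history_repr(1)[OF pos q A B bc, of x "real n / \<mu>"] x pos by (simp add: e)
      then show "0 \<le> 1 - real n + \<mu> * r \<and> 1 - real n + \<mu> * r \<le> 1 \<and> ?H r = 1 * B (real n / \<mu>) (1 - real n + \<mu> * r)"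
        unfolding x_def .
    qed (use pos in auto)
    moreover have "{- \<tau>..(real n - 1) / \<mu>} \<union> {(real n - 1) / \<mu><..(real (Suc n) - 1) / \<mu>} = {- \<tau>..(real (Suc n) - 1) / \<mu>}"
    proof -
      have "- \<tau> \<le> - (1 / \<mu>)" using pos by (simp add: \<tau>)
      also have "- (1 / \<mu>) \<le> (real n - 1) / \<mu>" using pos by (simp add: diff_divide_distrib)
      finally have "- \<tau> \<le> (real n - 1) / \<mu>" .
      moreover have "(real n - 1) / \<mu> \<le> (real (Suc n) - 1) / \<mu>" using pos by (intro divide_right_mono) auto
      ultimately show ?thesis by auto
    qed
    ultimately show ?case using L2_on_Un[OF Suc] by metis
  qed
  obtain n :: nat where "\<mu> * T + 1 \<le> real n" using real_arch_simple by blast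
  then have "T \<le> (real n - 1) / \<mu>" using pos by (simp add: field_simps)
  then show ?thesis by (intro L2_on_subset[OF n[of n]]) auto
qed

lemma solution_delay_representation:
  assumes pos: "lam > 0" "\<mu> > 0" and q: "q \<noteq> 0" and \<tau>: "\<tau> = 1 / lam + 1 / \<mu>"
    and S: "Linf_01 spm" "Linf_01 smp"
    and bk: "backstepping_kernels lam \<mu> q spm smp Kuu Kuv Kvu Kvv"
    and inv: "inverse_kernels Kuu Kuv Kvu Kvv Laa Lab Lba Lbb"
    and sol: "hyperbolic_solution lam \<mu> q \<rho> spm smp U u0 v0 u v"
  defines "\<alpha> \<equiv> \<lambda>t x. u t x - volterra Kuu Kuv (u t) (v t) x" and "\<beta> \<equiv> \<lambda>t x. v t x - volterra Kvu Kvv (u t) (v t) x"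
  defines "H \<equiv> boundary_history lam \<mu> q \<alpha> \<beta>" and "N \<equiv> N_tilde lam \<mu> q \<rho> Laa Lab Lba Lbb"
  shows "t > 0 \<Longrightarrow> x \<in> {0..1} \<Longrightarrow> \<alpha> t x = q * H (t - x / lam - 1 / \<mu>) \<and> \<beta> t x = H (t - (1 - x) / \<mu>)"
    and "t > 0 \<Longrightarrow> set_integrable lborel {0..\<tau>} (\<lambda>\<nu>. N \<nu> * H (t - \<nu>)) \<and>
       H t = q * \<rho> * H (t - \<tau>) + U t - (LBINT \<nu>:{0..\<tau>}. N \<nu> * H (t - \<nu>))"
    and "L2_on {- \<tau>..T} H"
    and "t > 0 \<Longrightarrow> x \<in> {0..1} \<Longrightarrow> u t x = \<alpha> t x + volterra Laa Lab (\<alpha> t) (\<beta> t) x \<and> v t x = \<beta> t x + volterra Lba Lbb (\<alpha> t) (\<beta> t) x"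
proof -
  have A: "transport_eq half_strip 1 lam \<alpha> (\<lambda>t x. 0)" and B: "transport_eq half_strip 1 (- \<mu>) \<beta> (\<lambda>t x. 0)"
    using target_transport[OF pos q S bk sol] by (simp_all add: \<alpha>_def \<beta>_def)
  have Luv: "L2_01 (u t)" "L2_01 (v t)" if "0 \<le> t" for t
    using sol that by (auto simp: hyperbolic_solution_def L2_continuous_def)
  have K: "Linf_triangle Kuu" "Linf_triangle Kuv" "Linf_triangle Kvu" "Linf_triangle Kvv"
    using bk by (auto simp: backstepping_kernels_def)
  have L: "Linf_triangle Laa" "Linf_triangle Lab" "Linf_triangle Lba" "Linf_triangle Lbb"
    using inv by (auto simp: inverse_kernels_def)
  have La: "L2_01 (\<alpha> t)" and Lb: "L2_01 (\<beta> t)" if "0 \<le> t" for t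
    unfolding \<alpha>_def \<beta>_def
    by (rule L2_01_diff volterra_L2_triangle K Luv that)+
  have bc: "\<alpha> t 0 = q * \<beta> t 0" if "0 < t" for t
    using sol that by (simp add: \<alpha>_def \<beta>_def volterra_at_0 hyperbolic_solution_def)
  have R: "\<beta> t x = H (t - (1 - x) / \<mu>)" "\<alpha> t x = q * H (t - x / lam - 1 / \<mu>)" if "0 < t" "0 \<le> x" "x \<le> 1" for t x
    using boundary_history_repr[OF pos q A B bc, of x t] that by (simp_all add: H_def)
  show "\<alpha> t x = q * H (t - x / lam - 1 / \<mu>) \<and> \<beta> t x = H (t - (1 - x) / \<mu>)" if "t > 0" "x \<in> {0..1}"
    using R that by simp
  show I: "u t x = \<alpha> t x + volterra Laa Lab (\<alpha> t) (\<beta> t) x \<and> v t x = \<beta> t x + volterra Lba Lbb (\<alpha> t) (\<beta> t) x"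
    if t: "t > 0" and x: "x \<in> {0..1}" for t x
  proof -
    have "L2_01 (u t) \<and> L2_01 (v t)" using Luv t by simp
    then show ?thesis
      using inv x unfolding inverse_kernels_def Let_def \<alpha>_def \<beta>_def by blast
  qed
  show "L2_on {- \<tau>..T} H"
    unfolding H_def by (rule boundary_history_L2[OF pos q \<tau> A B bc La Lb]) simp_all
  show "set_integrable lborel {0..\<tau>} (\<lambda>\<nu>. N \<nu> * H (t - \<nu>)) \<and>
       H t = q * \<rho> * H (t - \<tau>) + U t - (LBINT \<nu>:{0..\<tau>}. N \<nu> * H (t - \<nu>))" if t: "t > 0"
  proof -
    have t0: "0 \<le> t" using t by simp
    note D = distributed_delay_integral[OF pos \<tau> L L2_01_integrable(1)[OF La[OF t0]] L2_01_integrable(1)[OF Lb[OF t0]] R(2)[OF t] R(1)[OF t], of \<rho>, folded N_def]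
    \<comment> \<open>The inverse formulas at x = 1 are inserted here; outside the integrals there
      remain \<beta>(t, 1) = H t on the left and \<rho> \<alpha>(t, 1) = q \<rho> H (t - \<tau>) on
      the right.\<close>
    have "v t 1 = \<rho> * u t 1 + U t" using sol t by (simp add: hyperbolic_solution_def)
    moreover have "\<alpha> t 1 = q * H (t - \<tau>)" "\<beta> t 1 = H t" using R[OF t, of 1] by (simp_all add: \<tau> algebra_simps)
    ultimately show ?thesis using I[OF t, of 1] D by (simp add: algebra_simps)
  qed
qed

text \<open>\<open>H\<close> is controlled on bounded windows and agrees with \<open>B\<close> from
  -\<tau> on; measurability on the half-line is that of a pointwise limit of truncations.\<close>

lemma solution_neutral:
  assumes \<tau>: "0 \<le> \<tau>" and L: "\<And>T. L2_on {- \<tau>..T} H"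
    and eq: "\<And>t. t > 0 \<Longrightarrow> set_integrable lborel {0..\<tau>} (\<lambda>\<nu>. N \<nu> * H (t - \<nu>)) \<and>
       H t = q * \<rho> * H (t - \<tau>) + U t - (LBINT \<nu>:{0..\<tau>}. N \<nu> * H (t - \<nu>))"
    and B: "\<And>t. t \<ge> - \<tau> \<Longrightarrow> H t = B t"
  shows "neutral_solution q \<rho> \<tau> N U B"
  unfolding neutral_solution_def
proof (intro conjI allI impI)
  have "(\<lambda>x. indicator {- \<tau>..} x * B x) \<in> borel_measurable borel"
  proof (rule borel_measurable_LIMSEQ_real)
    show "(\<lambda>x. indicator {- \<tau>..real n} x * H x) \<in> borel_measurable borel" for n
      using L[of "real n"] by (simp add: L2_on_def set_borel_measurable_def)
    show "(\<lambda>n. indicator {- \<tau>..real n} x * H x) \<longlonglongrightarrow> indicator {- \<tau>..} x * B x" for x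
    proof (rule tendsto_eventually)
      obtain m :: nat where m: "x \<le> real m" using real_arch_simple by blast
      show "eventually (\<lambda>n. indicator {- \<tau>..real n} x * H x = indicator {- \<tau>..} x * B x) sequentially"
        using eventually_ge_at_top[of m] by eventually_elim (use m B[of x] in \<open>auto simp: indicator_def\<close>)
    qed
  qed
  then show "set_borel_measurable borel {- \<tau>..} B" by (simp add: set_borel_measurable_def)
  show "set_integrable lborel {- \<tau>..T} (\<lambda>t. (B t)\<^sup>2)" for T
  proof -
    have "set_integrable lborel {- \<tau>..T} (\<lambda>t. (H t)\<^sup>2)" using L[of T] by (simp add: L2_on_def)
    then show ?thesis by (rule set_integrable_cong[THEN iffD1, rotated 3]) (auto simp: B)
  qed
  fix t :: real assume t: "0 < t"
  have e: "H (t - \<nu>) = B (t - \<nu>)" if "\<nu> \<in> {0..\<tau>}" for \<nu> using that t by (intro B) auto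
  show "set_integrable lborel {0..\<tau>} (\<lambda>\<nu>. N \<nu> * B (t - \<nu>))"
    using eq[OF t, THEN conjunct1] by (rule set_integrable_cong[THEN iffD1, rotated 3]) (auto simp: e)
  have "(LBINT \<nu>:{0..\<tau>}. N \<nu> * H (t - \<nu>)) = (LBINT \<nu>:{0..\<tau>}. N \<nu> * B (t - \<nu>))"
    by (rule set_lebesgue_integral_cong) (auto simp: e)
  then show "B t = q * \<rho> * B (t - \<tau>) + U t - (LBINT \<nu>:{0..\<tau>}. N \<nu> * B (t - \<nu>))"
    using eq[OF t] e[of \<tau>] B[of t] t \<tau> by simp
qed

section \<open>Realisation of neutral solutions\<close>

lemma half_strip_borel: "half_strip \<in> sets borel"
proof -
  have "closed half_strip" unfolding half_strip_def case_prod_beta'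
    by (intro closed_Collect_conj closed_Collect_le continuous_intros)
  then show ?thesis by (rule borel_closed)
qed

lemma set_borel_measurable_half_strip:
  fixes w :: "real \<Rightarrow> real \<Rightarrow> real"
  shows "case_prod w \<in> borel_measurable borel \<Longrightarrow> set_borel_measurable borel half_strip (case_prod w)"
  unfolding set_borel_measurable_def real_scaleR_def
  by (intro borel_measurable_times borel_measurable_indicator half_strip_borel)

text \<open>Both waves are copies of one function \<open>b\<close> of a single variable. Along a
  transversal characteristic the argument of \<open>b\<close> advances at the positive rate 1 + lam
  / \<mu> or 1 + \<mu> / lam, so integrability along it is an affine change of variables.\<close>

lemma wave_target_pair:
  fixes q :: real
  assumes pos: "lam > 0" "\<mu> > 0" and \<tau>: "\<tau> = 1 / lam + 1 / \<mu>"
    and b: "b \<in> borel_measurable borel" and sq: "\<And>T. set_integrable lborel {- \<tau>..T} (\<lambda>x. (b x)\<^sup>2)"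
  defines "\<alpha> \<equiv> ext2 half_strip (\<lambda>t x. q * b (t - x / lam - 1 / \<mu>))"
    and "\<beta> \<equiv> ext2 half_strip (\<lambda>t x. b (t - (1 - x) / \<mu>))"
  shows "target_pair lam \<mu> q \<alpha> \<beta>" and "L2_continuous \<alpha>" and "L2_continuous \<beta>"
proof -
  have val: "\<alpha> t x = q * b (t - x / lam - 1 / \<mu>)" "\<beta> t x = b (t - (1 - x) / \<mu>)" if "0 \<le> t" "0 \<le> x" "x \<le> 1" for t x
    using that by (simp_all add: \<alpha>_def \<beta>_def ext2_def half_strip_def)
  have \<tau>0: "0 < 1 / lam" "0 < 1 / \<mu>" using pos by simp_all
  have xl: "0 \<le> x / lam" "x / lam \<le> 1 / lam" "0 \<le> x / \<mu>" "x / \<mu> \<le> 1 / \<mu>" if "0 \<le> x" "x \<le> 1" for x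
    using that pos by (simp_all add: divide_right_mono)
  show La: "L2_continuous \<alpha>"
  proof (rule L2_continuous_wave[OF b sq, of "- 1 / lam" "- 1 / \<mu>" 0 _ q])
    show "- \<tau> \<le> - 1 / \<mu> + - 1 / lam * x \<and> - 1 / \<mu> + - 1 / lam * x \<le> 0" if "0 \<le> x" "x \<le> 1" for x
      using xl[OF that] \<tau>0 by (simp add: \<tau>)
  qed (use pos in \<open>simp_all add: val algebra_simps\<close>)
  show Lb: "L2_continuous \<beta>"
  proof (rule L2_continuous_wave[OF b sq, of "1 / \<mu>" "- 1 / \<mu>" 0 _ 1])
    show "- \<tau> \<le> - 1 / \<mu> + 1 / \<mu> * x \<and> - 1 / \<mu> + 1 / \<mu> * x \<le> 0" if "0 \<le> x" "x \<le> 1" for x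
      using xl[OF that] \<tau>0 by (simp add: \<tau>)
  qed (use pos in \<open>simp_all add: val diff_divide_distrib algebra_simps\<close>)
  have mb: "(\<lambda>p. b (c p)) \<in> borel_measurable borel" if "c \<in> borel_measurable borel" for c :: "real \<times> real \<Rightarrow> real"
    using measurable_compose[OF that b] .
  have ma: "case_prod (\<lambda>t x. q * b (t - x / lam - 1 / \<mu>)) \<in> borel_measurable borel"
    "case_prod (\<lambda>t x. b (t - (1 - x) / \<mu>)) \<in> borel_measurable borel"
    unfolding case_prod_beta' by (intro borel_measurable_times borel_measurable_const mb; simp)+
  have ee: "ext2 half_strip \<alpha> = \<alpha>" "ext2 half_strip \<beta> = \<beta>" by (auto simp: fun_eq_iff \<alpha>_def \<beta>_def ext2_def)
  have m\<alpha>: "case_prod \<alpha> \<in> borel_measurable borel" and m\<beta>: "case_prod \<beta> \<in> borel_measurable borel"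
    unfolding \<alpha>_def \<beta>_def by (intro ext2_measurable set_borel_measurable_half_strip ma)+
  have ta: "tame \<alpha>" "tame \<beta>"
    using L2_continuous_tame[OF set_borel_measurable_half_strip[OF m\<alpha>] La]
      L2_continuous_tame[OF set_borel_measurable_half_strip[OF m\<beta>] Lb] by (simp_all add: ee)
  have T1: "transport_eq half_strip 1 lam \<alpha> (\<lambda>t x. 0)"
  proof (rule transport_eqI)
    fix y z s :: real
    assume s: "0 \<le> s" and D: "\<And>r. 0 \<le> r \<Longrightarrow> r \<le> s \<Longrightarrow> (y + 1 * r, z + lam * r) \<in> half_strip"
    have "y + s - (z + lam * s) / lam = y - z / lam" using pos by (simp add: field_simps)
    moreover have "\<alpha> (y + 1 * s) (z + lam * s) = q * b (y + s - (z + lam * s) / lam - 1 / \<mu>)" "\<alpha> y z = q * b (y - z / lam - 1 / \<mu>)"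
      using D[of s] D[of 0] s val[of "y + s" "z + lam * s"] val[of y z] by (auto simp: half_strip_def)
    ultimately have "\<alpha> (y + 1 * s) (z + lam * s) = \<alpha> y z" by (simp only:)
    then show "set_integrable lborel {0..s} (\<lambda>r. 0 :: real) \<and> \<alpha> (y + 1 * s) (z + lam * s) - \<alpha> y z = (LBINT r:{0..s}. 0)"
      by (simp add: set_integrable_def)
  qed
  have T2: "transport_eq half_strip 1 (- \<mu>) \<beta> (\<lambda>t x. 0)"
  proof (rule transport_eqI)
    fix y z s :: real
    assume s: "0 \<le> s" and D: "\<And>r. 0 \<le> r \<Longrightarrow> r \<le> s \<Longrightarrow> (y + 1 * r, z + - \<mu> * r) \<in> half_strip"
    have "y + s - (1 - (z + - \<mu> * s)) / \<mu> = y - (1 - z) / \<mu>" using pos by (simp add: field_simps)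
    moreover have "\<beta> (y + 1 * s) (z + - \<mu> * s) = b (y + s - (1 - (z + - \<mu> * s)) / \<mu>)" "\<beta> y z = b (y - (1 - z) / \<mu>)"
      using D[of s] D[of 0] s val[of "y + s" "z + - \<mu> * s"] val[of y z] by (auto simp: half_strip_def)
    ultimately have "\<beta> (y + 1 * s) (z + - \<mu> * s) = \<beta> y z" by (simp only:)
    then show "set_integrable lborel {0..s} (\<lambda>r. 0 :: real) \<and> \<beta> (y + 1 * s) (z + - \<mu> * s) - \<beta> y z = (LBINT r:{0..s}. 0)"
      by (simp add: set_integrable_def)
  qed
  have L1: "set_integrable lborel {- \<tau>..T} b" for T
  proof (rule set_integrable_bound)
    show "set_integrable lborel {- \<tau>..T} (\<lambda>x. 1 + (b x)\<^sup>2)"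
      by (intro set_integral_add sq borel_integrable_atLeastAtMost' continuous_intros)
    show "set_borel_measurable lborel {- \<tau>..T} b" using b by (simp add: set_borel_measurable_def)
    have "\<bar>y\<bar> \<le> \<bar>1 + y\<^sup>2\<bar>" for y :: real
    proof -
      have "0 \<le> (1 - \<bar>y\<bar>)\<^sup>2" by simp
      then show ?thesis by (simp add: power2_diff)
    qed
    then show "AE x in lborel. x \<in> {- \<tau>..T} \<longrightarrow> norm (b x) \<le> norm (1 + (b x)\<^sup>2)" by simp
  qed
  have seg: "set_integrable lborel {0..s} (\<lambda>r. b (e + k * r))" if "k > 0" "- \<tau> \<le> e" for e k s
  proof -
    have "integrable lborel (\<lambda>r. indicator {e..e + k * s} (e + k * r) * b (e + k * r))"
      by (rule set_integral_affine(1)[OF _ set_integrable_subset[OF L1[of "e + k * s"]]]) (use that in auto)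
    also have "(\<lambda>r. indicator {e..e + k * s} (e + k * r) * b (e + k * r)) = (\<lambda>r. indicator {0..s} r * b (e + k * r))"
      using that by (auto simp: indicator_def fun_eq_iff zero_le_mult_iff)
    finally show ?thesis by (simp add: set_integrable_def)
  qed
  have bd: "set_integrable lborel {0..s} (\<lambda>r. \<beta> (t + r) 0)" if "0 \<le> t" "0 \<le> s" for t s
  proof -
    have "- \<tau> \<le> t - 1 / \<mu>" unfolding \<tau> using that \<tau>0 by linarith
    from seg[OF _ this, of 1 s] have "set_integrable lborel {0..s} (\<lambda>r. b (t - 1 / \<mu> + 1 * r))" by simp
    then show ?thesis
      by (rule set_integrable_cong[THEN iffD1, rotated 3]) (use that in \<open>auto simp: val algebra_simps\<close>)
  qed
  have al: "along_integrable lam \<beta>"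
    unfolding along_integrable_def
  proof (intro allI impI)
    fix t x s :: real
    assume t: "0 \<le> t" and s: "0 \<le> s" and D: "\<forall>r. 0 \<le> r \<longrightarrow> r \<le> s \<longrightarrow> 0 \<le> x + lam * r \<and> x + lam * r \<le> 1"
    have x: "0 \<le> x" "x \<le> 1" using D[rule_format, of 0] s by auto
    have "- \<tau> \<le> t - (1 - x) / \<mu>" using t xl[OF x] \<tau>0 by (simp add: \<tau> diff_divide_distrib)
    moreover have "0 < 1 + lam / \<mu>" using pos by (simp add: add_pos_pos)
    ultimately have "set_integrable lborel {0..s} (\<lambda>r. b (t - (1 - x) / \<mu> + (1 + lam / \<mu>) * r))" using seg by blast
    then show "set_integrable lborel {0..s} (\<lambda>r. \<beta> (t + r) (x + lam * r))"
    proof (rule set_integrable_cong[THEN iffD1, rotated 3])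
      fix r assume "r \<in> {0..s}"
      then have "\<beta> (t + r) (x + lam * r) = b (t + r - (1 - (x + lam * r)) / \<mu>)" using D t by (intro val) auto
      moreover have "t + r - (1 - (x + lam * r)) / \<mu> = t - (1 - x) / \<mu> + (1 + lam / \<mu>) * r"
        using pos by (simp add: field_simps)
      ultimately show "b (t - (1 - x) / \<mu> + (1 + lam / \<mu>) * r) = \<beta> (t + r) (x + lam * r)" by (simp only:)
    qed simp_all
  qed
  have am: "along_integrable (- \<mu>) \<alpha>"
    unfolding along_integrable_def
  proof (intro allI impI)
    fix t x s :: real
    assume t: "0 \<le> t" and s: "0 \<le> s" and D: "\<forall>r. 0 \<le> r \<longrightarrow> r \<le> s \<longrightarrow> 0 \<le> x + - \<mu> * r \<and> x + - \<mu> * r \<le> 1"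
    have x: "0 \<le> x" "x \<le> 1" using D[rule_format, of 0] s by auto
    have "- \<tau> \<le> t - x / lam - 1 / \<mu>" using t xl[OF x] by (simp add: \<tau>)
    moreover have "0 < 1 + \<mu> / lam" using pos by (simp add: add_pos_pos)
    ultimately have "set_integrable lborel {0..s} (\<lambda>r. b (t - x / lam - 1 / \<mu> + (1 + \<mu> / lam) * r))" using seg by blast
    then have "set_integrable lborel {0..s} (\<lambda>r. q * b (t - x / lam - 1 / \<mu> + (1 + \<mu> / lam) * r))" by simp
    then show "set_integrable lborel {0..s} (\<lambda>r. \<alpha> (t + r) (x + - \<mu> * r))"
    proof (rule set_integrable_cong[THEN iffD1, rotated 3])
      fix r assume "r \<in> {0..s}"
      then have "\<alpha> (t + r) (x + - \<mu> * r) = q * b (t + r - (x + - \<mu> * r) / lam - 1 / \<mu>)" using D t by (intro val) auto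
      moreover have "t + r - (x + - \<mu> * r) / lam - 1 / \<mu> = t - x / lam - 1 / \<mu> + (1 + \<mu> / lam) * r"
        using pos by (simp add: field_simps)
      ultimately show "q * b (t - x / lam - 1 / \<mu> + (1 + \<mu> / lam) * r) = \<alpha> (t + r) (x + - \<mu> * r)" by (simp only:)
    qed simp_all
  qed
  show "target_pair lam \<mu> q \<alpha> \<beta>"
    unfolding target_pair_def using ta T1 T2 bd al am by (simp add: val)
qed

text \<open>The neutral equation itself is the condition at x = 1 in disguise; the transport
  equations and the condition at x = 0 come from the wave form of \<alpha> and \<beta> and hold for
  any locally square-integrable signal \<open>B\<close>.\<close>

lemma neutral_solution_realized:
  assumes pos: "lam > 0" "\<mu> > 0" and q: "q \<noteq> 0" and \<tau>: "\<tau> = 1 / lam + 1 / \<mu>"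
    and S: "Linf_01 spm" "Linf_01 smp"
    and bk: "backstepping_kernels lam \<mu> q spm smp Kuu Kuv Kvu Kvv"
    and inv: "inverse_kernels Kuu Kuv Kvu Kvv Laa Lab Lba Lbb"
    and ns: "neutral_solution q \<rho> \<tau> (N_tilde lam \<mu> q \<rho> Laa Lab Lba Lbb) U B"
  shows "\<exists>u0 v0 u v. hyperbolic_solution lam \<mu> q \<rho> spm smp U u0 v0 u v \<and>
     (\<forall>t\<ge>- \<tau>. boundary_history lam \<mu> q (\<lambda>t x. u t x - volterra Kuu Kuv (u t) (v t) x)
        (\<lambda>t x. v t x - volterra Kvu Kvv (u t) (v t) x) t = B t)"
proof -
  \<comment> \<open>For t \<ge> 0 the waves read no value before -\<tau>; setting these values to 0
    makes \<open>b\<close> Borel on the whole line.\<close>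
  define b where "b = (\<lambda>r. indicator {- \<tau>..} r * B r)"
  have b: "b \<in> borel_measurable borel" and bB: "\<And>r. - \<tau> \<le> r \<Longrightarrow> b r = B r"
    using ns by (simp_all add: b_def neutral_solution_def set_borel_measurable_def)
  have sq: "set_integrable lborel {- \<tau>..T} (\<lambda>x. (b x)\<^sup>2)" for T
  proof -
    have "set_integrable lborel {- \<tau>..T} (\<lambda>x. (B x)\<^sup>2)" using ns by (simp add: neutral_solution_def)
    then show ?thesis by (rule set_integrable_cong[THEN iffD1, rotated 3]) (auto simp: bB)
  qed
  define \<alpha> where "\<alpha> = ext2 half_strip (\<lambda>t x. q * b (t - x / lam - 1 / \<mu>))"
  define \<beta> where "\<beta> = ext2 half_strip (\<lambda>t x. b (t - (1 - x) / \<mu>))"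
  note W = wave_target_pair(1,2)[OF pos \<tau> b sq, of q, folded \<alpha>_def \<beta>_def]
    wave_target_pair(3)[OF pos \<tau> b sq, folded \<beta>_def]
  have \<tau>0: "0 < 1 / lam" "0 < 1 / \<mu>" using pos by simp_all
  have val: "\<alpha> t x = q * B (t - x / lam - 1 / \<mu>)" "\<beta> t x = B (t - (1 - x) / \<mu>)" if "0 \<le> t" "0 \<le> x" "x \<le> 1" for t x
  proof -
    have "0 \<le> x / lam" "x / lam \<le> 1 / lam" "0 \<le> x / \<mu>" "x / \<mu> \<le> 1 / \<mu>"
      using that pos by (simp_all add: divide_right_mono)
    then have "- \<tau> \<le> t - x / lam - 1 / \<mu>" "- \<tau> \<le> t - (1 - x) / \<mu>"
      unfolding \<tau> diff_divide_distrib using that \<tau>0 by linarith+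
    then show "\<alpha> t x = q * B (t - x / lam - 1 / \<mu>)" "\<beta> t x = B (t - (1 - x) / \<mu>)"
      using that by (simp_all add: \<alpha>_def \<beta>_def ext2_def half_strip_def bB)
  qed
  have L: "Linf_triangle Laa" "Linf_triangle Lab" "Linf_triangle Lba" "Linf_triangle Lbb"
    using inv by (auto simp: inverse_kernels_def)
  note Lx = L[THEN Linf_triangle_ext2]
  define u where "u = (\<lambda>t x. \<alpha> t x + volterra (ext2 triangle Laa) (ext2 triangle Lab) (\<alpha> t) (\<beta> t) x)"
  define v where "v = (\<lambda>t x. \<beta> t x + volterra (ext2 triangle Lba) (ext2 triangle Lbb) (\<alpha> t) (\<beta> t) x)"
  have uv: "u t x = \<alpha> t x + volterra Laa Lab (\<alpha> t) (\<beta> t) x" "v t x = \<beta> t x + volterra Lba Lbb (\<alpha> t) (\<beta> t) x"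
    if "x \<le> 1" for t x using that by (simp_all add: u_def v_def volterra_ext2)
  have ta: "tame \<alpha>" "tame \<beta>" using W(1) by (auto simp: target_pair_def)
  have sb: "slab_bounded (\<lambda>t x. u t x - \<alpha> t x)" "slab_bounded (\<lambda>t x. v t x - \<beta> t x)"
    using slab_bounded_volterra[OF Lx(1,2) ta] slab_bounded_volterra[OF Lx(3,4) ta] by (simp_all add: u_def v_def)
  have tu: "tame u" "tame v"
    using tame_add[OF slab_bounded_tame[OF sb(1)] ta(1)] tame_add[OF slab_bounded_tame[OF sb(2)] ta(2)] by simp_all
  have Lu: "L2_continuous u" "L2_continuous v"
    unfolding u_def v_def
    by (intro L2_continuous_add W(2,3) L2_continuous_volterra Lx)+
  have Lab: "L2_01 (\<alpha> t)" "L2_01 (\<beta> t)" if "0 \<le> t" for t using W(2,3) that by (auto simp: L2_continuous_def)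
  \<comment> \<open>Here the second half of \<open>inverse_kernels\<close> enters: the direct
    transformation undoes the inverse one, so (u, v) satisfies the fixed-point equations of the
    Neumann iteration.\<close>
  have I: "\<alpha> t x = u t x - volterra Kuu Kuv (u t) (v t) x" "\<beta> t x = v t x - volterra Kvu Kvv (u t) (v t) x"
    if t: "0 \<le> t" and x: "0 \<le> x" "x \<le> 1" for t x
  proof -
    let ?u = "\<lambda>x. \<alpha> t x + volterra Laa Lab (\<alpha> t) (\<beta> t) x" and ?v = "\<lambda>x. \<beta> t x + volterra Lba Lbb (\<alpha> t) (\<beta> t) x"
    have "\<forall>x\<in>{0..1}. \<alpha> t x = ?u x - volterra Kuu Kuv ?u ?v x \<and> \<beta> t x = ?v x - volterra Kvu Kvv ?u ?v x"
      using inv Lab[OF t] unfolding inverse_kernels_def Let_def by blast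
    moreover have "volterra P Q (u t) (v t) x = volterra P Q ?u ?v x" for P Q
      by (rule volterra_cong) (use x uv in auto)
    ultimately show "\<alpha> t x = u t x - volterra Kuu Kuv (u t) (v t) x" "\<beta> t x = v t x - volterra Kvu Kvv (u t) (v t) x"
      using x uv by simp_all
  qed
  note rows = backstepping_kernel_rows[OF pos q S bk]
  note T = volterra_solution_transport[OF rows q W(1) sb]
  have T1: "transport_eq half_strip 1 lam u (\<lambda>t x. ext1 spm x * v t x)"
    and T2: "transport_eq half_strip 1 (- \<mu>) v (\<lambda>t x. ext1 smp x * u t x)"
    by (rule T; simp add: volterra_ext2 I)+
  have e1: "ext1 h x = h x" if "(t, x) \<in> half_strip" for h t x
    using that by (simp add: ext1_def half_strip_def)
  have sol: "hyperbolic_solution lam \<mu> q \<rho> spm smp U (u 0) (v 0) u v"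
    unfolding hyperbolic_solution_def
  proof (intro conjI allI impI)
    show "set_borel_measurable borel half_strip (case_prod u)" "set_borel_measurable borel half_strip (case_prod v)"
      by (intro set_borel_measurable_half_strip tame_measurable tu)+
    show "L2_continuous u" "L2_continuous v" by fact+
    show "transport_eq half_strip 1 lam u (\<lambda>t x. spm x * v t x)"
      by (rule transport_eq_cong[OF _ _ T1]) (simp_all add: e1)
    show "transport_eq half_strip 1 (- \<mu>) v (\<lambda>t x. smp x * u t x)"
      by (rule transport_eq_cong[OF _ _ T2]) (simp_all add: e1)
    show "L2_01 (u 0)" "L2_01 (v 0)" using Lu by (auto simp: L2_continuous_def)
    fix t :: real assume t: "0 < t"
    then show "u t 0 = q * v t 0" using val[of t 0] by (simp add: uv volterra_at_0)
    have t0: "0 \<le> t" using t by simp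
    note D = distributed_delay_integral(2)[OF pos \<tau> L L2_01_integrable(1)[OF Lab(1)[OF t0]] L2_01_integrable(1)[OF Lab(2)[OF t0]] val[OF t0], of \<rho>]
    have "B t = q * \<rho> * B (t - \<tau>) + U t - (LBINT \<nu>:{0..\<tau>}. N_tilde lam \<mu> q \<rho> Laa Lab Lba Lbb \<nu> * B (t - \<nu>))"
      using ns t by (simp add: neutral_solution_def)
    moreover have "\<alpha> t 1 = q * B (t - \<tau>)" "\<beta> t 1 = B t" using val[OF t0, of 1] by (simp_all add: \<tau> algebra_simps)
    ultimately show "v t 1 = \<rho> * u t 1 + U t" using D by (simp add: uv algebra_simps)
  qed simp_all
  moreover have "boundary_history lam \<mu> q (\<lambda>t x. u t x - volterra Kuu Kuv (u t) (v t) x)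
        (\<lambda>t x. v t x - volterra Kvu Kvv (u t) (v t) x) t = B t" if t: "- \<tau> \<le> t" for t
  proof -
    \<comment> \<open>The branches of the history: \<open>B\<close> is recovered from \<beta>(t, 1),
      from \<beta>(0, .) and from \<alpha>(0, .) / q.\<close>
    consider (a) "0 \<le> t" | (b) "t < 0" "- (1 / \<mu>) < t" | (c) "t \<le> - (1 / \<mu>)" by linarith
    then show ?thesis
    proof cases
      case a
      then show ?thesis using val(2)[of t 1] by (simp add: boundary_history_def flip: I)
    next
      case b
      have x: "0 \<le> 1 + \<mu> * t" "1 + \<mu> * t \<le> 1"
        using b pos by (simp_all add: field_simps mult_nonneg_nonpos)
      have "\<beta> 0 (1 + \<mu> * t) = B t" using val(2)[OF order_refl x] pos by simp
      then show ?thesis using b x by (simp add: boundary_history_def flip: I)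
    next
      case c
      define x where "x = - lam * (t + 1 / \<mu>)"
      have "x = lam * (- (1 / \<mu>) - t)" by (simp add: x_def algebra_simps)
      then have e: "x / lam = - (1 / \<mu>) - t" using pos by simp
      have "0 \<le> x / lam" "x / lam \<le> 1 / lam" unfolding e using c t by (simp_all add: \<tau>)
      then have x: "0 \<le> x" "x \<le> 1" using pos by (simp_all add: zero_le_divide_iff divide_le_cancel)
      have "\<alpha> 0 x = q * B t" using val(1)[OF order_refl x] by (simp add: e)
      moreover have "\<not> 0 \<le> t" "\<not> - (1 / \<mu>) < t" using c \<tau>0 by linarith+
      ultimately have "boundary_history lam \<mu> q (\<lambda>t x. u t x - volterra Kuu Kuv (u t) (v t) x)
          (\<lambda>t x. v t x - volterra Kvu Kvv (u t) (v t) x) t = (u 0 x - volterra Kuu Kuv (u 0) (v 0) x) / q"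
        by (simp only: boundary_history_def if_False x_def)
      then show ?thesis using I(1)[OF order_refl x, symmetric] \<open>\<alpha> 0 x = q * B t\<close> q by simp
    qed
  qed
  ultimately show ?thesis by blast
qed

text \<open>Equivalence of the two classes is made precise as a correspondence for each control
  \<open>U\<close>: the histories of solutions are exactly the solutions of the neutral equation,
  and a history determines the state at positive times.\<close>

theorem mainTheorem4:
  fixes lam \<mu> q \<rho> \<tau> :: real
    and spm smp :: "real \<Rightarrow> real"
    and Kuu Kuv Kvu Kvv Laa Lab Lba Lbb :: "real \<Rightarrow> real \<Rightarrow> real"
  assumes "lam > 0" and "\<mu> > 0" and "q \<noteq> 0"
    and "\<tau> = 1 / lam + 1 / \<mu>"
    and "Linf_01 spm" and "Linf_01 smp"
    and "backstepping_kernels lam \<mu> q spm smp Kuu Kuv Kvu Kvv"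
    and "inverse_kernels Kuu Kuv Kvu Kvv Laa Lab Lba Lbb"
  shows
    "let \<alpha> = (\<lambda>u v t x. u t x - volterra Kuu Kuv (u t) (v t) x);
         \<beta> = (\<lambda>u v t x. v t x - volterra Kvu Kvv (u t) (v t) x);
         \<beta>1 = (\<lambda>u v. boundary_history lam \<mu> q (\<alpha> u v) (\<beta> u v));
         N = N_tilde lam \<mu> q \<rho> Laa Lab Lba Lbb;
         sol = hyperbolic_solution lam \<mu> q \<rho> spm smp
     in
       (\<forall>U u0 v0 u v. sol U u0 v0 u v \<longrightarrow>
          (\<forall>t>0. \<forall>x\<in>{0..1}.
             \<alpha> u v t x = q * \<beta>1 u v (t - x / lam - 1 / \<mu>) \<and>
             \<beta> u v t x = \<beta>1 u v (t - (1 - x) / \<mu>)) \<and>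
          (\<forall>t>0. set_integrable lborel {0..\<tau>} (\<lambda>\<nu>. N \<nu> * \<beta>1 u v (t - \<nu>)) \<and>
             \<beta>1 u v t = q * \<rho> * \<beta>1 u v (t - \<tau>) + U t
               - (LBINT \<nu>:{0..\<tau>}. N \<nu> * \<beta>1 u v (t - \<nu>)))) \<and>
       (\<forall>U B. (\<exists>u0 v0 u v. sol U u0 v0 u v \<and> (\<forall>t\<ge>-\<tau>. \<beta>1 u v t = B t)) \<longleftrightarrow>
          neutral_solution q \<rho> \<tau> N U B) \<and>
       (\<forall>U u0 v0 u v u0' v0' u' v'.
          sol U u0 v0 u v \<and> sol U u0' v0' u' v' \<and> (\<forall>t\<ge>-\<tau>. \<beta>1 u v t = \<beta>1 u' v' t) \<longrightarrow>
          (\<forall>t>0. \<forall>x\<in>{0..1}. u t x = u' t x \<and> v t x = v' t x))"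
proof -
  note pos = assms(1,2) and q = assms(3) and \<tau> = assms(4) and S = assms(5,6) and bk = assms(7) and inv = assms(8)
  have \<tau>0: "0 \<le> \<tau>" using pos by (simp add: \<tau>)
  let ?\<alpha> = "\<lambda>u v t x. u t x - volterra Kuu Kuv (u t) (v t) x"
  let ?\<beta> = "\<lambda>u v t x. v t x - volterra Kvu Kvv (u t) (v t) x"
  let ?H = "\<lambda>u v. boundary_history lam \<mu> q (?\<alpha> u v) (?\<beta> u v)"
  let ?N = "N_tilde lam \<mu> q \<rho> Laa Lab Lba Lbb"
  let ?sol = "hyperbolic_solution lam \<mu> q \<rho> spm smp"
  note D = solution_delay_representation[OF pos q \<tau> S bk inv]
  have 1: "(\<forall>t>0. \<forall>x\<in>{0..1}. ?\<alpha> u v t x = q * ?H u v (t - x / lam - 1 / \<mu>) \<and> ?\<beta> u v t x = ?H u v (t - (1 - x) / \<mu>)) \<and>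
      (\<forall>t>0. set_integrable lborel {0..\<tau>} (\<lambda>\<nu>. ?N \<nu> * ?H u v (t - \<nu>)) \<and>
         ?H u v t = q * \<rho> * ?H u v (t - \<tau>) + U t - (LBINT \<nu>:{0..\<tau>}. ?N \<nu> * ?H u v (t - \<nu>)))"
    if "?sol U u0 v0 u v" for U u0 v0 u v
    using D(1)[OF that] D(2)[OF that] by blast
  have 2: "(\<exists>u0 v0 u v. ?sol U u0 v0 u v \<and> (\<forall>t\<ge>- \<tau>. ?H u v t = B t)) \<longleftrightarrow> neutral_solution q \<rho> \<tau> ?N U B" for U B
  proof
    assume "\<exists>u0 v0 u v. ?sol U u0 v0 u v \<and> (\<forall>t\<ge>- \<tau>. ?H u v t = B t)"
    then obtain u0 v0 u v where s: "?sol U u0 v0 u v" and B: "\<And>t. - \<tau> \<le> t \<Longrightarrow> ?H u v t = B t" by blast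
    show "neutral_solution q \<rho> \<tau> ?N U B"
      by (rule solution_neutral[OF \<tau>0 D(3)[OF s] D(2)[OF s] B])
  next
    assume "neutral_solution q \<rho> \<tau> ?N U B"
    then show "\<exists>u0 v0 u v. ?sol U u0 v0 u v \<and> (\<forall>t\<ge>- \<tau>. ?H u v t = B t)"
      by (rule neutral_solution_realized[OF pos q \<tau> S bk inv])
  qed
  have 3: "u t x = u' t x \<and> v t x = v' t x"
    if s: "?sol U u0 v0 u v" and s': "?sol U u0' v0' u' v'" and eq: "\<forall>t\<ge>- \<tau>. ?H u v t = ?H u' v' t"
      and t: "0 < t" and x: "x \<in> {0..1}" for U u0 v0 u v u0' v0' u' v' t x
  proof -
    \<comment> \<open>All delays in the representation are at most \<tau>, so for t > 0 only times
      from -\<tau> on are read, where the histories agree.\<close>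
    have ab: "?\<alpha> u v t \<xi> = ?\<alpha> u' v' t \<xi> \<and> ?\<beta> u v t \<xi> = ?\<beta> u' v' t \<xi>" if \<xi>: "\<xi> \<in> {0..1}" for \<xi>
    proof -
      have "0 \<le> \<xi> / lam" "\<xi> / lam \<le> 1 / lam" "0 \<le> \<xi> / \<mu>" "\<xi> / \<mu> \<le> 1 / \<mu>" "0 < 1 / lam"
        using \<xi> pos by (simp_all add: divide_right_mono)
      then have "- \<tau> \<le> t - \<xi> / lam - 1 / \<mu>" "- \<tau> \<le> t - (1 - \<xi>) / \<mu>"
        using t by (simp_all add: \<tau> diff_divide_distrib)
      then show ?thesis using D(1)[OF s t \<xi>] D(1)[OF s' t \<xi>] eq by simp
    qed
    have V: "volterra P Q (?\<alpha> u v t) (?\<beta> u v t) x = volterra P Q (?\<alpha> u' v' t) (?\<beta> u' v' t) x" for P Q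
      by (rule volterra_cong) (use ab x in auto)
    show ?thesis using D(4)[OF s t x] D(4)[OF s' t x] ab[OF x] V by metis
  qed
  show ?thesis
    unfolding Let_def
  proof (rule conjI[OF _ conjI])
    show "\<forall>U B. (\<exists>u0 v0 u v. ?sol U u0 v0 u v \<and> (\<forall>t\<ge>- \<tau>. ?H u v t = B t)) \<longleftrightarrow> neutral_solution q \<rho> \<tau> ?N U B"
      by (intro allI 2)
  qed (intro allI impI ballI; (elim conjE)?; rule 1 3; assumption)+
qed

end
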